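(* Let $(M^n,g)$ be an $n$-dimensional complete connected Riemannian manifold with $\mathrm{Ric}(M)\geq 0$, and let $H(x,y,t)$ be its heat kernel. Suppose that for every $\delta>0$ and all $x,y\in M$, $t>0$, $$H(x,y,t)\geq e^{-\delta}\,\frac{V_{\mathbb{R}^n}(R_{\delta}(t))}{V_x(R_{\delta}(t))}\,(4\pi t)^{-n/2}\exp\left[-\frac{d^2(x,y)}{4t}\right],\qquad R_{\delta}(t)=\frac{\sqrt{d^2(x,y)+4\delta t}-d(x,y)}{2}.$$ Then these lower bounds imply the Cheeger--Yau heat kernel comparison with Euclidean space: for all $x,y\in M$ and $t\in(0,\infty)$, $$H(x,y,t)\geq H^0(\bar x,\bar y,t)=\left(\frac{1}{4\pi t}\right)^{n/2}e^{-\frac{d^2(x,y)}{4t}},$$ where $\bar x,\bar y\in\mathbb{R}^n$ are any points with $d_{\mathbb{R}^n}(\bar x,\bar y)=d(x,y)$ and $H^0$ is the heat kernel of $\mathbb{R}^n$.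
   Context: The heat kernel $H(x,y,t)$ is the (minimal) heat kernel of $M$: a function on $M\times M\times(0,\infty)$ that is positive, symmetric in $x$ and $y$, and satisfies $(\Delta_y-\partial_t)H(x,y,t)=0$ with $\lim_{t\to0}H(x,y,t)=\delta_x(y)$, where $\delta_x$ is the point mass at $x$ and $\Delta$ is the (negative definite) Laplace--Beltrami operator. $d(x,y)$ is the Riemannian (geodesic) distance on $M$. $V_x(r)$ is the Riemannian volume of the geodesic ball $B_x(r)$ of radius $r$ centered at $x$ in $M$, and $V_{\mathbb{R}^n}(r)$ is the volume of a Euclidean ball of radius $r$ in $\mathbb{R}^n$. The content of the statement is the implication from the displayed family of lower bounds to the comparison inequality. *)

theory Defs
  imports "HOL-Analysis.Analysis"
begin

section \<open>Differentiability classes on open subsets of Euclidean space\<close>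

definition pd :: "'n::finite \<Rightarrow> (real ^ 'n \<Rightarrow> 'b::real_normed_vector) \<Rightarrow> real ^ 'n \<Rightarrow> 'b" where
  "pd i f z = frechet_derivative f (at z) (axis i 1)"

primrec iter_pd ::
  "'n::finite list \<Rightarrow> (real ^ 'n \<Rightarrow> 'b::real_normed_vector) \<Rightarrow> real ^ 'n \<Rightarrow> 'b" where
  "iter_pd [] f = f"
| "iter_pd (i # js) f = pd i (iter_pd js f)"

text \<open>Both notions below are meant for an open set \<open>S\<close> only.\<close>

definition Ck_on :: "nat \<Rightarrow> (real ^ 'n::finite) set \<Rightarrow> (real ^ 'n \<Rightarrow> 'b::real_normed_vector) \<Rightarrow> bool" where
  "Ck_on k S f \<longleftrightarrow>
     (\<forall>js. length js < k \<longrightarrow> (\<forall>z\<in>S. iter_pd js f differentiable (at z))) \<and>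
     (\<forall>js. length js \<le> k \<longrightarrow> continuous_on S (iter_pd js f))"

definition smooth_on :: "(real ^ 'n::finite) set \<Rightarrow> (real ^ 'n \<Rightarrow> 'b::real_normed_vector) \<Rightarrow> bool" where
  "smooth_on S f \<longleftrightarrow> (\<forall>k. Ck_on k S f)"

section \<open>Riemannian manifolds\<close>

text \<open>
  The manifold is the whole (second countable Hausdorff) type \<open>'m\<close>, its dimension is
  \<open>CARD('n)\<close>. A chart is a pair of its domain and its coordinate map; the values of the
  coordinate map off the domain are irrelevant.
\<close>

type_synonym ('m, 'n) chart = "'m set \<times> ('m \<Rightarrow> real ^ 'n)"

definition coords :: "('m, 'n::finite) chart \<Rightarrow> (real ^ 'n) set" where
  "coords c = snd c ` fst c"

definition chart_inv :: "('m, 'n::finite) chart \<Rightarrow> real ^ 'n \<Rightarrow> 'm" where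
  "chart_inv c = inv_into (fst c) (snd c)"

definition transition ::
  "('m, 'n::finite) chart \<Rightarrow> ('m, 'n) chart \<Rightarrow> real ^ 'n \<Rightarrow> real ^ 'n" where
  "transition c c' = snd c' \<circ> chart_inv c"

definition smooth_atlas :: "('m::topological_space, 'n::finite) chart set \<Rightarrow> bool" where
  "smooth_atlas A \<longleftrightarrow>
     (\<forall>c\<in>A. open (fst c) \<and> open (coords c) \<and>
        homeomorphism (fst c) (coords c) (snd c) (chart_inv c)) \<and>
     (\<Union>c\<in>A. fst c) = UNIV \<and>
     (\<forall>c\<in>A. \<forall>c'\<in>A. smooth_on (snd c ` (fst c \<inter> fst c')) (transition c c'))"

definition chart_at :: "('m, 'n::finite) chart set \<Rightarrow> 'm \<Rightarrow> ('m, 'n) chart" where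
  "chart_at A p = (SOME c. c \<in> A \<and> p \<in> fst c)"

text \<open>
  A Riemannian metric is given by its coefficient matrices \<open>g c z\<close> in each chart \<open>c\<close> at each
  coordinate point \<open>z\<close>; the last clause is the transformation law of a covariant 2-tensor.
\<close>

type_synonym ('m, 'n) metric_coeffs = "('m, 'n) chart \<Rightarrow> real ^ 'n \<Rightarrow> real ^ 'n ^ 'n"

definition riemannian_metric ::
  "('m, 'n::finite) chart set \<Rightarrow> ('m, 'n) metric_coeffs \<Rightarrow> bool" where
  "riemannian_metric A g \<longleftrightarrow>
     (\<forall>c\<in>A. smooth_on (coords c) (g c) \<and>
        (\<forall>z\<in>coords c. transpose (g c z) = g c z \<and> (\<forall>v. v \<noteq> 0 \<longrightarrow> 0 < v \<bullet> (g c z *v v)))) \<and>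
     (\<forall>c\<in>A. \<forall>c'\<in>A. \<forall>z \<in> snd c ` (fst c \<inter> fst c').
        let J = matrix (frechet_derivative (transition c c') (at z))
        in g c z = transpose J ** g c' (transition c c' z) ** J)"

definition riemannian_manifold ::
  "('m::{t2_space, second_countable_topology}, 'n::finite) chart set \<Rightarrow> ('m, 'n) metric_coeffs \<Rightarrow> bool" where
  "riemannian_manifold A g \<longleftrightarrow> smooth_atlas A \<and> riemannian_metric A g"

section \<open>Geodesic distance\<close>

definition C1_curve_on ::
  "('m::topological_space, 'n::finite) chart set \<Rightarrow> real \<Rightarrow> real \<Rightarrow> (real \<Rightarrow> 'm) \<Rightarrow> bool" where
  "C1_curve_on A a b \<gamma> \<longleftrightarrow>
     continuous_on {a..b} \<gamma> \<and>
     (\<forall>c\<in>A. \<exists>D. continuous_on {t\<in>{a..b}. \<gamma> t \<in> fst c} D \<and>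
        (\<forall>t\<in>{a..b}. \<gamma> t \<in> fst c \<longrightarrow>
           ((snd c \<circ> \<gamma>) has_vector_derivative D t) (at t within {a..b})))"

text \<open>\<open>K\<close> is a finite partition of \<open>[0,1]\<close>; \<open>\<gamma>\<close> is \<open>C\<^sup>1\<close> up to the endpoints on each of its pieces.\<close>

definition piecewise_C1_curve ::
  "('m::topological_space, 'n::finite) chart set \<Rightarrow> (real \<Rightarrow> 'm) \<Rightarrow> bool" where
  "piecewise_C1_curve A \<gamma> \<longleftrightarrow>
     (\<exists>K. finite K \<and> {0, 1} \<subseteq> K \<and> K \<subseteq> {0..1} \<and>
        (\<forall>a\<in>K. \<forall>b\<in>K. a < b \<and> K \<inter> {a<..<b} = {} \<longrightarrow> C1_curve_on A a b \<gamma>))"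

text \<open>By the transformation law the speed does not depend on the chart that \<open>chart_at\<close> picks.\<close>

definition speed ::
  "('m, 'n::finite) chart set \<Rightarrow> ('m, 'n) metric_coeffs \<Rightarrow> (real \<Rightarrow> 'm) \<Rightarrow> real \<Rightarrow> real" where
  "speed A g \<gamma> t =
     (let c = chart_at A (\<gamma> t); v = vector_derivative (snd c \<circ> \<gamma>) (at t)
      in sqrt (v \<bullet> (g c (snd c (\<gamma> t)) *v v)))"

definition curve_length ::
  "('m, 'n::finite) chart set \<Rightarrow> ('m, 'n) metric_coeffs \<Rightarrow> (real \<Rightarrow> 'm) \<Rightarrow> real" where
  "curve_length A g \<gamma> = integral {0..1} (speed A g \<gamma>)"

text \<open>On a connected manifold the set below is never empty, so the infimum is genuine.\<close>

definition geodesic_dist ::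
  "('m::topological_space, 'n::finite) chart set \<Rightarrow> ('m, 'n) metric_coeffs \<Rightarrow> 'm \<Rightarrow> 'm \<Rightarrow> real" where
  "geodesic_dist A g x y =
     Inf {curve_length A g \<gamma> | \<gamma>. piecewise_C1_curve A \<gamma> \<and> \<gamma> 0 = x \<and> \<gamma> 1 = y}"

definition geodesic_ball ::
  "('m::topological_space, 'n::finite) chart set \<Rightarrow> ('m, 'n) metric_coeffs \<Rightarrow> 'm \<Rightarrow> real \<Rightarrow> 'm set" where
  "geodesic_ball A g x r = {y. geodesic_dist A g x y < r}"

definition complete_riemannian ::
  "('m::topological_space, 'n::finite) chart set \<Rightarrow> ('m, 'n) metric_coeffs \<Rightarrow> bool" where
  "complete_riemannian A g \<longleftrightarrow> Metric_space.mcomplete UNIV (geodesic_dist A g)"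

section \<open>Riemannian volume\<close>

text \<open>The unique Borel measure that is \<open>sqrt (det g) dz\<close> in every chart.\<close>

definition riemannian_volume ::
  "('m::topological_space, 'n::finite) chart set \<Rightarrow> ('m, 'n) metric_coeffs \<Rightarrow> 'm measure" where
  "riemannian_volume A g =
     (THE \<mu>. sets \<mu> = sets borel \<and>
        (\<forall>c\<in>A. \<forall>B\<in>sets borel. B \<subseteq> fst c \<longrightarrow>
           emeasure \<mu> B = (\<integral>\<^sup>+ z\<in>snd c ` B. ennreal (sqrt (det (g c z))) \<partial>lborel)))"

section \<open>Ricci curvature and the Laplace--Beltrami operator\<close>

text \<open>In these coordinate formulas \<open>G\<close> is the coefficient matrix of the metric in one chart.\<close>

definition christoffel ::
  "(real ^ 'n \<Rightarrow> real ^ 'n ^ 'n::finite) \<Rightarrow> 'n \<Rightarrow> 'n \<Rightarrow> 'n \<Rightarrow> real ^ 'n \<Rightarrow> real" where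
  "christoffel G k i j z =
     (\<Sum>l\<in>UNIV. matrix_inv (G z) $ k $ l *
        (pd i (\<lambda>w. G w $ j $ l) z + pd j (\<lambda>w. G w $ i $ l) z - pd l (\<lambda>w. G w $ i $ j) z)) / 2"

text \<open>
  \<open>curvature G l k i j\<close> is the component along \<open>\<partial>\<^sub>l\<close> of \<open>R(\<partial>\<^sub>i,\<partial>\<^sub>j)\<partial>\<^sub>k\<close>, where
  \<open>R(X,Y) = [\<nabla>\<^sub>X,\<nabla>\<^sub>Y] - \<nabla>\<^bsub>[X,Y]\<^esub>\<close>; \<open>ricci\<close> is its trace in \<open>\<partial>\<^sub>i\<close>, so round spheres have
  positive Ricci curvature.
\<close>

definition curvature ::
  "(real ^ 'n \<Rightarrow> real ^ 'n ^ 'n::finite) \<Rightarrow> 'n \<Rightarrow> 'n \<Rightarrow> 'n \<Rightarrow> 'n \<Rightarrow> real ^ 'n \<Rightarrow> real" where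
  "curvature G l k i j z =
     pd i (christoffel G l j k) z - pd j (christoffel G l i k) z +
     (\<Sum>p\<in>UNIV. christoffel G l i p z * christoffel G p j k z -
                 christoffel G l j p z * christoffel G p i k z)"

definition ricci ::
  "(real ^ 'n \<Rightarrow> real ^ 'n ^ 'n::finite) \<Rightarrow> 'n \<Rightarrow> 'n \<Rightarrow> real ^ 'n \<Rightarrow> real" where
  "ricci G j k z = (\<Sum>i\<in>UNIV. curvature G i k i j z)"

definition ricci_nonneg ::
  "('m, 'n::finite) chart set \<Rightarrow> ('m, 'n) metric_coeffs \<Rightarrow> bool" where
  "ricci_nonneg A g \<longleftrightarrow>
     (\<forall>c\<in>A. \<forall>z\<in>coords c. \<forall>v. 0 \<le> (\<Sum>j\<in>UNIV. \<Sum>k\<in>UNIV. ricci (g c) j k z * v $ j * v $ k))"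

definition chart_laplacian ::
  "(real ^ 'n \<Rightarrow> real ^ 'n ^ 'n::finite) \<Rightarrow> (real ^ 'n \<Rightarrow> real) \<Rightarrow> real ^ 'n \<Rightarrow> real" where
  "chart_laplacian G f z =
     (\<Sum>i\<in>UNIV. pd i (\<lambda>w. \<Sum>j\<in>UNIV. sqrt (det (G w)) * matrix_inv (G w) $ i $ j * pd j f w) z)
       / sqrt (det (G z))"

definition laplace_beltrami ::
  "('m, 'n::finite) chart set \<Rightarrow> ('m, 'n) metric_coeffs \<Rightarrow> ('m \<Rightarrow> real) \<Rightarrow> 'm \<Rightarrow> real" where
  "laplace_beltrami A g f p =
     (let c = chart_at A p in chart_laplacian (g c) (f \<circ> chart_inv c) (snd c p))"

section \<open>Heat kernels\<close>

text \<open>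
  The regularity of a classical solution \<open>u y t\<close> of the heat equation on \<open>M \<times> (0,\<infinity>)\<close>:
  \<open>C\<^sup>2\<close> in space and \<open>C\<^sup>1\<close> in time, the derivatives being jointly continuous.
\<close>

definition C21 :: "('m, 'n::finite) chart set \<Rightarrow> ('m \<Rightarrow> real \<Rightarrow> real) \<Rightarrow> bool" where
  "C21 A u \<longleftrightarrow>
     (\<forall>c\<in>A.
        (\<forall>t>0. Ck_on 2 (coords c) (\<lambda>z. u (chart_inv c z) t)) \<and>
        (\<forall>js. length js \<le> 2 \<longrightarrow>
           continuous_on (coords c \<times> {0<..}) (\<lambda>(z, t). iter_pd js (\<lambda>w. u (chart_inv c w) t) z)) \<and>
        (\<forall>z\<in>coords c. \<forall>t>0. u (chart_inv c z) differentiable (at t)) \<and>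
        continuous_on (coords c \<times> {0<..}) (\<lambda>(z, t). deriv (u (chart_inv c z)) t))"

text \<open>
  The initial condition is weak convergence to the point mass at \<open>x\<close>, tested against
  continuous functions of compact support. Values of \<open>H x y t\<close> for \<open>t \<le> 0\<close> play no role.
\<close>

definition positive_fundamental_solution ::
  "('m::topological_space, 'n::finite) chart set \<Rightarrow> ('m, 'n) metric_coeffs \<Rightarrow>
   ('m \<Rightarrow> 'm \<Rightarrow> real \<Rightarrow> real) \<Rightarrow> bool" where
  "positive_fundamental_solution A g H \<longleftrightarrow>
     (\<forall>x y. \<forall>t>0. 0 < H x y t \<and> H x y t = H y x t) \<and>
     (\<forall>x. C21 A (H x)) \<and>
     (\<forall>x y. \<forall>t>0. laplace_beltrami A g (\<lambda>w. H x w t) y - deriv (H x y) t = 0) \<and>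
     (\<forall>x f. continuous_on UNIV f \<and> compact (closure {y. f y \<noteq> 0}) \<longrightarrow>
        ((\<lambda>t. LINT y|riemannian_volume A g. H x y t * f y) \<longlongrightarrow> f x) (at_right 0))"

definition heat_kernel ::
  "('m::topological_space, 'n::finite) chart set \<Rightarrow> ('m, 'n) metric_coeffs \<Rightarrow>
   ('m \<Rightarrow> 'm \<Rightarrow> real \<Rightarrow> real) \<Rightarrow> bool" where
  "heat_kernel A g H \<longleftrightarrow>
     positive_fundamental_solution A g H \<and>
     (\<forall>K. positive_fundamental_solution A g K \<longrightarrow> (\<forall>x y. \<forall>t>0. H x y t \<le> K x y t))"

section \<open>Euclidean space as a Riemannian manifold\<close>

definition euclidean_atlas :: "(real ^ 'n, 'n::finite) chart set" where
  "euclidean_atlas = {(UNIV, \<lambda>x. x)}"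

definition flat_metric :: "(real ^ 'n, 'n::finite) metric_coeffs" where
  "flat_metric = (\<lambda>c z. mat 1)"

section \<open>The comparison radius\<close>

text \<open>\<open>comparison_radius d \<delta> t\<close> is \<open>R\<^sub>\<delta>(t)\<close> for a pair of points at distance \<open>d\<close>.\<close>

definition comparison_radius :: "real \<Rightarrow> real \<Rightarrow> real \<Rightarrow> real" where
  "comparison_radius d \<delta> t = (sqrt (d\<^sup>2 + 4 * \<delta> * t) - d) / 2"

end

theory Submission
  imports Defs "HOL-Probability.Distributions"
begin

text \<open>
  The statement has two parts: the heat kernel of flat space is the Gaussian, and the given lower
  bounds yield the Gaussian lower bound for \<open>H\<close> when \<open>\<delta> \<rightarrow> 0\<close>.

  As \<open>\<delta> \<rightarrow> 0\<close>, the factor \<open>exp (- \<delta>)\<close> tends to \<open>1\<close> and the comparison radius tends to \<open>0\<close>, also when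
  the two points coincide. A Riemannian manifold looks Euclidean at small scales, so the ratio of
  the Euclidean to the Riemannian volume of balls of the same small radius tends to \<open>1\<close>. What
  enters is the lower bound for this limit, that is, an upper bound for the volume of a small
  geodesic ball, together with its positivity (\<open>small_geodesic_ball_volume\<close>). Its proof works in
  one chart around the centre, after a linear change of coordinates that makes the metric at the
  centre Euclidean (\<open>posdef_congruent_identity\<close>). A curve of length less than \<open>r\<close> from the centre
  cannot leave the ellipsoid of a slightly larger radius (\<open>short_curve_stays_in_chart\<close>), and the
  volume density is nearly constant there. To speak about volumes at all, the Riemannian volume
  has to be constructed by patching chart volumes (\<open>riemannian_volume_exists_unique\<close>), and geodesic
  balls have to be shown open (\<open>geodesic_ball_open\<close>).

  On flat space, the Gaussian is a positive fundamental solution (\<open>gauss_fundamental_solution\<close>), so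
  the minimal one is at most the Gaussian. Conversely every positive fundamental solution \<open>K\<close>
  dominates the Gaussian (\<open>gauss_minimal\<close>): the heat flow of a compactly supported datum below
  \<open>K x \<cdot> s\<close> decays at infinity, hence stays below the positive solution \<open>K\<close> by the minimum principle
  (\<open>parabolic_minimum_principle\<close>), and it tends to the Gaussian as \<open>s \<rightarrow> 0\<close>.
\<close>

section \<open>Change of variables in Euclidean space\<close>

text \<open>
  The theorem \<open>has_absolute_integral_change_of_variables\<close> asks for a well-ordered index type, whereas
  \<open>'n\<close> is merely finite. The type \<open>'n idx\<close> is a copy of \<open>'n\<close> made of the
  numbers below \<open>CARD('n)\<close>; it inherits their order, and the theorem is carried over along a
  bijection between the two index types.
\<close>

typedef ('n::finite) idx = "{..<CARD('n)}"
  by (metis finite_UNIV_card_ge_0 finite lessThan_iff)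

instantiation idx :: (finite) wellorder
begin
definition "less_eq_idx (i::'a idx) (j::'a idx) \<longleftrightarrow> Rep_idx i \<le> Rep_idx j"
definition "less_idx (i::'a idx) (j::'a idx) \<longleftrightarrow> Rep_idx i < Rep_idx j"
instance
proof
  fix P :: "'a idx \<Rightarrow> bool" and a
  assume step: "\<And>x. (\<And>y. y < x \<Longrightarrow> P y) \<Longrightarrow> P x"
  show "P a"
    by (induction a rule: measure_induct_rule[where f=Rep_idx])
       (auto intro: step simp: less_idx_def)
qed (auto simp: less_eq_idx_def less_idx_def Rep_idx_inject)
end

instance idx :: (finite) finite
proof
  have "(UNIV :: 'a idx set) = Abs_idx ` {..<CARD('a)}"
    by (metis type_definition.Abs_image type_definition_idx)
  then show "finite (UNIV :: 'a idx set)" by (metis finite_imageI finite_lessThan)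
qed

lemma ex_idx_bij: "\<exists>b :: 'n::finite idx \<Rightarrow> 'n. bij b"
proof -
  have "CARD('n idx) = CARD('n)"
    using type_definition.card[OF type_definition_idx] by simp
  then show ?thesis
    by (metis bij_betw_iff_card finite)
qed

text \<open>
  In the Leibniz formula the bijection conjugates permutations, and conjugation preserves signs.
\<close>

lemma det_reindex:
  fixes M :: "real^'n^'n" and b :: "'k::finite \<Rightarrow> 'n::finite"
  assumes b: "bij b"
  shows "det (\<chi> i j. M $ b i $ b j) = det M"
proof -
  have bb: "bij_betw b UNIV UNIV" using b .
  let ?m = "map_permutation UNIV b"
  let ?i = "map_permutation UNIV (inv b)"
  have m: "?m p permutes UNIV" if "p permutes UNIV" for p
    by (rule map_permutation_permutes[OF bb that])
  have mi: "?i p permutes UNIV" if "p permutes UNIV" for p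
    by (rule map_permutation_permutes[OF bij_imp_bij_inv[OF b] that])
  have mf: "?m p = b \<circ> p \<circ> inv b" for p
    using b by (auto simp: map_permutation_def restrict_id_def fun_eq_iff bij_is_surj)
  have mif: "?i p = inv b \<circ> p \<circ> b" for p
    using b by (auto simp: map_permutation_def restrict_id_def fun_eq_iff inv_inv_eq bij_is_surj bij_imp_bij_inv)
  have *: "b (inv b x) = x" "inv b (b y) = y" for x y
    using b by (simp_all add: bij_is_surj surj_f_inv_f bij_is_inj)
  have mm: "?m (?i p) = p" and mim: "?i (?m q) = q" for p q by (simp_all add: mf mif fun_eq_iff *)
  have "det M = (\<Sum>p | p permutes UNIV. of_int (sign p) * (\<Prod>i\<in>UNIV. M $ i $ p i))"
    by (simp add: det_def)
  also have "\<dots> = (\<Sum>p | p permutes (UNIV::'k set). of_int (sign (?m p)) * (\<Prod>i\<in>UNIV. M $ i $ (?m p) i))"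
    by (rule sum.reindex_bij_witness[where i="?m" and j="?i"])
       (use m mi in \<open>auto simp: mf[symmetric] mif[symmetric] fun_eq_iff mm mim\<close>)
  also have "\<dots> = (\<Sum>p | p permutes (UNIV::'k set). of_int (sign p) * (\<Prod>i\<in>UNIV. M $ b i $ b (p i)))"
  proof (rule sum.cong[OF refl])
    fix p :: "'k \<Rightarrow> 'k" assume "p \<in> {p. p permutes UNIV}"
    then have "sign (?m p) = sign p"
      using b by (intro sign_map_permutation) (auto simp: bij_is_inj)
    moreover have "(\<Prod>i\<in>UNIV. M $ i $ (?m p) i) = (\<Prod>i\<in>UNIV. M $ b i $ b (p i))"
      by (rule prod.reindex_bij_witness[where i=b and j="inv b"]) (auto simp: mf *)
    ultimately show "of_int (sign (?m p)) * (\<Prod>i\<in>UNIV. M $ i $ (?m p) i)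
        = of_int (sign p) * (\<Prod>i\<in>UNIV. M $ b i $ b (p i))" by simp
  qed
  also have "\<dots> = det (\<chi> i j. M $ b i $ b j)" by (simp add: det_def)
  finally show ?thesis by simp
qed

text \<open>
  Renaming coordinates maps boxes to boxes of the same volume, and boxes determine Lebesgue
  measure.
\<close>

lemma lborel_reindex:
  fixes b :: "'k::finite \<Rightarrow> 'n::finite"
  assumes b: "bij b"
  shows "distr lborel borel (\<lambda>x::real^'n. \<chi> i. x $ b i) = (lborel :: (real^'k) measure)"
proof (rule lborel_eqI[symmetric])
  have [measurable]: "(\<lambda>x::real^'n. (\<chi> i. x $ b i) :: real^'k) \<in> borel_measurable borel"
    by (intro borel_measurable_continuous_onI continuous_intros)
  fix l u :: "real^'k"
  assume lu: "\<And>c. c \<in> Basis \<Longrightarrow> l \<bullet> c \<le> u \<bullet> c"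
  have lu': "l $ i \<le> u $ i" for i
    using lu[of "axis i 1"] by (auto simp: Basis_vec_def inner_axis)
  have *: "b (inv b x) = x" "inv b (b y) = y" for x y
    using b by (simp_all add: bij_is_surj surj_f_inv_f bij_is_inj)
  let ?l = "(\<chi> j. l $ inv b j) :: real^'n" and ?u = "(\<chi> j. u $ inv b j) :: real^'n"
  have B: "(\<Prod>c\<in>Basis. (x::real^'a::finite) \<bullet> c) = (\<Prod>i\<in>UNIV. x $ i)" for x
  proof -
    have "(\<Prod>c\<in>Basis. x \<bullet> c) = prod (\<lambda>c. x \<bullet> c) ((\<lambda>i. axis i 1) ` UNIV)"
      by (rule prod.cong) (auto simp: Basis_vec_def)
    also have "\<dots> = (\<Prod>i\<in>UNIV. x $ i)"
      by (subst prod.reindex) (auto simp: inj_on_def axis_eq_axis inner_axis)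
    finally show ?thesis .
  qed
  have "(\<lambda>x::real^'n. (\<chi> i. x $ b i) :: real^'k) -` box l u = box ?l ?u"
    by (auto simp: mem_box_cart) (metis *)+
  then have "emeasure (distr lborel borel (\<lambda>x::real^'n. \<chi> i. x $ b i)) (box l u) = emeasure lborel (box ?l ?u)"
    by (simp add: emeasure_distr)
  also have "\<dots> = (\<Prod>c\<in>Basis. (?u - ?l) \<bullet> c)"
    by (rule emeasure_lborel_box) (use lu' in \<open>auto simp: Basis_vec_def inner_axis\<close>)
  also have "(\<Prod>c\<in>Basis. (?u - ?l) \<bullet> c) = (\<Prod>c\<in>Basis. (u - l) \<bullet> c)"
    unfolding B by (rule prod.reindex_bij_witness[where i=b and j="inv b"]) (auto simp: *)
  finally show "emeasure (distr lborel borel (\<lambda>x::real^'n. \<chi> i. x $ b i)) (box l u) = (\<Prod>c\<in>Basis. (u - l) \<bullet> c)" .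
qed simp

text \<open>
  Separating the integrable from the non-integrable case turns an equivalence between absolute
  integrability and values of the gauge integral into one equation in \<open>[0,\<infinity>]\<close>.
\<close>

lemma nn_integral_indicator_eq_integral:
  fixes h :: "'a::euclidean_space \<Rightarrow> real"
  assumes m: "(\<lambda>x. indicator S x * h x) \<in> borel_measurable borel" and nn: "\<And>x. x \<in> S \<Longrightarrow> 0 \<le> h x"
  shows "(\<integral>\<^sup>+x. ennreal (indicator S x * h x) \<partial>lborel) =
     (if h absolutely_integrable_on S then ennreal (integral S h) else \<infinity>)"
proof -
  have m': "(\<lambda>x. indicator S x * h x) \<in> borel_measurable lebesgue"
    using m by (simp add: measurable_completion)
  have eq: "(\<integral>\<^sup>+x. ennreal (indicator S x * h x) \<partial>lborel) = (\<integral>\<^sup>+x. ennreal (indicator S x * h x) \<partial>lebesgue)"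
    by (rule nn_integral_completion[symmetric])
  show ?thesis
  proof (cases "h absolutely_integrable_on S")
    case True
    then have "integrable lebesgue (\<lambda>x. indicator S x * h x)"
      by (simp add: set_integrable_def)
    then have "(\<integral>\<^sup>+x. ennreal (indicator S x * h x) \<partial>lebesgue) = ennreal (\<integral>x. indicator S x * h x \<partial>lebesgue)"
      by (rule nn_integral_eq_integral) (auto simp: nn indicator_def)
    also have "(\<integral>x. indicator S x * h x \<partial>lebesgue) = integral S h"
      using set_lebesgue_integral_eq_integral(2)[OF True] by (simp add: set_lebesgue_integral_def)
    finally show ?thesis using True eq by simp
  next
    case False
    have "(\<integral>\<^sup>+x. ennreal (indicator S x * h x) \<partial>lebesgue) = \<infinity>"
    proof (rule ccontr)
      assume "\<not> ?thesis"
      then have "integrable lebesgue (\<lambda>x. indicator S x * h x)"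
        by (intro integrableI_nonneg m') (auto simp: nn indicator_def less_top)
      with False show False by (simp add: set_integrable_def)
    qed
    with False eq show ?thesis by simp
  qed
qed

lemma nn_integral_change_of_variables_wellorder:
  fixes T :: "real^'n::{finite,wellorder} \<Rightarrow> real^'n::_" and f :: "real^'n::_ \<Rightarrow> real"
  assumes S: "S \<in> sets borel"
    and der: "\<And>x. x \<in> S \<Longrightarrow> (T has_derivative T' x) (at x within S)"
    and inj: "inj_on T S"
    and mf: "(\<lambda>y. indicator (T ` S) y * f y) \<in> borel_measurable borel"
    and mf': "(\<lambda>x. indicator S x * (\<bar>det (matrix (T' x))\<bar> * f (T x))) \<in> borel_measurable borel"
    and nn: "\<And>y. y \<in> T ` S \<Longrightarrow> 0 \<le> f y"
  shows "(\<integral>\<^sup>+y. ennreal (indicator (T ` S) y * f y) \<partial>lborel) =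
         (\<integral>\<^sup>+x. ennreal (indicator S x * (\<bar>det (matrix (T' x))\<bar> * f (T x))) \<partial>lborel)"
proof -
  let ?F = "\<lambda>x. \<bar>det (matrix (T' x))\<bar> * f (T x)"
  have S': "S \<in> sets lebesgue" using S by simp
  have cov: "?F absolutely_integrable_on S \<and> integral S ?F = b \<longleftrightarrow>
     f absolutely_integrable_on (T ` S) \<and> integral (T ` S) f = b" for b
  proof -
    have "(\<lambda>x. \<bar>det (matrix (T' x))\<bar> *\<^sub>R (vec (f (T x)) :: real^1)) absolutely_integrable_on S \<and>
           integral S (\<lambda>x. \<bar>det (matrix (T' x))\<bar> *\<^sub>R (vec (f (T x)) :: real^1)) = vec b
     \<longleftrightarrow> (\<lambda>y. vec (f y) :: real^1) absolutely_integrable_on (T ` S) \<and> integral (T ` S) (\<lambda>y. vec (f y) :: real^1) = vec b"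
      by (rule has_absolute_integral_change_of_variables[OF S' der inj])
    then show ?thesis
      unfolding absolutely_integrable_on_1_iff integral_on_1_eq
      by (simp add: vec_eq_iff)
  qed
  have "?F absolutely_integrable_on S \<longleftrightarrow> f absolutely_integrable_on (T ` S)"
    using cov by blast
  moreover have "?F absolutely_integrable_on S \<Longrightarrow> integral S ?F = integral (T ` S) f"
    using cov by blast
  ultimately show ?thesis
    by (subst nn_integral_indicator_eq_integral[OF mf nn], simp,
        subst nn_integral_indicator_eq_integral[OF mf']) (auto intro!: nn mult_nonneg_nonneg)
qed

text \<open>
  The substitution is conjugated with the renaming of coordinates, which changes neither Lebesgue
  measure nor the Jacobian determinant.
\<close>

lemma nn_integral_change_of_variables:
  fixes T :: "real^'n::finite \<Rightarrow> real^'n" and f :: "real^'n \<Rightarrow> real"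
  assumes S: "S \<in> sets borel"
    and der: "\<And>x. x \<in> S \<Longrightarrow> (T has_derivative T' x) (at x within S)"
    and inj: "inj_on T S"
    and mf: "(\<lambda>y. indicator (T ` S) y * f y) \<in> borel_measurable borel"
    and mf': "(\<lambda>x. indicator S x * (\<bar>det (matrix (T' x))\<bar> * f (T x))) \<in> borel_measurable borel"
    and nn: "\<And>y. y \<in> T ` S \<Longrightarrow> 0 \<le> f y"
  shows "(\<integral>\<^sup>+y. ennreal (indicator (T ` S) y * f y) \<partial>lborel) =
         (\<integral>\<^sup>+x. ennreal (indicator S x * (\<bar>det (matrix (T' x))\<bar> * f (T x))) \<partial>lborel)"
proof -
  obtain b :: "'n idx \<Rightarrow> 'n" where b: "bij b" using ex_idx_bij by blast
  have bs: "b (inv b x) = x" "inv b (b y) = y" for x y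
    using b by (simp_all add: bij_is_surj surj_f_inv_f bij_is_inj)
  define r where "r = (\<lambda>x::real^'n. (\<chi> i. x $ b i) :: real^'n idx)"
  define r' where "r' = (\<lambda>x::real^'n idx. (\<chi> i. x $ inv b i) :: real^'n)"
  have rr [simp]: "r (r' x) = x" "r' (r y) = y" for x y
    by (simp_all add: r_def r'_def bs vec_eq_iff)
  have lin: "bounded_linear r" "bounded_linear r'"
    unfolding r_def r'_def linear_conv_bounded_linear[symmetric]
    by (auto intro!: linearI simp: vec_eq_iff)
  have [measurable]: "r \<in> borel_measurable borel" "r' \<in> borel_measurable borel"
    using lin by (auto intro!: borel_measurable_continuous_onI linear_continuous_on)
  have lb: "(lborel :: (real^'n idx) measure) = distr lborel borel r"
    unfolding r_def using lborel_reindex[OF b] by simp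
  let ?T = "r \<circ> T \<circ> r'" and ?T' = "\<lambda>x. r \<circ> T' (r' x) \<circ> r'" and ?f = "f \<circ> r'"
  have img: "?T ` (r ` S) = r ` (T ` S)" by (auto simp: image_comp)
  have ri: "indicator (r ` A) (r y) = (indicator A y :: real)" for A y
    by (auto simp: indicator_def) (metis rr(2))
  have ri': "indicator (r ` A) x = (indicator A (r' x) :: real)" for A x
    using ri[of A "r' x"] by simp
  have rS: "r ` A = r' -` A" for A
    by (auto simp: image_iff) (metis rr(1))
  have det: "det (matrix (?T' x)) = det (matrix (T' (r' x)))" for x
  proof -
    have ax: "r' (axis j 1) = axis (b j) 1" for j
      by (auto simp: r'_def axis_def vec_eq_iff bs)
    have "matrix (?T' x) = (\<chi> i j. matrix (T' (r' x)) $ b i $ b j)"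
      by (simp add: matrix_def ax r_def)
    then show ?thesis using det_reindex[OF b] by metis
  qed
  have "(\<integral>\<^sup>+y. ennreal (indicator (?T ` (r ` S)) y * ?f y) \<partial>lborel) =
         (\<integral>\<^sup>+x. ennreal (indicator (r ` S) x * (\<bar>det (matrix (?T' x))\<bar> * ?f (?T x))) \<partial>lborel)"
  proof (rule nn_integral_change_of_variables_wellorder)
    show "r ` S \<in> sets borel"
      unfolding rS using S measurable_sets[of r' borel borel S] by simp
    show "(?T has_derivative ?T' x) (at x within r ` S)" if "x \<in> r ` S" for x
    proof -
      have x: "r' x \<in> S" using that by auto
      have 1: "(r' has_derivative r') (at x within r ` S)"
        using lin(2) by (rule bounded_linear_imp_has_derivative)
      have "(T \<circ> r' has_derivative T' (r' x) \<circ> r') (at x within r ` S)"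
        by (rule diff_chain_within[OF 1]) (use der[OF x] in \<open>simp add: image_comp o_def\<close>)
      from diff_chain_within[OF this bounded_linear_imp_has_derivative[OF lin(1)]]
      show ?thesis by (simp add: o_assoc)
    qed
    show "inj_on ?T (r ` S)"
      using inj by (auto simp: inj_on_def) (metis rr(2))
    show "(\<lambda>y. indicator (?T ` r ` S) y * ?f y) \<in> borel_measurable borel"
      unfolding img unfolding ri' o_def using mf by (rule measurable_compose[rotated]) simp
    show "(\<lambda>x. indicator (r ` S) x * (\<bar>det (matrix (?T' x))\<bar> * ?f (?T x))) \<in> borel_measurable borel"
      unfolding det unfolding ri' o_def rr using mf' by (rule measurable_compose[rotated]) simp
    show "0 \<le> ?f y" if "y \<in> ?T ` r ` S" for y
      using that nn by (auto simp: image_comp)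
  qed
  moreover have tr: "(\<integral>\<^sup>+y. ennreal (h (r' y)) \<partial>lborel) = (\<integral>\<^sup>+x. ennreal (h x) \<partial>lborel)"
    if [measurable]: "h \<in> borel_measurable borel" for h :: "real^'n \<Rightarrow> real"
    unfolding lb by (subst nn_integral_distr) simp_all
  ultimately show ?thesis
    unfolding img det ri' o_apply rr by (simp only: tr[OF mf] tr[OF mf'])
qed

section \<open>Positive definite matrices\<close>

text \<open>
  Gram--Schmidt for the inner product with matrix \<open>G\<close>, adding one index at a time. As long as an
  index is missing, the vectors found so far span a proper subspace, so a further vector exists.
\<close>

lemma gram_schmidt_partial:
  fixes G :: "real^'n^'n::finite"
  assumes sym: "transpose G = G" and pos: "\<And>v. v \<noteq> 0 \<Longrightarrow> 0 < v \<bullet> (G *v v)"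
  shows "finite S \<Longrightarrow> \<exists>b :: 'n \<Rightarrow> real^'n. \<forall>i\<in>S. \<forall>j\<in>S. b i \<bullet> (G *v b j) = (if i = j then 1 else 0)"
proof (induction S rule: finite_induct)
  case (insert k S)
  have symm: "u \<bullet> (G *v v) = v \<bullet> (G *v u)" for u v
    by (metis sym dot_lmul_matrix inner_commute transpose_matrix_vector)
  obtain b where b: "\<And>i j. i \<in> S \<Longrightarrow> j \<in> S \<Longrightarrow> b i \<bullet> (G *v b j) = (if i = j then 1 else 0)"
    using insert.IH by blast
  have "card (insert k S) \<le> CARD('n)" by (rule card_mono) auto
  with insert have "card S < CARD('n)" by simp
  moreover have "dim (span (b ` S)) \<le> card (b ` S)"
    by (simp add: dim_le_card' insert.hyps(1))
  moreover have "card (b ` S) \<le> card S" by (rule card_image_le) (rule insert)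
  ultimately have "dim (span (b ` S)) < DIM(real^'n)" by simp
  then have "span (b ` S) \<noteq> UNIV" by (metis dim_UNIV less_irrefl)
  then obtain v where v: "v \<notin> span (b ` S)" by blast
  define w where "w = v - (\<Sum>i\<in>S. (b i \<bullet> (G *v v)) *\<^sub>R b i)"
  have "w \<noteq> 0"
  proof
    assume "w = 0"
    then have "v = (\<Sum>i\<in>S. (b i \<bullet> (G *v v)) *\<^sub>R b i)" by (simp add: w_def)
    also have "\<dots> \<in> span (b ` S)" by (intro span_sum span_scale span_base) auto
    finally show False using v by simp
  qed
  have ortho: "b i \<bullet> (G *v w) = 0" if "i \<in> S" for i
  proof -
    have "b i \<bullet> (G *v w) = b i \<bullet> (G *v v) - (\<Sum>j\<in>S. (b j \<bullet> (G *v v)) * (b i \<bullet> (G *v b j)))"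
      unfolding w_def
      by (simp add: matrix_vector_mult_diff_distrib inner_diff_right linear_sum[OF matrix_vector_mul_linear]
          inner_sum_right matrix_vector_mult_scaleR)
    also have "(\<Sum>j\<in>S. (b j \<bullet> (G *v v)) * (b i \<bullet> (G *v b j))) = (\<Sum>j\<in>S. if j = i then b j \<bullet> (G *v v) else 0)"
      by (rule sum.cong) (use b that in auto)
    also have "\<dots> = b i \<bullet> (G *v v)" using that insert by simp
    finally show ?thesis by simp
  qed
  define a where "a = sqrt (w \<bullet> (G *v w))"
  have a: "a > 0" "a * a = w \<bullet> (G *v w)" using pos[OF \<open>w \<noteq> 0\<close>] by (auto simp: a_def)
  define c where "c = b(k := (1 / a) *\<^sub>R w)"
  have ck: "c k = (1 / a) *\<^sub>R w" "\<And>i. i \<in> S \<Longrightarrow> c i = b i" using insert by (auto simp: c_def)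
  have kk: "c k \<bullet> (G *v c k) = 1"
    using a by (simp add: ck matrix_vector_mult_scaleR a(2)[symmetric])
  have ik: "c i \<bullet> (G *v c k) = 0" "c k \<bullet> (G *v c i) = 0" if "i \<in> S" for i
    using ortho[OF that] symm[of w "b i"] that by (simp_all add: ck matrix_vector_mult_scaleR)
  show ?case
  proof (intro exI[of _ c] ballI)
    fix i j assume "i \<in> insert k S" "j \<in> insert k S"
    moreover have "c i \<bullet> (G *v c j) = (if i = j then 1 else 0)" if "i \<in> S" "j \<in> S"
      using b[OF that] that by (simp add: ck)
    ultimately show "c i \<bullet> (G *v c j) = (if i = j then 1 else 0)"
      using kk ik insert.hyps(2) by fastforce
  qed
qed auto

text \<open>
  The columns of \<open>P\<close> form a basis that is orthonormal for \<open>G\<close>. In the coordinates that \<open>P\<close>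
  introduces, a metric with matrix \<open>G\<close> is the Euclidean one; this replaces the choice of
  normal coordinates at a point.
\<close>

lemma posdef_congruent_identity:
  fixes G :: "real^'n^'n::finite"
  assumes sym: "transpose G = G" and pos: "\<And>v. v \<noteq> 0 \<Longrightarrow> 0 < v \<bullet> (G *v v)"
  obtains P :: "real^'n^'n" where "transpose P ** G ** P = mat 1"
proof -
  obtain b :: "'n \<Rightarrow> real^'n" where b: "\<And>i j. b i \<bullet> (G *v b j) = (if i = j then 1 else 0)"
    using gram_schmidt_partial[OF assms, of UNIV] by auto
  define P :: "real^'n^'n" where "P = (\<chi> i j. b j $ i)"
  have col: "P *v axis j 1 = b j" for j
    by (simp add: matrix_vector_mul_component vec_eq_iff P_def inner_axis matrix_vector_mult_basis column_def)
  have "(transpose P ** G ** P) $ i $ j = b i \<bullet> (G *v b j)" for i j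
  proof -
    have "(transpose P ** G ** P) $ i $ j = axis i 1 \<bullet> ((transpose P ** G ** P) *v axis j 1)"
      by (simp add: inner_axis' matrix_vector_mult_basis column_def)
    also have "\<dots> = axis i 1 \<bullet> (transpose P *v (G *v (P *v axis j 1)))"
      by (simp add: matrix_vector_mul_assoc matrix_mul_assoc)
    also have "\<dots> = (P *v axis i 1) \<bullet> (G *v (P *v axis j 1))"
      by (metis dot_lmul_matrix transpose_transpose transpose_matrix_vector vector_transpose_matrix)
    finally show ?thesis by (simp add: col)
  qed
  then have "transpose P ** G ** P = mat 1"
    by (simp add: vec_eq_iff mat_def b)
  then show ?thesis by (rule that)
qed

lemma posdef_det_pos:
  fixes G :: "real^'n^'n::finite"
  assumes "transpose G = G" and "\<And>v. v \<noteq> 0 \<Longrightarrow> 0 < v \<bullet> (G *v v)"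
  shows "0 < det G"
proof -
  obtain P :: "real^'n^'n" where "transpose P ** G ** P = mat 1" using posdef_congruent_identity[OF assms] by blast
  then have "det (transpose P ** G ** P) = 1" by simp
  then have "(det P)\<^sup>2 * det G = 1" by (simp add: det_mul power2_eq_square algebra_simps)
  then have "0 < (det P)\<^sup>2 * det G" by simp
  then show ?thesis by (simp add: zero_less_mult_iff)
qed

section \<open>Charts, transition maps and metric coefficients\<close>

lemma smooth_atlasD:
  assumes "smooth_atlas A" "c \<in> A"
  shows chart_open: "open (fst c)" and coords_open: "open (coords c)"
    and chart_homeomorphism: "homeomorphism (fst c) (coords c) (snd c) (chart_inv c)"
  using assms by (auto simp: smooth_atlas_def)

lemma chart_inverses:
  assumes "smooth_atlas A" "c \<in> A"
  shows chart_inv_chart: "p \<in> fst c \<Longrightarrow> chart_inv c (snd c p) = p"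
    and chart_chart_inv: "z \<in> coords c \<Longrightarrow> snd c (chart_inv c z) = z"
    and chart_inv_in: "z \<in> coords c \<Longrightarrow> chart_inv c z \<in> fst c"
    and chart_in: "p \<in> fst c \<Longrightarrow> snd c p \<in> coords c"
    and chart_cont: "continuous_on (fst c) (snd c)"
    and chart_inv_cont: "continuous_on (coords c) (chart_inv c)"
  using chart_homeomorphism[OF assms] by (auto simp: homeomorphism_def)

lemma chart_inj:
  assumes "smooth_atlas A" "c \<in> A"
  shows "inj_on (snd c) (fst c)"
  using chart_inv_chart[OF assms] by (rule inj_on_inverseI)

lemma chart_at_in:
  assumes "smooth_atlas A"
  shows "chart_at A p \<in> A" "p \<in> fst (chart_at A p)"
proof -
  have "p \<in> (\<Union>c\<in>A. fst c)" using assms by (simp add: smooth_atlas_def)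
  then have "\<exists>c. c \<in> A \<and> p \<in> fst c" by blast
  from someI_ex[OF this] show "chart_at A p \<in> A" "p \<in> fst (chart_at A p)"
    by (auto simp: chart_at_def)
qed

lemma chart_image_eq:
  assumes "smooth_atlas A" "c \<in> A"
  shows "snd c ` (fst c \<inter> U) = coords c \<inter> chart_inv c -` U"
proof -
  note i = chart_inverses[OF assms]
  show ?thesis by (auto simp: i) (metis IntI i(2) i(3) image_iff)
qed

lemma overlap_open:
  assumes "smooth_atlas A" "c \<in> A" "open U"
  shows "open (snd c ` (fst c \<inter> U))"
  unfolding chart_image_eq[OF assms(1,2)]
  using chart_inv_cont[OF assms(1,2)] coords_open[OF assms(1,2)] assms(3)
  by (rule continuous_open_preimage)

lemma chart_image_borel:
  assumes "smooth_atlas A" "c \<in> A" "B \<in> sets borel" "B \<subseteq> fst c"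
  shows "snd c ` B \<in> sets borel"
proof -
  have co: "coords c \<in> sets borel" using coords_open[OF assms(1,2)] by simp
  have "chart_inv c \<in> measurable (restrict_space borel (coords c)) borel"
    by (rule borel_measurable_continuous_on_restrict[OF chart_inv_cont[OF assms(1,2)]])
  from measurable_sets[OF this assms(3)]
  have "chart_inv c -` B \<inter> coords c \<in> sets borel"
    using co by (simp add: space_restrict_space sets_restrict_space_iff)
  moreover have "snd c ` B = chart_inv c -` B \<inter> coords c"
    using chart_image_eq[OF assms(1,2), of B] assms(4) by (simp add: Int_absorb1 Int_absorb2 Int_commute)
  ultimately show ?thesis by simp
qed

lemma transition_image:
  assumes "smooth_atlas A" "c \<in> A" "c' \<in> A" "B \<subseteq> fst c"
  shows "transition c c' ` (snd c ` B) = snd c' ` B"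
proof -
  have "transition c c' (snd c b) = snd c' b" if "b \<in> B" for b
    using chart_inv_chart[OF assms(1,2)] that assms(4) by (auto simp: transition_def)
  then show ?thesis by (force simp: image_image)
qed

lemma smooth_on_differentiable: "smooth_on S f \<Longrightarrow> z \<in> S \<Longrightarrow> f differentiable (at z)"
  unfolding smooth_on_def Ck_on_def
  by (drule spec[of _ 1]) (auto dest!: spec[of _ "[]"])

lemma smooth_on_continuous: "smooth_on S f \<Longrightarrow> continuous_on S f"
  unfolding smooth_on_def Ck_on_def
  by (drule spec[of _ 0]) auto

lemma smooth_on_pd_continuous: "smooth_on S f \<Longrightarrow> continuous_on S (pd i f)"
  unfolding smooth_on_def Ck_on_def
  by (drule spec[of _ 1]) (auto dest!: spec[of _ "[i]"])

lemma frechet_derivative_eq_pd: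
  assumes "f differentiable (at z)"
  shows "frechet_derivative f (at z) v = (\<Sum>i\<in>UNIV. v $ i *\<^sub>R pd i f z)"
proof -
  have lin: "linear (frechet_derivative f (at z))"
    using linear_frechet_derivative[OF assms] .
  have "frechet_derivative f (at z) v = frechet_derivative f (at z) (\<Sum>i\<in>UNIV. v $ i *\<^sub>R axis i 1)"
    by (simp add: basis_expansion scalar_mult_eq_scaleR[symmetric])
  also have "\<dots> = (\<Sum>i\<in>UNIV. v $ i *\<^sub>R pd i f z)"
    by (simp add: linear_sum[OF lin] linear_scale[OF lin] pd_def)
  finally show ?thesis .
qed

lemma riemannian_manifoldD:
  assumes "riemannian_manifold A g"
  shows manifold_atlas: "smooth_atlas A" and manifold_metric: "riemannian_metric A g"
  using assms by (auto simp: riemannian_manifold_def)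

lemma metricD:
  assumes "riemannian_metric A g" "c \<in> A"
  shows metric_cont: "continuous_on (coords c) (g c)"
    and metric_sym: "z \<in> coords c \<Longrightarrow> transpose (g c z) = g c z"
    and metric_pos: "z \<in> coords c \<Longrightarrow> v \<noteq> 0 \<Longrightarrow> 0 < v \<bullet> (g c z *v v)"
    and metric_nonneg: "z \<in> coords c \<Longrightarrow> 0 \<le> v \<bullet> (g c z *v v)"
  using assms smooth_on_continuous unfolding riemannian_metric_def
  by (blast, blast, blast, cases "v = 0") (auto simp: less_imp_le)

lemma metric_det_pos:
  assumes "riemannian_metric A g" "c \<in> A" "z \<in> coords c"
  shows "0 < det (g c z)"
  using metric_sym[OF assms] metric_pos[OF assms] by (rule posdef_det_pos)

lemma metric_transform:
  assumes "riemannian_metric A g" "c \<in> A" "c' \<in> A" "z \<in> snd c ` (fst c \<inter> fst c')"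
  defines "J \<equiv> matrix (frechet_derivative (transition c c') (at z))"
  shows "g c z = transpose J ** g c' (transition c c' z) ** J"
  using assms unfolding riemannian_metric_def Let_def by blast

lemma transition_derivative:
  assumes "smooth_atlas A" "c \<in> A" "c' \<in> A" "z \<in> snd c ` (fst c \<inter> fst c')"
  shows "(transition c c' has_derivative frechet_derivative (transition c c') (at z)) (at z)"
proof -
  have "transition c c' differentiable (at z)"
    by (rule smooth_on_differentiable[OF _ assms(4)]) (use assms in \<open>auto simp: smooth_atlas_def\<close>)
  then show ?thesis by (simp add: frechet_derivative_works)
qed

lemma continuous_on_det [continuous_intros]:
  fixes G :: "'a::topological_space \<Rightarrow> real^'n^'n::finite"
  assumes "continuous_on S G"
  shows "continuous_on S (\<lambda>x. det (G x))"
  unfolding det_def by (intro continuous_intros assms)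

section \<open>Existence and uniqueness of the Riemannian volume\<close>

definition chart_volume :: "('m, 'n::finite) metric_coeffs \<Rightarrow> ('m, 'n) chart \<Rightarrow> 'm set \<Rightarrow> ennreal" where
  "chart_volume g c B = (\<integral>\<^sup>+ z\<in>snd c ` B. ennreal (sqrt (det (g c z))) \<partial>lborel)"

lemma volume_density_measurable:
  assumes "riemannian_metric A g" "c \<in> A" "S \<subseteq> coords c" "S \<in> sets borel"
  shows "(\<lambda>z. indicator S z * sqrt (det (g c z))) \<in> borel_measurable borel"
proof -
  have "continuous_on S (\<lambda>z. sqrt (det (g c z)))"
    by (intro continuous_intros continuous_on_subset[OF metric_cont[OF assms(1,2)]] assms(3))
  from borel_measurable_continuous_on_indicator[OF assms(4) this] show ?thesis by simp
qed

lemma chart_volume_eq: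
  "chart_volume g c B = (\<integral>\<^sup>+ z. ennreal (indicator (snd c ` B) z * sqrt (det (g c z))) \<partial>lborel)"
  unfolding chart_volume_def by (rule nn_integral_cong) (auto simp: indicator_def)

text \<open>
  The transformation law gives \<open>det g = (det J)\<^sup>2 det g'\<close>, so the densities \<open>sqrt (det g)\<close> in two
  charts differ by exactly the Jacobian factor \<open>\<bar>det J\<bar>\<close> of the change of variables formula.
\<close>

lemma chart_volume_independent:
  assumes A: "smooth_atlas A" and g: "riemannian_metric A g"
    and c: "c \<in> A" "c' \<in> A" and B: "B \<in> sets borel" "B \<subseteq> fst c" "B \<subseteq> fst c'"
  shows "chart_volume g c B = chart_volume g c' B"
proof -
  let ?S = "snd c ` B" and ?T = "transition c c'"
  let ?T' = "\<lambda>z. frechet_derivative ?T (at z)"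
  have TS: "?T ` ?S = snd c' ` B" using A c B(2) by (rule transition_image)
  have sub: "?S \<subseteq> coords c" "snd c' ` B \<subseteq> coords c'" using B by (auto simp: coords_def)
  have ov: "z \<in> snd c ` (fst c \<inter> fst c')" if "z \<in> ?S" for z using that B by auto
  have bS: "?S \<in> sets borel" "snd c' ` B \<in> sets borel"
    by (rule chart_image_borel[OF A c(1) B(1,2)], rule chart_image_borel[OF A c(2) B(1,3)])
  have J: "\<bar>det (matrix (?T' z))\<bar> * sqrt (det (g c' (?T z))) = sqrt (det (g c z))" if "z \<in> ?S" for z
  proof -
    have "det (g c z) = (det (matrix (?T' z)))\<^sup>2 * det (g c' (?T z))"
      by (subst metric_transform[OF g c ov[OF that]]) (simp add: det_mul power2_eq_square)
    then show ?thesis by (simp add: real_sqrt_mult)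
  qed
  have eq: "indicator ?S z * (\<bar>det (matrix (?T' z))\<bar> * sqrt (det (g c' (?T z)))) = indicator ?S z * sqrt (det (g c z))" for z
    by (cases "z \<in> ?S") (simp_all add: J)
  have "(\<integral>\<^sup>+y. ennreal (indicator (?T ` ?S) y * sqrt (det (g c' y))) \<partial>lborel) =
         (\<integral>\<^sup>+z. ennreal (indicator ?S z * (\<bar>det (matrix (?T' z))\<bar> * sqrt (det (g c' (?T z))))) \<partial>lborel)"
  proof (rule nn_integral_change_of_variables[OF bS(1)])
    show "(?T has_derivative ?T' z) (at z within ?S)" if "z \<in> ?S" for z
      by (rule has_derivative_at_withinI[OF transition_derivative[OF A c ov[OF that]]])
    show "inj_on ?T ?S"
    proof (rule inj_on_inverseI[where g="snd c \<circ> chart_inv c'"])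
      fix z assume "z \<in> ?S"
      then obtain b where b: "b \<in> B" "z = snd c b" by auto
      then have "?T z = snd c' b" using chart_inv_chart[OF A c(1)] B by (auto simp: transition_def)
      then show "(snd c \<circ> chart_inv c') (?T z) = z"
        using chart_inv_chart[OF A c(2)] b B by auto
    qed
    show "(\<lambda>y. indicator (?T ` ?S) y * sqrt (det (g c' y))) \<in> borel_measurable borel"
      unfolding TS by (rule volume_density_measurable[OF g c(2) sub(2) bS(2)])
    show "(\<lambda>z. indicator ?S z * (\<bar>det (matrix (?T' z))\<bar> * sqrt (det (g c' (?T z))))) \<in> borel_measurable borel"
      unfolding eq by (rule volume_density_measurable[OF g c(1) sub(1) bS(1)])
    show "0 \<le> sqrt (det (g c' y))" if "y \<in> ?T ` ?S" for y
      using metric_det_pos[OF g c(2), of y] that sub(2) unfolding TS by (auto intro: less_imp_le)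
  qed
  then show ?thesis unfolding chart_volume_eq TS eq by simp
qed

lemma chart_volume_suminf:
  assumes A: "smooth_atlas A" and g: "riemannian_metric A g" and c: "c \<in> A"
    and B: "\<And>i::nat. B i \<in> sets borel" "\<And>i. B i \<subseteq> fst c" "disjoint_family B"
  shows "(\<Sum>i. chart_volume g c (B i)) = chart_volume g c (\<Union>i. B i)"
proof -
  let ?W = "\<lambda>z. ennreal (indicator (coords c) z * sqrt (det (g c z)))"
  let ?D = "density lborel ?W"
  have co: "coords c \<in> sets borel" using coords_open[OF A c] by simp
  have [measurable]: "(\<lambda>z. indicator (coords c) z * sqrt (det (g c z))) \<in> borel_measurable borel"
    by (rule volume_density_measurable[OF g c order_refl co])
  have eq: "chart_volume g c S = emeasure ?D (snd c ` S)" if "S \<in> sets borel" "S \<subseteq> fst c" for S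
  proof -
    have "emeasure ?D (snd c ` S) = (\<integral>\<^sup>+ z. ?W z * indicator (snd c ` S) z \<partial>lborel)"
      using chart_image_borel[OF A c that] by (subst emeasure_density) auto
    also have "\<dots> = chart_volume g c S"
      unfolding chart_volume_def
      by (rule nn_integral_cong) (use that in \<open>auto simp: indicator_def coords_def\<close>)
    finally show ?thesis by simp
  qed
  have "disjoint_family (\<lambda>i. snd c ` B i)"
    unfolding disjoint_family_on_def
  proof (intro ballI impI)
    fix i j :: nat assume "i \<noteq> j"
    have "snd c ` B i \<inter> snd c ` B j = snd c ` (B i \<inter> B j)"
      using inj_on_image_Int[OF chart_inj[OF A c] B(2) B(2)] by simp
    also have "B i \<inter> B j = {}" using B(3) \<open>i \<noteq> j\<close> by (auto simp: disjoint_family_on_def)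
    finally show "snd c ` B i \<inter> snd c ` B j = {}" by simp
  qed
  then have "(\<Sum>i. emeasure ?D (snd c ` B i)) = emeasure ?D (\<Union>i. snd c ` B i)"
    using chart_image_borel[OF A c B(1,2)] by (intro suminf_emeasure) auto
  moreover have "chart_volume g c (\<Union>i. B i) = emeasure ?D (snd c ` (\<Union>i. B i))"
    by (rule eq) (use B in auto)
  ultimately show ?thesis by (simp add: eq B image_UN)
qed

text \<open>
  Second countability provides countably many charts that cover the manifold; removing from each
  domain the earlier ones makes the pieces disjoint.
\<close>

lemma countable_chart_partition:
  fixes A :: "('m::{t2_space, second_countable_topology}, 'n::finite) chart set"
  assumes A: "smooth_atlas A"
  obtains c :: "nat \<Rightarrow> ('m, 'n) chart" and D :: "nat \<Rightarrow> 'm set"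
  where "\<And>k. c k \<in> A" "\<And>k. D k \<subseteq> fst (c k)" "\<And>k. D k \<in> sets borel" "disjoint_family D" "(\<Union>k. D k) = UNIV"
proof -
  obtain F where F: "F \<subseteq> fst ` A" "countable F" "\<Union>F = \<Union>(fst ` A)"
    using Lindelof[of "fst ` A"] chart_open[OF A] by (metis imageE)
  have U: "\<Union>F = UNIV" using A F by (auto simp: smooth_atlas_def)
  then have ne: "F \<noteq> {}" by auto
  define u where "u = from_nat_into F"
  have uF: "u k \<in> F" for k by (simp add: u_def ne from_nat_into)
  have "\<exists>c. c \<in> A \<and> fst c = u k" for k using subsetD[OF F(1) uF[of k]] by fastforce
  then obtain c where c: "\<And>k. c k \<in> A" "\<And>k. fst (c k) = u k" by metis
  have "range u = F" by (simp add: u_def ne F range_from_nat_into)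
  then have "(\<Union>k. u k) = UNIV" using U by simp
  moreover have "u k \<in> sets borel" for k using chart_open[OF A c(1)[of k]] c(2) by simp
  ultimately show ?thesis
    using c sets.range_disjointed_sets[of u borel] disjointed_subset[of u]
    by (intro that[of c "disjointed u"]) (auto simp: disjoint_family_disjointed UN_disjointed_eq)
qed

lemma ennreal_suminf_swap:
  fixes f :: "nat \<Rightarrow> nat \<Rightarrow> ennreal"
  shows "(\<Sum>i. \<Sum>j. f i j) = (\<Sum>j. \<Sum>i. f i j)"
  unfolding nn_integral_count_space_nat[symmetric]
  by (subst nn_integral_count_space_nat[of "\<lambda>j. _ j"], subst nn_integral_suminf[symmetric]) (auto simp: nn_integral_count_space_nat)

text \<open>
  For existence, the chart volumes of the pieces of a countable partition subordinate to charts are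
  added up; independence of the chart shows that this gives the right value on subsets of any
  other chart. For uniqueness, the partition determines a measure by its values inside charts.
  Without this theorem the definite description in \<open>riemannian_volume\<close> would say nothing.
\<close>

theorem riemannian_volume_exists_unique:
  fixes A :: "('m::{t2_space, second_countable_topology}, 'n::finite) chart set"
  assumes "riemannian_manifold A g"
  shows "\<exists>!\<mu>. sets \<mu> = sets borel \<and>
        (\<forall>c\<in>A. \<forall>B\<in>sets borel. B \<subseteq> fst c \<longrightarrow>
           emeasure \<mu> B = (\<integral>\<^sup>+ z\<in>snd c ` B. ennreal (sqrt (det (g c z))) \<partial>lborel))"
proof -
  note A = manifold_atlas[OF assms] and g = manifold_metric[OF assms]
  obtain c :: "nat \<Rightarrow> ('m, 'n) chart" and D :: "nat \<Rightarrow> 'm set"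
    where c: "\<And>k. c k \<in> A" and D: "\<And>k. D k \<subseteq> fst (c k)" "\<And>k. D k \<in> sets borel" "disjoint_family D" "(\<Union>k. D k) = UNIV"
    using countable_chart_partition[OF A] by blast
  define m where "m = (\<lambda>B. \<Sum>k. chart_volume g (c k) (B \<inter> D k))"
  define \<mu> where "\<mu> = measure_of UNIV (sets (borel :: 'm measure)) m"
  have s\<mu>: "sets \<mu> = sets borel"
    unfolding \<mu>_def by (metis sets.sigma_sets_eq sets.space_closed sets_measure_of space_borel)
  have pos: "positive (sets \<mu>) m"
    by (simp add: positive_def m_def chart_volume_def)
  have ca: "countably_additive (sets \<mu>) m"
  proof (unfold countably_additive_def, intro allI impI)
    fix B :: "nat \<Rightarrow> 'm set"
    assume B: "range B \<subseteq> sets \<mu>" "disjoint_family B"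
    have b: "B i \<in> sets borel" for i using B s\<mu> by auto
    have "(\<Sum>i. m (B i)) = (\<Sum>k. \<Sum>i. chart_volume g (c k) (B i \<inter> D k))"
      unfolding m_def by (rule ennreal_suminf_swap)
    also have "\<dots> = (\<Sum>k. chart_volume g (c k) (\<Union>i. B i \<inter> D k))"
    proof (intro suminf_cong chart_volume_suminf[OF A g c])
      show "B i \<inter> D k \<in> sets borel" for i k using b D by auto
      show "B i \<inter> D k \<subseteq> fst (c k)" for i k using D(1)[of k] by blast
      show "disjoint_family (\<lambda>i. B i \<inter> D k)" for k using B(2) by (auto simp: disjoint_family_on_def)
    qed
    also have "\<dots> = m (\<Union>i. B i)" by (simp add: m_def)
    finally show "(\<Sum>i. m (B i)) = m (\<Union>i. B i)" .
  qed
  have em: "emeasure \<mu> B = m B" if "B \<in> sets borel" for B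
    by (rule emeasure_measure_of[OF \<mu>_def _ pos ca]) (use that s\<mu> in auto)
  have part: "(\<Union>k. B \<inter> D k) = B" "disjoint_family (\<lambda>k. B \<inter> D k)" for B
    using D(3,4) by (auto simp: disjoint_family_on_def)
  show ?thesis
    unfolding chart_volume_def[symmetric]
  proof (rule ex1I[of _ \<mu>])
    have "emeasure \<mu> B = chart_volume g c' B" if c': "c' \<in> A" and B: "B \<in> sets borel" "B \<subseteq> fst c'" for c' B
    proof -
      have "emeasure \<mu> B = (\<Sum>k. chart_volume g c' (B \<inter> D k))"
        unfolding em[OF B(1)] m_def
        by (intro suminf_cong chart_volume_independent[OF A g c c']) (use B D in auto)
      also have "\<dots> = chart_volume g c' (\<Union>k. B \<inter> D k)"
        by (rule chart_volume_suminf[OF A g c']) (use B D part in auto)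
      finally show ?thesis by (simp only: part)
    qed
    with s\<mu> show "sets \<mu> = sets borel \<and> (\<forall>c\<in>A. \<forall>B\<in>sets borel. B \<subseteq> fst c \<longrightarrow> emeasure \<mu> B = chart_volume g c B)"
      by blast
  next
    fix \<nu> assume \<nu>: "sets \<nu> = sets borel \<and> (\<forall>c\<in>A. \<forall>B\<in>sets borel. B \<subseteq> fst c \<longrightarrow> emeasure \<nu> B = chart_volume g c B)"
    show "\<nu> = \<mu>"
    proof (rule measure_eqI)
      show "sets \<nu> = sets \<mu>" using \<nu> s\<mu> by simp
      fix B assume "B \<in> sets \<nu>"
      then have B: "B \<in> sets borel" using \<nu> by simp
      have "emeasure \<nu> B = (\<Sum>k. emeasure \<nu> (B \<inter> D k))"
      proof -
        have "(\<Sum>k. emeasure \<nu> (B \<inter> D k)) = emeasure \<nu> (\<Union>k. B \<inter> D k)"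
          by (rule suminf_emeasure) (use \<nu> B D(2) part in auto)
        then show ?thesis by (simp only: part)
      qed
      also have "\<dots> = m B"
        unfolding m_def
      proof (intro suminf_cong)
        fix k
        have "B \<inter> D k \<in> sets borel" "B \<inter> D k \<subseteq> fst (c k)" using B D(2) D(1)[of k] by auto
        then show "emeasure \<nu> (B \<inter> D k) = chart_volume g (c k) (B \<inter> D k)"
          using \<nu> c[of k] by blast
      qed
      finally show "emeasure \<nu> B = emeasure \<mu> B" using em[OF B] by simp
    qed
  qed
qed

lemma riemannian_volume:
  fixes A :: "('m::{t2_space, second_countable_topology}, 'n::finite) chart set"
  assumes "riemannian_manifold A g"
  shows sets_riemannian_volume: "sets (riemannian_volume A g) = sets borel"
    and emeasure_riemannian_volume: "\<And>c B. c \<in> A \<Longrightarrow> B \<in> sets borel \<Longrightarrow> B \<subseteq> fst c \<Longrightarrow>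
           emeasure (riemannian_volume A g) B = (\<integral>\<^sup>+ z\<in>snd c ` B. ennreal (sqrt (det (g c z))) \<partial>lborel)"
  using theI'[OF riemannian_volume_exists_unique[OF assms]] unfolding riemannian_volume_def[symmetric]
  by auto

section \<open>Piecewise continuously differentiable curves\<close>

text \<open>
  The notion for \<open>[0,1]\<close> with an arbitrary interval in its place, so that curves can be cut,
  rescaled and joined.
\<close>

definition piecewise_C1_on ::
  "('m::topological_space, 'n::finite) chart set \<Rightarrow> real \<Rightarrow> real \<Rightarrow> (real \<Rightarrow> 'm) \<Rightarrow> bool" where
  "piecewise_C1_on A a b \<gamma> \<longleftrightarrow>
     (\<exists>K. finite K \<and> {a, b} \<subseteq> K \<and> K \<subseteq> {a..b} \<and>
        (\<forall>p\<in>K. \<forall>q\<in>K. p < q \<and> K \<inter> {p<..<q} = {} \<longrightarrow> C1_curve_on A p q \<gamma>))"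

lemma piecewise_C1_curve_eq: "piecewise_C1_curve A \<gamma> \<longleftrightarrow> piecewise_C1_on A 0 1 \<gamma>"
  by (simp add: piecewise_C1_curve_def piecewise_C1_on_def)

lemma piecewise_C1_onE:
  assumes "piecewise_C1_on A a b \<gamma>"
  obtains K where "finite K" "{a, b} \<subseteq> K" "K \<subseteq> {a..b}"
    "\<forall>p\<in>K. \<forall>q\<in>K. p < q \<longrightarrow> K \<inter> {p<..<q} = {} \<longrightarrow> C1_curve_on A p q \<gamma>"
proof -
  obtain K where K: "finite K \<and> {a, b} \<subseteq> K \<and> K \<subseteq> {a..b} \<and>
        (\<forall>p\<in>K. \<forall>q\<in>K. p < q \<and> K \<inter> {p<..<q} = {} \<longrightarrow> C1_curve_on A p q \<gamma>)"
    using assms unfolding piecewise_C1_on_def by (rule exE)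
  show ?thesis by (rule that[of K]) (use K in simp_all)
qed

lemma piecewise_C1_onI:
  assumes "finite K" "{a, b} \<subseteq> K" "K \<subseteq> {a..b}"
    "\<And>p q. p \<in> K \<Longrightarrow> q \<in> K \<Longrightarrow> p < q \<Longrightarrow> K \<inter> {p<..<q} = {} \<Longrightarrow> C1_curve_on A p q \<gamma>"
  shows "piecewise_C1_on A a b \<gamma>"
  unfolding piecewise_C1_on_def by (rule exI[of _ K]) (use assms in simp)

lemma C1_curve_onE:
  assumes "C1_curve_on A a b \<gamma>" "c \<in> A"
  obtains D where "continuous_on {t\<in>{a..b}. \<gamma> t \<in> fst c} D"
    "\<And>t. t \<in> {a..b} \<Longrightarrow> \<gamma> t \<in> fst c \<Longrightarrow> ((snd c \<circ> \<gamma>) has_vector_derivative D t) (at t within {a..b})"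
  using assms unfolding C1_curve_on_def by metis

lemma C1_curve_on_subinterval:
  assumes "C1_curve_on A a b \<gamma>" "a \<le> p" "q \<le> b"
  shows "C1_curve_on A p q \<gamma>"
  unfolding C1_curve_on_def
proof (intro conjI ballI)
  have sub: "{p..q} \<subseteq> {a..b}" using assms by auto
  show "continuous_on {p..q} \<gamma>"
    using assms(1) sub unfolding C1_curve_on_def by (blast intro: continuous_on_subset)
  fix c assume c: "c \<in> A"
  obtain D where D: "continuous_on {t\<in>{a..b}. \<gamma> t \<in> fst c} D"
    "\<And>t. t \<in> {a..b} \<Longrightarrow> \<gamma> t \<in> fst c \<Longrightarrow> ((snd c \<circ> \<gamma>) has_vector_derivative D t) (at t within {a..b})"
    by (rule C1_curve_onE[OF assms(1) c], rule that, assumption, blast)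
  show "\<exists>D. continuous_on {t\<in>{p..q}. \<gamma> t \<in> fst c} D \<and>
        (\<forall>t\<in>{p..q}. \<gamma> t \<in> fst c \<longrightarrow> ((snd c \<circ> \<gamma>) has_vector_derivative D t) (at t within {p..q}))"
  proof (rule exI[of _ D], intro conjI ballI impI)
    show "continuous_on {t\<in>{p..q}. \<gamma> t \<in> fst c} D"
      by (rule continuous_on_subset[OF D(1)]) (use sub in auto)
    show "((snd c \<circ> \<gamma>) has_vector_derivative D t) (at t within {p..q})" if "t \<in> {p..q}" "\<gamma> t \<in> fst c" for t
      by (rule has_vector_derivative_within_subset[OF D(2) sub]) (use that sub in auto)
  qed
qed

lemma C1_curve_on_cong:
  assumes "C1_curve_on A a b \<gamma>" "\<And>t. t \<in> {a..b} \<Longrightarrow> \<gamma> t = \<eta> t"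
  shows "C1_curve_on A a b \<eta>"
  unfolding C1_curve_on_def
proof (intro conjI ballI)
  show "continuous_on {a..b} \<eta>"
    using assms continuous_on_cong[of "{a..b}" "{a..b}" \<gamma> \<eta>] unfolding C1_curve_on_def by auto
  fix c assume c: "c \<in> A"
  obtain D where D: "continuous_on {t\<in>{a..b}. \<gamma> t \<in> fst c} D"
    "\<And>t. t \<in> {a..b} \<Longrightarrow> \<gamma> t \<in> fst c \<Longrightarrow> ((snd c \<circ> \<gamma>) has_vector_derivative D t) (at t within {a..b})"
    by (rule C1_curve_onE[OF assms(1) c], rule that, assumption, blast)
  show "\<exists>D. continuous_on {t\<in>{a..b}. \<eta> t \<in> fst c} D \<and>
        (\<forall>t\<in>{a..b}. \<eta> t \<in> fst c \<longrightarrow> ((snd c \<circ> \<eta>) has_vector_derivative D t) (at t within {a..b}))"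
  proof (rule exI[of _ D], intro conjI ballI impI)
    have "{t\<in>{a..b}. \<gamma> t \<in> fst c} = {t\<in>{a..b}. \<eta> t \<in> fst c}" using assms(2) by auto
    then show "continuous_on {t\<in>{a..b}. \<eta> t \<in> fst c} D" using D(1) by simp
    show "((snd c \<circ> \<eta>) has_vector_derivative D t) (at t within {a..b})" if "t \<in> {a..b}" "\<eta> t \<in> fst c" for t
      by (rule has_vector_derivative_transform[OF that(1) _ D(2)[OF that(1)]])
         (use that(2) assms(2)[OF that(1)] in \<open>simp_all add: assms(2)\<close>)
  qed
qed

lemma C1_curve_on_affine:
  assumes "C1_curve_on A a b \<gamma>" "m > 0"
  shows "C1_curve_on A ((a - k) / m) ((b - k) / m) (\<lambda>t. \<gamma> (m * t + k))"
  unfolding C1_curve_on_def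
proof (intro conjI ballI)
  let ?I = "{(a - k) / m..(b - k) / m}"
  have I: "m * t + k \<in> {a..b}" if "t \<in> ?I" for t using that assms(2) by (simp add: pos_divide_le_eq pos_le_divide_eq algebra_simps)
  have img: "(\<lambda>t. m * t + k) ` ?I \<subseteq> {a..b}" using I by blast
  have "continuous_on {a..b} \<gamma>" using assms(1) by (simp add: C1_curve_on_def)
  then show "continuous_on ?I (\<lambda>t. \<gamma> (m * t + k))"
    by (rule continuous_on_compose2[OF _ _ img]) (intro continuous_intros)
  fix c assume c: "c \<in> A"
  obtain D where D: "continuous_on {t\<in>{a..b}. \<gamma> t \<in> fst c} D"
    "\<And>t. t \<in> {a..b} \<Longrightarrow> \<gamma> t \<in> fst c \<Longrightarrow> ((snd c \<circ> \<gamma>) has_vector_derivative D t) (at t within {a..b})"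
    by (rule C1_curve_onE[OF assms(1) c], rule that, assumption, blast)
  show "\<exists>D. continuous_on {t\<in>?I. \<gamma> (m * t + k) \<in> fst c} D \<and>
        (\<forall>t\<in>?I. \<gamma> (m * t + k) \<in> fst c \<longrightarrow> ((snd c \<circ> (\<lambda>t. \<gamma> (m * t + k))) has_vector_derivative D t) (at t within ?I))"
  proof (rule exI[of _ "\<lambda>t. m *\<^sub>R D (m * t + k)"], intro conjI ballI impI)
    have "continuous_on {t\<in>?I. \<gamma> (m * t + k) \<in> fst c} (\<lambda>t. D (m * t + k))"
      by (rule continuous_on_compose2[OF D(1)]) (use I in \<open>auto intro!: continuous_intros\<close>)
    then show "continuous_on {t\<in>?I. \<gamma> (m * t + k) \<in> fst c} (\<lambda>t. m *\<^sub>R D (m * t + k))"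
      by (intro continuous_intros)
    fix t assume t: "t \<in> ?I" "\<gamma> (m * t + k) \<in> fst c"
    have 1: "((\<lambda>t. m * t + k) has_vector_derivative m) (at t within ?I)"
      by (rule has_real_derivative_iff_has_vector_derivative[THEN iffD1]) (auto intro!: derivative_eq_intros)
    have "((snd c \<circ> \<gamma>) has_vector_derivative D (m * t + k)) (at (m * t + k) within (\<lambda>t. m * t + k) ` ?I)"
      by (rule has_vector_derivative_within_subset[OF D(2)[OF I[OF t(1)] t(2)] img])
    from vector_diff_chain_within[OF 1 this]
    show "((snd c \<circ> (\<lambda>t. \<gamma> (m * t + k))) has_vector_derivative m *\<^sub>R D (m * t + k)) (at t within ?I)"
      unfolding o_def .
  qed
qed

lemma piecewise_C1_on_cong:
  assumes "piecewise_C1_on A a b \<gamma>" "\<And>t. t \<in> {a..b} \<Longrightarrow> \<gamma> t = \<eta> t"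
  shows "piecewise_C1_on A a b \<eta>"
proof -
  obtain K where K: "finite K" "{a, b} \<subseteq> K" "K \<subseteq> {a..b}"
    "\<forall>p\<in>K. \<forall>q\<in>K. p < q \<longrightarrow> K \<inter> {p<..<q} = {} \<longrightarrow> C1_curve_on A p q \<gamma>"
    using piecewise_C1_onE[OF assms(1)] .
  have "C1_curve_on A p q \<eta>" if "p \<in> K" "q \<in> K" "p < q" "K \<inter> {p<..<q} = {}" for p q
  proof (rule C1_curve_on_cong[OF K(4)[rule_format, OF that]])
    fix t assume "t \<in> {p..q}"
    moreover have "{p..q} \<subseteq> {a..b}" using subsetD[OF K(3) that(1)] subsetD[OF K(3) that(2)] by simp
    ultimately show "\<gamma> t = \<eta> t" using assms(2) by blast
  qed
  with K(1-3) show ?thesis by (rule piecewise_C1_onI)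
qed

lemma piecewise_C1_on_affine:
  assumes "piecewise_C1_on A a b \<gamma>" "m > 0"
  shows "piecewise_C1_on A ((a - k) / m) ((b - k) / m) (\<lambda>t. \<gamma> (m * t + k))"
proof -
  obtain K where K: "finite K" "{a, b} \<subseteq> K" "K \<subseteq> {a..b}"
    "\<forall>p\<in>K. \<forall>q\<in>K. p < q \<longrightarrow> K \<inter> {p<..<q} = {} \<longrightarrow> C1_curve_on A p q \<gamma>"
    using piecewise_C1_onE[OF assms(1)] .
  let ?f = "\<lambda>t. (t - k) / m"
  have mono: "?f s < ?f t \<longleftrightarrow> s < t" "?f s \<le> ?f t \<longleftrightarrow> s \<le> t" for s t
    using assms(2) by (auto simp: divide_less_cancel divide_le_cancel)
  have "C1_curve_on A (?f p) (?f q) (\<lambda>t. \<gamma> (m * t + k))"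
    if "p \<in> K" "q \<in> K" "?f p < ?f q" "?f ` K \<inter> {?f p<..<?f q} = {}" for p q
  proof (rule C1_curve_on_affine[OF K(4)[rule_format] assms(2)])
    show "K \<inter> {p<..<q} = {}"
    proof (rule ccontr)
      assume "K \<inter> {p<..<q} \<noteq> {}"
      then obtain u where "u \<in> K" "p < u" "u < q" by auto
      then have "?f u \<in> ?f ` K \<inter> {?f p<..<?f q}" by (intro IntI imageI) (auto simp: mono)
      with that show False by blast
    qed
  qed (use that mono in auto)
  then show ?thesis
  proof (intro piecewise_C1_onI[of "?f ` K"])
    show "finite (?f ` K)" "{?f a, ?f b} \<subseteq> ?f ` K" using K(1,2) by auto
    show "?f ` K \<subseteq> {?f a..?f b}"
    proof (rule image_subsetI)
      fix u assume "u \<in> K"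
      then have "u \<in> {a..b}" using K(3) by blast
      then show "?f u \<in> {?f a..?f b}" by (simp add: mono)
    qed
  qed auto
qed

lemma piecewise_C1_on_join:
  assumes "piecewise_C1_on A a m \<gamma>" "piecewise_C1_on A m b \<gamma>"
  shows "piecewise_C1_on A a b \<gamma>"
proof -
  obtain K where K: "finite K" "{a, m} \<subseteq> K" "K \<subseteq> {a..m}"
    "\<forall>p\<in>K. \<forall>q\<in>K. p < q \<longrightarrow> K \<inter> {p<..<q} = {} \<longrightarrow> C1_curve_on A p q \<gamma>"
    using piecewise_C1_onE[OF assms(1)] .
  obtain L where L: "finite L" "{m, b} \<subseteq> L" "L \<subseteq> {m..b}"
    "\<forall>p\<in>L. \<forall>q\<in>L. p < q \<longrightarrow> L \<inter> {p<..<q} = {} \<longrightarrow> C1_curve_on A p q \<gamma>"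
    using piecewise_C1_onE[OF assms(2)] .
  have "C1_curve_on A p q \<gamma>"
    if pq: "p \<in> K \<union> L" "q \<in> K \<union> L" "p < q" "(K \<union> L) \<inter> {p<..<q} = {}" for p q
  proof -
    have "m \<notin> {p<..<q}" using pq(4) K(2) by blast
    then consider "q \<le> m" | "m \<le> p" by fastforce
    then show ?thesis
    proof cases
      case 1
      then have "p \<in> K" "q \<in> K" using pq K L by force+
      then show ?thesis using K(4)[rule_format, of p q] pq by blast
    next
      case 2
      then have "p \<in> L" "q \<in> L" using pq K L by force+
      then show ?thesis using L(4)[rule_format, of p q] pq by blast
    qed
  qed
  moreover have "a \<le> m" "m \<le> b" using K L by auto
  ultimately show ?thesis
  proof (intro piecewise_C1_onI[of "K \<union> L"])
    show "K \<union> L \<subseteq> {a..b}"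
      by (intro Un_least order_trans[OF K(3)] order_trans[OF L(3)]) (use \<open>a \<le> m\<close> \<open>m \<le> b\<close> in auto)
  qed (use K(1,2) L(1,2) in auto)
qed

lemma C1_imp_piecewise_C1_on:
  assumes "C1_curve_on A a b \<gamma>" "a \<le> b"
  shows "piecewise_C1_on A a b \<gamma>"
  unfolding piecewise_C1_on_def by (rule exI[of _ "{a, b}"]) (use assms in auto)

text \<open>
  A property of intervals that holds on \<open>C\<^sup>1\<close> pieces and survives gluing holds on the whole
  parameter interval: the partition points are reached from the left one after the other.
\<close>

lemma piecewise_C1_on_induct:
  assumes "piecewise_C1_on A a b \<gamma>" "a < b"
    and piece: "\<And>p q. p < q \<Longrightarrow> C1_curve_on A p q \<gamma> \<Longrightarrow> P p q"
    and join: "\<And>p q r. p < q \<Longrightarrow> q < r \<Longrightarrow> P p q \<Longrightarrow> P q r \<Longrightarrow> P p r"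
  shows "P a b"
proof -
  obtain K where K: "finite K" "{a, b} \<subseteq> K" "K \<subseteq> {a..b}"
    "\<forall>p\<in>K. \<forall>q\<in>K. p < q \<longrightarrow> K \<inter> {p<..<q} = {} \<longrightarrow> C1_curve_on A p q \<gamma>"
    using piecewise_C1_onE[OF assms(1)] .
  have "P a q" if "q \<in> K" "a < q" for q
    using that
  proof (induction "card {k\<in>K. k < q}" arbitrary: q rule: less_induct)
    case less
    let ?S = "{k\<in>K. k < q}"
    have S: "finite ?S" "a \<in> ?S" using K(1,2) less.prems by auto
    define p where "p = Max ?S"
    have p: "p \<in> ?S" unfolding p_def using S by (metis Max_in empty_iff)
    have "K \<inter> {p<..<q} = {}"
    proof -
      have "k \<le> p" if "k \<in> K" "k < q" for k
        unfolding p_def by (rule Max_ge) (use S that in auto)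
      then show ?thesis by force
    qed
    then have pq: "P p q" using K(4)[rule_format, of p q] p less.prems by (intro piece) auto
    show ?case
    proof (cases "p = a")
      case False
      have pa: "a < p" using False p K(3) by force
      have "P a p"
      proof (rule less.hyps)
        show "card {k\<in>K. k < p} < card ?S"
          by (rule psubset_card_mono) (use S p in auto)
      qed (use p pa in auto)
      then show ?thesis using join[OF pa _ _ pq] p by auto
    qed (use pq in simp)
  qed
  then show ?thesis using assms(2) K by auto
qed

lemma piecewise_C1_on_continuous:
  assumes "piecewise_C1_on A a b \<gamma>" "a < b"
  shows "continuous_on {a..b} \<gamma>"
  using assms
proof (rule piecewise_C1_on_induct)
  fix p q r assume "p < q" "q < r" "continuous_on {p..q} \<gamma>" "continuous_on {q..r} \<gamma>"
  then have "continuous_on ({p..q} \<union> {q..r}) \<gamma>" by (intro continuous_on_closed_Un) auto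
  also have "{p..q} \<union> {q..r} = {p..r}" using \<open>p < q\<close> \<open>q < r\<close> by auto
  finally show "continuous_on {p..r} \<gamma>" .
qed (simp add: C1_curve_on_def)

lemma piecewise_C1_on_differentiable:
  fixes \<gamma> :: "real \<Rightarrow> 'm::topological_space" and A :: "('m, 'n::finite) chart set"
  assumes "piecewise_C1_on A a b \<gamma>" "a < b"
  shows "\<exists>F. finite F \<and> (\<forall>t\<in>{a..b} - F. \<forall>c\<in>A. \<gamma> t \<in> fst c \<longrightarrow>
           (\<exists>v. ((snd c \<circ> \<gamma>) has_vector_derivative v) (at t)))"
proof -
  define D where "D = (\<lambda>t. \<forall>c\<in>A. \<gamma> t \<in> fst c \<longrightarrow> (\<exists>v. ((snd c \<circ> \<gamma>) has_vector_derivative v) (at t)))"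
  have "\<exists>F. finite F \<and> (\<forall>t\<in>{a..b} - F. D t)"
    using assms
  proof (rule piecewise_C1_on_induct)
    fix p q assume pq: "p < q" "C1_curve_on A p q \<gamma>"
    have "D t" if t: "t \<in> {p..q} - {p, q}" for t
      unfolding D_def
    proof (intro ballI impI)
      fix c assume c: "c \<in> A" "\<gamma> t \<in> fst c"
      then obtain v where "((snd c \<circ> \<gamma>) has_vector_derivative v) (at t within {p..q})"
        using t pq(2) C1_curve_onE[of A p q \<gamma> c] by (metis DiffD1)
      then show "\<exists>v. ((snd c \<circ> \<gamma>) has_vector_derivative v) (at t)"
        using t at_within_Icc_at[of p t q] by force
    qed
    then show "\<exists>F. finite F \<and> (\<forall>t\<in>{p..q} - F. D t)" by (intro exI[of _ "{p, q}"]) simp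
  next
    fix p q r :: real assume "p < q" "q < r"
    assume "\<exists>F. finite F \<and> (\<forall>t\<in>{p..q} - F. D t)" and "\<exists>F. finite F \<and> (\<forall>t\<in>{q..r} - F. D t)"
    then obtain F G where FG: "finite F" "finite G" "\<forall>t\<in>{p..q} - F. D t" "\<forall>t\<in>{q..r} - G. D t" by blast
    have "{p..r} - (F \<union> G) \<subseteq> ({p..q} - F) \<union> ({q..r} - G)" by auto
    with FG(3,4) have "\<forall>t\<in>{p..r} - (F \<union> G). D t" by (meson Un_iff subsetD)
    with FG(1,2) show "\<exists>F. finite F \<and> (\<forall>t\<in>{p..r} - F. D t)"
      by (intro exI[of _ "F \<union> G"] conjI) simp_all
  qed
  then show ?thesis unfolding D_def .
qed

lemma continuous_on_quadratic_form:
  fixes M :: "'a::topological_space \<Rightarrow> real^'n^'n::finite"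
  assumes "continuous_on S M" "continuous_on S u"
  shows "continuous_on S (\<lambda>s. u s \<bullet> (M s *v u s))"
proof -
  have "u s \<bullet> (M s *v u s) = (\<Sum>i\<in>UNIV. u s $ i * (\<Sum>j\<in>UNIV. M s $ i $ j * u s $ j))" for s
    by (simp add: inner_vec_def matrix_vector_mult_def)
  then show ?thesis
    by (simp only:) (intro continuous_on_sum continuous_on_mult continuous_on_component assms)
qed

section \<open>Speed and length\<close>

text \<open>
  Velocities in two charts are related by the Jacobian of the transition map, and the metric
  coefficients by its congruence, so the squared speed agrees. The derivative is taken within a
  set \<open>S\<close> so that one-sided derivatives at the end points of a piece are covered.
\<close>

lemma velocity_change_of_chart:
  assumes A: "smooth_atlas A" and g: "riemannian_metric A g" and c: "c \<in> A" "c' \<in> A"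
    and t: "t \<in> S" "\<gamma> t \<in> fst c" "\<gamma> t \<in> fst c'" and cont: "continuous (at t within S) \<gamma>"
    and v: "((snd c \<circ> \<gamma>) has_vector_derivative v) (at t within S)"
  obtains w where "((snd c' \<circ> \<gamma>) has_vector_derivative w) (at t within S)"
    "w \<bullet> (g c' (snd c' (\<gamma> t)) *v w) = v \<bullet> (g c (snd c (\<gamma> t)) *v v)"
proof
  let ?T = "transition c c'" and ?z = "snd c (\<gamma> t)"
  let ?J = "frechet_derivative ?T (at ?z)"
  have z: "?z \<in> snd c ` (fst c \<inter> fst c')" using t by auto
  have dT: "(?T has_derivative ?J) (at ?z)" by (rule transition_derivative[OF A c z])
  have Tz: "?T ?z = snd c' (\<gamma> t)" using chart_inv_chart[OF A c(1) t(2)] by (simp add: transition_def)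
  have "((?T \<circ> (snd c \<circ> \<gamma>)) has_vector_derivative ?J v) (at t within S)"
    by (rule vector_derivative_diff_chain_within[OF v has_derivative_at_withinI]) (use dT in simp)
  moreover obtain d where d: "d > 0" "\<And>s. s \<in> S \<Longrightarrow> dist s t < d \<Longrightarrow> \<gamma> s \<in> fst c"
  proof -
    have "eventually (\<lambda>s. \<gamma> s \<in> fst c) (at t within S)"
      using cont[unfolded continuous_within] topological_tendstoD chart_open[OF A c(1)] t(2) by blast
    then obtain d where "d > 0" "\<forall>s\<in>S. s \<noteq> t \<and> dist s t < d \<longrightarrow> \<gamma> s \<in> fst c"
      unfolding eventually_at by blast
    then show ?thesis using t(2) by (intro that[of d]) auto
  qed
  moreover have "(?T \<circ> (snd c \<circ> \<gamma>)) s = (snd c' \<circ> \<gamma>) s" if "s \<in> S" "dist s t < d" for s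
    using d(2)[OF that] by (simp add: transition_def chart_inv_chart[OF A c(1)])
  ultimately show "((snd c' \<circ> \<gamma>) has_vector_derivative ?J v) (at t within S)"
    using has_vector_derivative_transform_within[of "?T \<circ> (snd c \<circ> \<gamma>)" "?J v" t S d "snd c' \<circ> \<gamma>"] t(1) d(1) by blast
  have lin: "linear ?J" using dT has_derivative_linear by blast
  let ?M = "matrix ?J"
  have Mv: "?M *v u = ?J u" for u using fun_cong[OF matrix_vector_mul(2)[OF lin]] .
  have "v \<bullet> (g c ?z *v v) = v \<bullet> ((transpose ?M ** g c' (?T ?z) ** ?M) *v v)"
    using metric_transform[OF g c z] by simp
  also have "\<dots> = v \<bullet> (transpose ?M *v (g c' (?T ?z) *v (?M *v v)))"
    by (simp add: matrix_vector_mul_assoc matrix_mul_assoc)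
  also have "\<dots> = (?M *v v) \<bullet> (g c' (?T ?z) *v (?M *v v))"
    by (simp only: dot_lmul_matrix[symmetric] vector_transpose_matrix)
  finally show "?J v \<bullet> (g c' (snd c' (\<gamma> t)) *v ?J v) = v \<bullet> (g c ?z *v v)"
    by (simp add: Mv Tz)
qed

lemma speed_in_chart:
  assumes A: "smooth_atlas A" and g: "riemannian_metric A g" and c: "c \<in> A"
    and t: "\<gamma> t \<in> fst c" and cont: "isCont \<gamma> t"
    and v: "((snd c \<circ> \<gamma>) has_vector_derivative v) (at t)"
  shows "speed A g \<gamma> t = sqrt (v \<bullet> (g c (snd c (\<gamma> t)) *v v))"
proof -
  let ?c = "chart_at A (\<gamma> t)"
  obtain w where w: "((snd ?c \<circ> \<gamma>) has_vector_derivative w) (at t)"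
    "w \<bullet> (g ?c (snd ?c (\<gamma> t)) *v w) = v \<bullet> (g c (snd c (\<gamma> t)) *v v)"
    using velocity_change_of_chart[OF A g c chart_at_in(1)[OF A], of t UNIV \<gamma> _ v] t chart_at_in(2)[OF A] cont v by auto
  then show ?thesis by (simp add: speed_def Let_def vector_derivative_at)
qed

lemma speed_nonneg:
  assumes A: "smooth_atlas A" and g: "riemannian_metric A g"
  shows "0 \<le> speed A g \<gamma> t"
  unfolding speed_def Let_def
  using metric_nonneg[OF g chart_at_in(1)[OF A] chart_in[OF A chart_at_in[OF A]]] by simp

text \<open>
  The integrand may use a different chart at every time. Its one-sided version \<open>\<sigma>\<close> nevertheless
  is continuous, since near a given time it can be computed in one fixed chart; and \<open>\<sigma>\<close> differs
  from the speed at the two end points only. Integrability matters because the length of a curve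
  with non-integrable speed would be \<open>0\<close>.
\<close>

lemma C1_speed_integrable:
  assumes A: "smooth_atlas A" and g: "riemannian_metric A g" and C: "C1_curve_on A a b \<gamma>" and ab: "a < b"
  shows "speed A g \<gamma> integrable_on {a..b}"
proof -
  define \<sigma> where "\<sigma> = (\<lambda>t. let c = chart_at A (\<gamma> t); v = vector_derivative (snd c \<circ> \<gamma>) (at t within {a..b})
      in sqrt (v \<bullet> (g c (snd c (\<gamma> t)) *v v)))"
  have cont: "continuous_on {a..b} \<gamma>" using C by (simp add: C1_curve_on_def)
  have "continuous (at t within {a..b}) \<sigma>" if t: "t \<in> {a..b}" for t
  proof -
    define c where "c = chart_at A (\<gamma> t)"
    have c: "c \<in> A" "\<gamma> t \<in> fst c" unfolding c_def by (auto intro: chart_at_in[OF A])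
    let ?S = "{s\<in>{a..b}. \<gamma> s \<in> fst c}"
    obtain D where D: "continuous_on ?S D"
      "\<And>s. s \<in> {a..b} \<Longrightarrow> \<gamma> s \<in> fst c \<Longrightarrow> ((snd c \<circ> \<gamma>) has_vector_derivative D s) (at s within {a..b})"
      by (rule C1_curve_onE[OF C c(1)], rule that, assumption, blast)
    have eq: "\<sigma> s = sqrt (D s \<bullet> (g c (snd c (\<gamma> s)) *v D s))" if s: "s \<in> ?S" for s
    proof -
      have cs: "continuous (at s within {a..b}) \<gamma>"
        using cont s by (simp add: continuous_on_eq_continuous_within)
      let ?c = "chart_at A (\<gamma> s)"
      obtain w where w: "((snd ?c \<circ> \<gamma>) has_vector_derivative w) (at s within {a..b})"
        "w \<bullet> (g ?c (snd ?c (\<gamma> s)) *v w) = D s \<bullet> (g c (snd c (\<gamma> s)) *v D s)"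
        using velocity_change_of_chart[OF A g c(1) chart_at_in(1)[OF A], of s "{a..b}" \<gamma> _ "D s"]
          s chart_at_in(2)[OF A] cs D(2) by auto
      have "vector_derivative (snd ?c \<circ> \<gamma>) (at s within {a..b}) = w"
        by (rule vector_derivative_within_closed_interval[OF ab _ w(1)]) (use s in auto)
      then show ?thesis using w(2) by (simp add: \<sigma>_def Let_def)
    qed
    have c1: "continuous_on ?S (\<lambda>s. snd c (\<gamma> s))"
      by (rule continuous_on_compose2[OF chart_cont[OF A c(1)] continuous_on_subset[OF cont]]) auto
    have c2: "continuous_on ?S (\<lambda>s. g c (snd c (\<gamma> s)))"
      by (rule continuous_on_compose2[OF metric_cont[OF g c(1)] c1]) (auto intro: chart_in[OF A c(1)])
    have "continuous_on ?S (\<lambda>s. sqrt (D s \<bullet> (g c (snd c (\<gamma> s)) *v D s)))"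
      by (intro continuous_on_real_sqrt continuous_on_quadratic_form c2 D(1))
    moreover have "continuous_on ?S \<sigma> \<longleftrightarrow> continuous_on ?S (\<lambda>s. sqrt (D s \<bullet> (g c (snd c (\<gamma> s)) *v D s)))"
      by (rule continuous_on_cong[OF refl]) (rule eq)
    ultimately have "continuous_on ?S \<sigma>" by (rule iffD2[rotated])
    then have "continuous (at t within ?S) \<sigma>"
      using t c by (auto simp: continuous_on_eq_continuous_within)
    moreover have "at t within ?S = at t within {a..b}"
    proof -
      obtain V where V: "open V" "V \<inter> {a..b} = \<gamma> -` fst c \<inter> {a..b}"
        using cont[unfolded continuous_on_open_invariant, rule_format, OF chart_open[OF A c(1)]] by (elim exE conjE)
      have "t \<in> V \<inter> {a..b}" unfolding V(2) using t c by simp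
      moreover have "?S \<inter> V = {a..b} \<inter> V" using V(2) by (auto simp: set_eq_iff)
      ultimately show ?thesis using V(1)
        by (intro at_within_nhd[where S=V]) auto
    qed
    ultimately show ?thesis by (simp add: continuous_within)
  qed
  then have "\<sigma> integrable_on {a..b}"
    by (intro integrable_continuous_interval) (simp add: continuous_on_eq_continuous_within)
  then show ?thesis
    by (rule integrable_spike_finite[of "{a, b}", rotated 2])
       (auto simp: \<sigma>_def speed_def Let_def at_within_Icc_at)
qed

lemma speed_integrable:
  assumes A: "smooth_atlas A" and g: "riemannian_metric A g" and C: "piecewise_C1_on A a b \<gamma>" and ab: "a < b"
  shows "speed A g \<gamma> integrable_on {a..b}"
  using C ab
proof (rule piecewise_C1_on_induct)
  fix p q r assume "p < q" "q < r" "speed A g \<gamma> integrable_on {p..q}" "speed A g \<gamma> integrable_on {q..r}"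
  then show "speed A g \<gamma> integrable_on {p..r}"
    by (intro Henstock_Kurzweil_Integration.integrable_combine[of p q r]) auto
qed (rule C1_speed_integrable[OF A g])

lemma speed_affine:
  assumes m: "m > 0" and U: "open U" "t \<in> U" "\<And>s. s \<in> U \<Longrightarrow> \<eta> s = \<gamma> (m * s + k)"
    and d: "((snd (chart_at A (\<gamma> (m * t + k))) \<circ> \<gamma>) has_vector_derivative v) (at (m * t + k))"
  shows "speed A g \<eta> t = m * speed A g \<gamma> (m * t + k)"
proof -
  let ?c = "chart_at A (\<gamma> (m * t + k))"
  have 1: "((\<lambda>t. m * t + k) has_vector_derivative m) (at t)"
    by (rule has_real_derivative_iff_has_vector_derivative[THEN iffD1]) (auto intro!: derivative_eq_intros)
  have "((snd ?c \<circ> \<gamma> \<circ> (\<lambda>t. m * t + k)) has_vector_derivative m *\<^sub>R v) (at t)"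
    by (rule vector_diff_chain_at[OF 1 d])
  then have "((snd ?c \<circ> \<eta>) has_vector_derivative m *\<^sub>R v) (at t)"
    by (rule has_vector_derivative_transform_within_open[OF _ U(1,2)]) (simp add: U(3))
  then have e: "vector_derivative (snd ?c \<circ> \<eta>) (at t) = m *\<^sub>R v" by (rule vector_derivative_at)
  show ?thesis
    unfolding speed_def U(3)[OF U(2)] Let_def e vector_derivative_at[OF d] using m
    by (simp add: matrix_vector_mult_scaleR real_sqrt_mult)
qed

text \<open>
  Length is invariant under affine reparametrisation: the speed gets multiplied by \<open>m\<close> and the
  interval shrinks by the same factor.
\<close>

lemma has_integral_speed_affine:
  assumes A: "smooth_atlas A" and g: "riemannian_metric A g" and C: "piecewise_C1_on A a b \<gamma>" and ab: "a < b"
    and m: "m > 0" and eq: "\<And>s. s \<in> {(a - k) / m<..<(b - k) / m} \<Longrightarrow> \<eta> s = \<gamma> (m * s + k)"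
  shows "(speed A g \<eta> has_integral integral {a..b} (speed A g \<gamma>)) {(a - k) / m..(b - k) / m}"
proof -
  let ?J = "{(a - k) / m..(b - k) / m}"
  obtain F where F: "finite F" "\<And>t c. t \<in> {a..b} - F \<Longrightarrow> c \<in> A \<Longrightarrow> \<gamma> t \<in> fst c \<Longrightarrow>
      \<exists>v. ((snd c \<circ> \<gamma>) has_vector_derivative v) (at t)"
    using piecewise_C1_on_differentiable[OF C ab] by blast
  have "(speed A g \<gamma> has_integral integral {a..b} (speed A g \<gamma>)) (cbox a b)"
    using speed_integrable[OF A g C ab] by (simp add: integrable_integral)
  from has_integral_affinity'[OF this m, of k]
  have "((\<lambda>t. speed A g \<gamma> (m * t + k)) has_integral (integral {a..b} (speed A g \<gamma>) / m)) ?J"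
    by (simp add: divide_inverse mult.commute)
  from has_integral_mult_right[OF this, of m]
  have h: "((\<lambda>t. m * speed A g \<gamma> (m * t + k)) has_integral integral {a..b} (speed A g \<gamma>)) ?J"
    using m by simp
  let ?E = "(\<lambda>t. (t - k) / m) ` F \<union> {(a - k) / m, (b - k) / m}"
  show ?thesis
  proof (rule has_integral_spike_finite[OF _ _ h, of ?E])
    fix t assume t: "t \<in> ?J - ?E"
    have "m * t + k \<notin> F"
    proof
      assume "m * t + k \<in> F"
      then have "(m * t + k - k) / m \<in> (\<lambda>t. (t - k) / m) ` F" by blast
      then show False using t m by simp
    qed
    moreover have "m * t + k \<in> {a..b}" using t m by (simp add: pos_divide_le_eq pos_le_divide_eq algebra_simps)
    ultimately have "m * t + k \<in> {a..b} - F" by simp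
    from F(2)[OF this chart_at_in[OF A]]
    obtain v where v: "((snd (chart_at A (\<gamma> (m * t + k))) \<circ> \<gamma>) has_vector_derivative v) (at (m * t + k))" ..
    show "speed A g \<eta> t = m * speed A g \<gamma> (m * t + k)"
    proof (rule speed_affine[OF m _ _ _ v])
      show "t \<in> {(a - k) / m<..<(b - k) / m}" using t by simp
    qed (simp, rule eq)
  qed (simp add: F(1))
qed

section \<open>Geodesic distance and geodesic balls\<close>

text \<open>
  The lengths over which the infimum in \<open>geodesic_dist\<close> is taken.
\<close>

definition joined_by ::
  "('m::topological_space, 'n::finite) chart set \<Rightarrow> ('m, 'n) metric_coeffs \<Rightarrow> 'm \<Rightarrow> 'm \<Rightarrow> real \<Rightarrow> bool" where
  "joined_by A g x y L \<longleftrightarrow> (\<exists>\<gamma>. piecewise_C1_curve A \<gamma> \<and> \<gamma> 0 = x \<and> \<gamma> 1 = y \<and> curve_length A g \<gamma> = L)"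

text \<open>
  The two curves are run through at double speed, one after the other.
\<close>

lemma joined_by_trans:
  assumes A: "smooth_atlas A" and g: "riemannian_metric A g"
    and "joined_by A g x y L" "joined_by A g y z L'"
  shows "joined_by A g x z (L + L')"
proof -
  obtain \<gamma> where \<gamma>: "piecewise_C1_on A 0 1 \<gamma>" "\<gamma> 0 = x" "\<gamma> 1 = y" "integral {0..1} (speed A g \<gamma>) = L"
    using assms(3) unfolding joined_by_def piecewise_C1_curve_eq curve_length_def by (elim exE conjE)
  obtain \<eta> where \<eta>: "piecewise_C1_on A 0 1 \<eta>" "\<eta> 0 = y" "\<eta> 1 = z" "integral {0..1} (speed A g \<eta>) = L'"
    using assms(4) unfolding joined_by_def piecewise_C1_curve_eq curve_length_def by (elim exE conjE)
  define \<theta> where "\<theta> = (\<lambda>t::real. if t \<le> 1/2 then \<gamma> (2 * t + 0) else \<eta> (2 * t + (-1)))"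
  have 1: "piecewise_C1_on A 0 (1/2) \<theta>"
    by (rule piecewise_C1_on_cong[OF piecewise_C1_on_affine[OF \<gamma>(1), of 2 0, simplified]]) (auto simp: \<theta>_def)
  have 2: "piecewise_C1_on A (1/2) 1 \<theta>"
  proof (rule piecewise_C1_on_cong[OF piecewise_C1_on_affine[OF \<eta>(1), of 2 "-1", simplified]])
    fix t :: real assume "t \<in> {1/2..1}"
    show "\<eta> (2 * t - 1) = \<theta> t"
    proof (cases "t = 1/2")
      case True
      show ?thesis unfolding True by (simp add: \<theta>_def \<gamma> \<eta>)
    next
      case False
      then have "\<not> t \<le> 1/2" using \<open>t \<in> {1/2..1}\<close> by auto
      then show ?thesis by (simp add: \<theta>_def)
    qed
  qed
  have "(speed A g \<theta> has_integral L) {(0-0)/2..(1-0)/2}"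
    unfolding \<gamma>(4)[symmetric] by (rule has_integral_speed_affine[OF A g \<gamma>(1)]) (auto simp: \<theta>_def)
  moreover have "(speed A g \<theta> has_integral L') {(0-(-1))/2..(1-(-1))/2}"
    unfolding \<eta>(4)[symmetric] by (rule has_integral_speed_affine[OF A g \<eta>(1)]) (auto simp: \<theta>_def)
  ultimately have "(speed A g \<theta> has_integral (L + L')) {0..1}"
    by (intro has_integral_combine[where c="1/2"]) auto
  then have "curve_length A g \<theta> = L + L'" by (simp add: curve_length_def integral_unique)
  moreover have "piecewise_C1_curve A \<theta>"
    unfolding piecewise_C1_curve_eq by (rule piecewise_C1_on_join[OF 1 2])
  moreover have "\<theta> 0 = x" "\<theta> 1 = z" by (simp_all add: \<theta>_def \<gamma>(2) \<eta>(3))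
  ultimately show ?thesis unfolding joined_by_def by (intro exI[of _ \<theta>] conjI)
qed

lemma joined_by_nonneg:
  assumes "smooth_atlas A" "riemannian_metric A g" "joined_by A g x y L"
  shows "0 \<le> L"
proof -
  obtain \<gamma> where "L = integral {0..1} (speed A g \<gamma>)"
    using assms(3) unfolding joined_by_def curve_length_def by blast
  moreover have "0 \<le> integral {0..1} (speed A g \<gamma>)"
  proof (cases "speed A g \<gamma> integrable_on {0..1}")
    case True
    then show ?thesis by (rule integral_nonneg) (rule speed_nonneg[OF assms(1,2)])
  qed (simp add: not_integrable_integral)
  ultimately show ?thesis by simp
qed

lemma chart_segment_C1:
  assumes A: "smooth_atlas A" and c: "c \<in> A" and seg: "closed_segment q q' \<subseteq> coords c"
  shows "C1_curve_on A 0 1 (\<lambda>t. chart_inv c (q + t *\<^sub>R (q' - q)))"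
  unfolding C1_curve_on_def
proof (intro conjI ballI)
  let ?l = "\<lambda>t. q + t *\<^sub>R (q' - q)"
  have l: "?l t \<in> coords c" if "t \<in> {0..1}" for t
  proof -
    have "?l t = (1 - t) *\<^sub>R q + t *\<^sub>R q'" by (simp add: algebra_simps)
    then have "?l t \<in> closed_segment q q'" using that by (auto simp: in_segment)
    then show ?thesis using seg by blast
  qed
  show "continuous_on {0..1} (\<lambda>t. chart_inv c (?l t))"
    by (rule continuous_on_compose2[OF chart_inv_cont[OF A c]]) (auto intro!: continuous_intros l)
  fix c' assume c': "c' \<in> A"
  let ?S = "{t \<in> {0..1}. chart_inv c (?l t) \<in> fst c'}"
  let ?T = "transition c c'"
  let ?O = "snd c ` (fst c \<inter> fst c')"
  have ov: "?l t \<in> ?O" if "t \<in> ?S" for t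
    unfolding chart_image_eq[OF A c] using that l[of t] by simp
  have sm: "smooth_on ?O ?T" using A c c' unfolding smooth_atlas_def by blast
  let ?D = "\<lambda>t. \<Sum>i\<in>UNIV. (q' - q) $ i *\<^sub>R pd i ?T (?l t)"
  show "\<exists>D. continuous_on ?S D \<and> (\<forall>t\<in>{0..1}. chart_inv c (?l t) \<in> fst c' \<longrightarrow>
         ((snd c' \<circ> (\<lambda>t. chart_inv c (?l t))) has_vector_derivative D t) (at t within {0..1}))"
  proof (rule exI[of _ ?D], intro conjI ballI impI)
    have "continuous_on ?S (\<lambda>t. pd i ?T (?l t))" for i
    proof (rule continuous_on_compose2[OF smooth_on_pd_continuous[OF sm]])
      show "continuous_on ?S ?l" by (intro continuous_intros)
      show "?l ` ?S \<subseteq> ?O" using ov by blast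
    qed
    then show "continuous_on ?S ?D" by (intro continuous_intros)
    fix t :: real assume t: "t \<in> {0..1}" "chart_inv c (?l t) \<in> fst c'"
    have o: "?l t \<in> ?O" using ov t by blast
    have "(?l has_vector_derivative (q' - q)) (at t within {0..1})"
      by (auto intro!: derivative_eq_intros simp: has_vector_derivative_def)
    moreover have "(?T has_derivative frechet_derivative ?T (at (?l t))) (at (?l t) within ?l ` {0..1})"
      by (rule has_derivative_at_withinI[OF transition_derivative[OF A c c' o]])
    ultimately have "((?T \<circ> ?l) has_vector_derivative frechet_derivative ?T (at (?l t)) (q' - q)) (at t within {0..1})"
      by (rule vector_derivative_diff_chain_within)
    also have "frechet_derivative ?T (at (?l t)) (q' - q) = ?D t"
      by (rule frechet_derivative_eq_pd[OF smooth_on_differentiable[OF sm o]])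
    also have "?T \<circ> ?l = snd c' \<circ> (\<lambda>t. chart_inv c (?l t))"
      by (simp only: transition_def o_def)
    finally show "((snd c' \<circ> (\<lambda>t. chart_inv c (?l t))) has_vector_derivative ?D t) (at t within {0..1})" .
  qed
qed

text \<open>
  The preimage of a coordinate segment under a chart is a curve whose speed is bounded by a bound
  on the metric coefficients along the segment.
\<close>

lemma chart_segment_joined_by:
  assumes A: "smooth_atlas A" and g: "riemannian_metric A g" and c: "c \<in> A"
    and seg: "closed_segment q q' \<subseteq> coords c" and M: "0 \<le> M"
    and bound: "\<And>w v. w \<in> closed_segment q q' \<Longrightarrow> v \<bullet> (g c w *v v) \<le> M\<^sup>2 * (norm v)\<^sup>2"
  obtains L where "L \<le> M * norm (q' - q)" "joined_by A g (chart_inv c q) (chart_inv c q') L"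
proof
  let ?l = "\<lambda>t. q + t *\<^sub>R (q' - q)"
  let ?\<gamma> = "\<lambda>t. chart_inv c (?l t)"
  have l: "?l t \<in> closed_segment q q'" if "t \<in> {0..1}" for t
  proof -
    have "?l t = (1 - t) *\<^sub>R q + t *\<^sub>R q'" by (simp add: algebra_simps)
    then show ?thesis using that by (auto simp: in_segment)
  qed
  have C1: "C1_curve_on A 0 1 ?\<gamma>" by (rule chart_segment_C1[OF A c seg])
  have p: "piecewise_C1_curve A ?\<gamma>"
    unfolding piecewise_C1_curve_eq by (rule C1_imp_piecewise_C1_on[OF C1]) simp
  then show "joined_by A g (chart_inv c q) (chart_inv c q') (curve_length A g ?\<gamma>)"
    unfolding joined_by_def by (intro exI[of _ ?\<gamma>]) simp
  have sp: "speed A g ?\<gamma> t \<le> M * norm (q' - q)" if t: "t \<in> {0<..<1}" for t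
  proof -
    have lt: "?l t \<in> closed_segment q q'" using l t by simp
    then have co: "?l t \<in> coords c" using seg by blast
    have "continuous_on {0..1} ?\<gamma>" using C1 by (simp add: C1_curve_on_def)
    then have cont: "isCont ?\<gamma> t"
      by (rule continuous_on_interior) (use t in simp)
    have "((snd c \<circ> ?\<gamma>) has_vector_derivative (q' - q)) (at t)"
    proof (rule has_vector_derivative_transform_within_open[of ?l _ _ "{0<..<1}"])
      show "(?l has_vector_derivative (q' - q)) (at t)"
        by (auto intro!: derivative_eq_intros simp: has_vector_derivative_def)
      fix s :: real assume "s \<in> {0<..<1}"
      then have "?l s \<in> coords c" using l[of s] seg by auto
      then show "?l s = (snd c \<circ> ?\<gamma>) s" by (simp add: chart_chart_inv[OF A c])
    qed (use t in auto)
    from speed_in_chart[OF A g c chart_inv_in[OF A c co] cont this]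
    have "speed A g ?\<gamma> t = sqrt ((q' - q) \<bullet> (g c (?l t) *v (q' - q)))"
      by (simp add: chart_chart_inv[OF A c co])
    also have "\<dots> \<le> sqrt (M\<^sup>2 * (norm (q' - q))\<^sup>2)"
      using bound[OF lt, of "q' - q"] by simp
    also have "\<dots> = M * norm (q' - q)" using M by (simp add: real_sqrt_mult)
    finally show ?thesis .
  qed
  define h where "h = (\<lambda>t. if t \<in> {0, 1} then 0 else speed A g ?\<gamma> t)"
  have "speed A g ?\<gamma> integrable_on {0..1}"
    by (rule C1_speed_integrable[OF A g C1]) simp
  then have i: "h integrable_on {0..1}"
    by (rule integrable_spike_finite[of "{0, 1}", rotated 2]) (simp_all add: h_def)
  have "curve_length A g ?\<gamma> = integral {0..1} h"
    unfolding curve_length_def by (rule integral_spike[of "{0, 1}"]) (simp_all add: h_def)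
  also have "\<dots> \<le> integral {0..1} (\<lambda>t::real. M * norm (q' - q))"
  proof (rule integral_le[OF i])
    fix t :: real assume "t \<in> {0..1}"
    then show "h t \<le> M * norm (q' - q)" using sp[of t] M by (auto simp: h_def)
  qed auto
  also have "\<dots> = M * norm (q' - q)" by simp
  finally show "curve_length A g ?\<gamma> \<le> M * norm (q' - q)" .
qed

text \<open>
  The metric coefficients are bounded on a compact coordinate ball.
\<close>

lemma chart_ball_bounded_metric:
  assumes A: "smooth_atlas A" and g: "riemannian_metric A g" and c: "c \<in> A" and q: "q \<in> coords c"
  obtains \<rho> M where "0 < \<rho>" "0 < M" "ball q \<rho> \<subseteq> coords c"
    "\<And>w v. w \<in> ball q \<rho> \<Longrightarrow> v \<bullet> (g c w *v v) \<le> M\<^sup>2 * (norm v)\<^sup>2"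
proof -
  obtain \<rho> where \<rho>: "\<rho> > 0" "cball q \<rho> \<subseteq> coords c"
    using coords_open[OF A c] q open_contains_cball by blast
  let ?s = "\<lambda>w. \<Sum>i\<in>UNIV. \<Sum>j\<in>UNIV. \<bar>g c w $ i $ j\<bar>"
  have "continuous_on (cball q \<rho>) ?s"
    by (intro continuous_on_sum continuous_on_rabs continuous_on_component
        continuous_on_subset[OF metric_cont[OF g c] \<rho>(2)])
  then have "bounded (?s ` cball q \<rho>)"
    by (intro compact_imp_bounded compact_continuous_image) auto
  then obtain B where B: "B > 0" "\<And>w. w \<in> cball q \<rho> \<Longrightarrow> \<bar>?s w\<bar> \<le> B"
    unfolding bounded_pos by auto
  have "v \<bullet> (g c w *v v) \<le> (sqrt B)\<^sup>2 * (norm v)\<^sup>2" if "w \<in> ball q \<rho>" for w v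
  proof -
    have "v \<bullet> (g c w *v v) \<le> norm v * norm (g c w *v v)" by (rule norm_cauchy_schwarz)
    also have "norm (g c w *v v) \<le> onorm ((*v) (g c w)) * norm v"
      by (rule onorm) (rule matrix_vector_mul_bounded_linear)
    also have "onorm ((*v) (g c w)) \<le> B"
      using onorm_le_matrix_component_sum[of "g c w"] B(2)[of w] that by auto
    finally have "v \<bullet> (g c w *v v) \<le> norm v * (B * norm v)"
      by (simp add: mult_left_mono mult_right_mono)
    then show ?thesis using B(1) by (simp add: power2_eq_square algebra_simps)
  qed
  then show ?thesis
    by (intro that[of \<rho> "sqrt B"]) (use \<rho> B(1) in auto)
qed

text \<open>
  Points in a small coordinate ball are joined to its centre, in both directions, by short
  coordinate segments. Both directions are stated in place of a symmetry of \<open>joined_by\<close>, which would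
  require reversing curves.
\<close>

lemma joined_by_nearby:
  assumes A: "smooth_atlas A" and g: "riemannian_metric A g" and e: "0 < e"
  obtains U where "open U" "y \<in> U"
    "\<And>z. z \<in> U \<Longrightarrow> \<exists>L<e. joined_by A g y z L" "\<And>z. z \<in> U \<Longrightarrow> \<exists>L<e. joined_by A g z y L"
proof -
  define c where "c = chart_at A y"
  have c: "c \<in> A" "y \<in> fst c" unfolding c_def by (rule chart_at_in[OF A])+
  let ?q = "snd c y"
  obtain \<rho> M where \<rho>: "0 < \<rho>" "0 < M" "ball ?q \<rho> \<subseteq> coords c"
    and b: "\<And>w v. w \<in> ball ?q \<rho> \<Longrightarrow> v \<bullet> (g c w *v v) \<le> M\<^sup>2 * (norm v)\<^sup>2"
    using chart_ball_bounded_metric[OF A g c(1) chart_in[OF A c]] by blast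
  define r where "r = min \<rho> (e / M)"
  have r: "0 < r" "r \<le> \<rho>" "r \<le> e / M" using \<rho> e by (auto simp: r_def)
  let ?U = "fst c \<inter> snd c -` ball ?q r"
  show ?thesis
  proof (rule that)
    show "open ?U" by (rule continuous_open_preimage[OF chart_cont[OF A c(1)] chart_open[OF A c(1)]]) simp
    show "y \<in> ?U" using c r by simp
    fix z assume z: "z \<in> ?U"
    then have zb: "snd c z \<in> ball ?q r" by simp
    have yb: "?q \<in> ball ?q r" using r by simp
    have ball: "ball ?q r \<subseteq> ball ?q \<rho>" using r by (simp add: subset_ball)
    have s1: "closed_segment ?q (snd c z) \<subseteq> ball ?q \<rho>" "closed_segment (snd c z) ?q \<subseteq> ball ?q \<rho>"
      using closed_segment_subset[OF yb zb] closed_segment_subset[OF zb yb] ball by auto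
    have inv: "chart_inv c ?q = y" "chart_inv c (snd c z) = z"
      using chart_inv_chart[OF A c(1)] c z by auto
    have "norm (snd c z - ?q) < e / M" using zb r by (simp add: dist_norm norm_minus_commute)
    then have small: "M * norm (snd c z - ?q) < e" "M * norm (?q - snd c z) < e"
      using \<rho>(2) by (simp_all add: field_simps norm_minus_commute)
    obtain L where "L \<le> M * norm (snd c z - ?q)" "joined_by A g y z L"
      by (rule chart_segment_joined_by[OF A g c(1) order_trans[OF s1(1) \<rho>(3)]
            less_imp_le[OF \<rho>(2)] b[OF subsetD[OF s1(1)]], unfolded inv])
    then show "\<exists>L<e. joined_by A g y z L" using small by (intro exI[of _ L]) simp
    obtain L where "L \<le> M * norm (?q - snd c z)" "joined_by A g z y L"
      by (rule chart_segment_joined_by[OF A g c(1) order_trans[OF s1(2) \<rho>(3)]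
            less_imp_le[OF \<rho>(2)] b[OF subsetD[OF s1(2)]], unfolded inv])
    then show "\<exists>L<e. joined_by A g z y L" using small by (intro exI[of _ L]) simp
  qed
qed

text \<open>
  The set of points that can be joined to \<open>x\<close> is open, and so is its complement.
\<close>

lemma connected_imp_joined_by:
  fixes A :: "('m::topological_space, 'n::finite) chart set"
  assumes A: "smooth_atlas A" and g: "riemannian_metric A g" and con: "connected (UNIV :: 'm set)"
  shows "\<exists>L. joined_by A g x y L"
proof -
  let ?R = "{y. \<exists>L. joined_by A g x y L}"
  have 1: "open ?R"
  proof (subst open_subopen, intro ballI)
    fix y assume "y \<in> ?R"
    then obtain L where L: "joined_by A g x y L" by blast
    obtain U where U: "open U" "y \<in> U" "\<And>z. z \<in> U \<Longrightarrow> \<exists>L<1. joined_by A g y z L"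
      using joined_by_nearby[OF A g zero_less_one, of y] by metis
    have "U \<subseteq> ?R" using U(3) joined_by_trans[OF A g L] by blast
    then show "\<exists>T. open T \<and> y \<in> T \<and> T \<subseteq> ?R" using U by blast
  qed
  have 2: "open (- ?R)"
  proof (subst open_subopen, intro ballI)
    fix y assume y: "y \<in> - ?R"
    obtain U where U: "open U" "y \<in> U" "\<And>z. z \<in> U \<Longrightarrow> \<exists>L<1. joined_by A g z y L"
      using joined_by_nearby[OF A g zero_less_one, of y] by metis
    have "U \<subseteq> - ?R"
    proof
      fix z assume "z \<in> U"
      then obtain L where "joined_by A g z y L" using U(3) by blast
      then show "z \<in> - ?R" using y joined_by_trans[OF A g] by blast
    qed
    then show "\<exists>T. open T \<and> y \<in> T \<and> T \<subseteq> - ?R" using U by blast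
  qed
  have "x \<in> ?R" using joined_by_nearby[OF A g zero_less_one, of x] by (metis mem_Collect_eq)
  then have "?R = UNIV" using con 1 2 connected_clopen[of "UNIV :: 'm set"] by (auto simp: closed_def)
  then show ?thesis by blast
qed

lemma geodesic_dist_eq: "geodesic_dist A g x y = Inf {L. joined_by A g x y L}"
  unfolding geodesic_dist_def joined_by_def by (rule arg_cong[where f=Inf]) blast

lemma geodesic_dist_le:
  assumes A: "smooth_atlas A" and g: "riemannian_metric A g" and "joined_by A g x y L"
  shows "geodesic_dist A g x y \<le> L"
  unfolding geodesic_dist_eq
proof (rule cInf_lower)
  show "bdd_below {L. joined_by A g x y L}"
    using joined_by_nonneg[OF A g] by (auto intro!: bdd_belowI[of _ 0])
qed (use assms(3) in simp)

text \<open>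
  Connectedness enters here: it makes the set of lengths nonempty, so that its infimum is
  approached by lengths of curves.
\<close>

lemma geodesic_dist_lessE:
  fixes A :: "('m::topological_space, 'n::finite) chart set"
  assumes A: "smooth_atlas A" and g: "riemannian_metric A g" and con: "connected (UNIV :: 'm set)"
    and "geodesic_dist A g x y < r"
  obtains L where "L < r" "joined_by A g x y L"
proof -
  have "{L. joined_by A g x y L} \<noteq> {}" using connected_imp_joined_by[OF A g con] by blast
  from cInf_lessD[OF this] assms(4) show ?thesis
    unfolding geodesic_dist_eq using that by blast
qed

text \<open>
  Extending a short enough curve by a coordinate segment stays within the radius. Openness is
  what makes geodesic balls measurable.
\<close>

lemma geodesic_ball_open:
  fixes A :: "('m::topological_space, 'n::finite) chart set"
  assumes A: "smooth_atlas A" and g: "riemannian_metric A g" and con: "connected (UNIV :: 'm set)"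
  shows "open (geodesic_ball A g x r)"
proof (subst open_subopen, intro ballI)
  fix y assume "y \<in> geodesic_ball A g x r"
  then obtain L where L: "L < r" "joined_by A g x y L"
    using geodesic_dist_lessE[OF A g con] unfolding geodesic_ball_def by blast
  obtain U where U: "open U" "y \<in> U" "\<And>z. z \<in> U \<Longrightarrow> \<exists>L'<r-L. joined_by A g y z L'"
    using joined_by_nearby[OF A g, of "r - L" y] L(1) by (metis diff_gt_0_iff_gt)
  have "z \<in> geodesic_ball A g x r" if z: "z \<in> U" for z
  proof -
    obtain L' where L': "L' < r - L" "joined_by A g y z L'" using U(3)[OF z] by blast
    have "geodesic_dist A g x z \<le> L + L'"
      by (rule geodesic_dist_le[OF A g joined_by_trans[OF A g L(2) L'(2)]])
    then show ?thesis using L' by (simp add: geodesic_ball_def)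
  qed
  then show "\<exists>T. open T \<and> y \<in> T \<and> T \<subseteq> geodesic_ball A g x r" using U by blast
qed

lemma centre_in_geodesic_ball:
  assumes A: "smooth_atlas A" and g: "riemannian_metric A g" and "0 < r"
  shows "x \<in> geodesic_ball A g x r"
proof -
  obtain L where "L < r" "joined_by A g x x L"
    using joined_by_nearby[OF A g assms(3), of x] by metis
  then show ?thesis using geodesic_dist_le[OF A g] by (force simp: geodesic_ball_def)
qed

section \<open>Volume of small geodesic balls\<close>

text \<open>
  At \<open>p\<close> itself \<open>transpose P ** g ** P\<close> is the identity matrix, hence near \<open>p\<close> it is close to it by
  continuity. With \<open>Q\<close> the inverse of \<open>P\<close>, the norm \<open>\<lambda>v. norm (Q *v v)\<close> is the one that the metric
  has at \<open>p\<close>, and \<open>1 / \<bar>det P\<bar>\<close> is the volume density at \<open>p\<close>.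
\<close>

lemma metric_nearly_constant:
  fixes A :: "('m::topological_space, 'n::finite) chart set"
  assumes A: "smooth_atlas A" and g: "riemannian_metric A g" and c: "c \<in> A" and p: "p \<in> coords c"
    and e: "0 < e" "e < 1"
  obtains P Q :: "real^'n^'n" and \<rho> :: real
  where "P ** Q = mat 1" "Q ** P = mat 1" "0 < \<rho>" "cball p \<rho> \<subseteq> coords c"
    "\<forall>z\<in>cball p \<rho>. \<forall>v. (1 - e) * norm (Q *v v) \<le> sqrt (v \<bullet> (g c z *v v))"
    "\<forall>z\<in>cball p \<rho>. \<bar>det P\<bar> * sqrt (det (g c z)) \<le> 1 + e"
proof -
  obtain P :: "real^'n^'n" where P: "transpose P ** g c p ** P = mat 1"
    using posdef_congruent_identity[OF metric_sym[OF g c p] metric_pos[OF g c p]] by blast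
  define Q where "Q = transpose P ** g c p"
  have QP: "Q ** P = mat 1" using P by (simp add: Q_def)
  then have PQ: "P ** Q = mat 1" by (simp add: matrix_left_right_inverse)
  define F where "F = (\<lambda>z. transpose P ** g c z ** P)"
  define s where "s = (\<lambda>z. \<Sum>i\<in>UNIV. \<Sum>j\<in>UNIV. \<bar>(F z - mat 1) $ i $ j\<bar>)"
  define t where "t = (\<lambda>z. \<bar>det P\<bar> * sqrt (det (g c z)))"
  have F_entry: "F z $ i $ j = (\<Sum>l\<in>UNIV. (\<Sum>k\<in>UNIV. P $ k $ i * g c z $ k $ l) * P $ l $ j)" for z i j
    by (simp add: F_def matrix_matrix_mult_def transpose_def)
  have "continuous_on (coords c) (\<lambda>z. F z $ i $ j)" for i j
    unfolding F_entry
    by (intro continuous_on_sum continuous_on_mult continuous_on_const continuous_on_component metric_cont[OF g c])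
  then have cs: "continuous_on (coords c) s"
    unfolding s_def vector_minus_component by (intro continuous_on_sum continuous_on_rabs continuous_on_diff continuous_on_const)
  have ct: "continuous_on (coords c) t"
    unfolding t_def by (intro continuous_on_mult continuous_on_const continuous_on_real_sqrt continuous_on_det metric_cont[OF g c])
  have sp: "s p = 0" by (simp add: s_def F_def P)
  have tp: "t p = 1"
  proof -
    have "det (transpose P ** g c p ** P) = 1" using P by simp
    then have "(det P)\<^sup>2 * det (g c p) = 1" by (simp add: det_mul power2_eq_square algebra_simps)
    then have "sqrt ((det P)\<^sup>2 * det (g c p)) = 1" by simp
    then show ?thesis by (simp add: t_def real_sqrt_mult)
  qed
  define \<eta> where "\<eta> = 1 - (1 - e)\<^sup>2"
  have "(1 - e)\<^sup>2 < 1\<^sup>2" by (rule power_strict_mono) (use e in auto)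
  then have \<eta>: "0 < \<eta>" by (simp add: \<eta>_def)
  (* On W the form of g is at least (1 - \<eta>) times the squared norm, and 1 - \<eta> = (1 - e)^2. *)
  let ?W = "(coords c \<inter> s -` {..<\<eta>}) \<inter> (coords c \<inter> t -` {..<1 + e})"
  have "open ?W"
    by (intro open_Int continuous_open_preimage cs ct coords_open[OF A c]) auto
  moreover have "p \<in> ?W" using p sp tp \<eta> e by simp
  ultimately obtain \<rho> where \<rho>: "0 < \<rho>" "cball p \<rho> \<subseteq> ?W"
    using open_contains_cball by metis
  show ?thesis
  proof (rule that[OF PQ QP \<rho>(1)], safe)
    show "z \<in> coords c" if "z \<in> cball p \<rho>" for z using \<rho>(2) that by blast
  next
    fix z assume z: "z \<in> cball p \<rho>"
    then have "z \<in> ?W" using \<rho>(2) by blast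
    then have sz: "s z < \<eta>" and tz: "t z < 1 + e" by auto
    show "\<bar>det P\<bar> * sqrt (det (g c z)) \<le> 1 + e" using tz by (simp add: t_def)
    fix v
    define u where "u = Q *v v"
    have v: "v = P *v u" by (simp add: u_def matrix_vector_mul_assoc PQ)
    have "v \<bullet> (g c z *v v) = u \<bullet> (F z *v u)"
    proof -
      have "u \<bullet> (F z *v u) = u \<bullet> (transpose P *v (g c z *v (P *v u)))"
        by (simp add: F_def matrix_vector_mul_assoc matrix_mul_assoc)
      also have "\<dots> = (P *v u) \<bullet> (g c z *v (P *v u))"
        by (simp only: dot_lmul_matrix[symmetric] vector_transpose_matrix)
      finally show ?thesis by (simp add: v)
    qed
    also have "F z *v u = u + (F z - mat 1) *v u"
      by (simp add: matrix_vector_mult_diff_rdistrib)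
    finally have q: "v \<bullet> (g c z *v v) = (norm u)\<^sup>2 + u \<bullet> ((F z - mat 1) *v u)"
      by (simp add: inner_add_right power2_norm_eq_inner)
    have "\<bar>u \<bullet> ((F z - mat 1) *v u)\<bar> \<le> norm u * norm ((F z - mat 1) *v u)"
      by (rule Cauchy_Schwarz_ineq2)
    also have "norm ((F z - mat 1) *v u) \<le> onorm ((*v) (F z - mat 1)) * norm u"
      by (rule onorm) (rule matrix_vector_mul_bounded_linear)
    also have "onorm ((*v) (F z - mat 1)) \<le> \<eta>"
      using onorm_le_matrix_component_sum[of "F z - mat 1"] sz unfolding s_def by linarith
    finally have "\<bar>u \<bullet> ((F z - mat 1) *v u)\<bar> \<le> norm u * (\<eta> * norm u)"
      by (simp add: mult_left_mono mult_right_mono)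
    then have "(1 - \<eta>) * (norm u)\<^sup>2 \<le> v \<bullet> (g c z *v v)"
      unfolding q by (simp add: power2_eq_square algebra_simps)
    then have "((1 - e) * norm u)\<^sup>2 \<le> v \<bullet> (g c z *v v)"
      by (simp add: \<eta>_def power_mult_distrib)
    then show "(1 - e) * norm (Q *v v) \<le> sqrt (v \<bullet> (g c z *v v))"
      unfolding u_def by (rule real_le_rsqrt)
  qed
qed

text \<open>
  On each \<open>C\<^sup>1\<close> piece the displacement is the integral of the velocity, whose norm is bounded by
  the speed. Pieces are added by the triangle inequality.
\<close>

lemma chart_displacement_le_length:
  fixes A :: "('m::topological_space, 'n::finite) chart set" and Q :: "real^'n^'n"
  assumes A: "smooth_atlas A" and g: "riemannian_metric A g" and c: "c \<in> A"
    and W: "W \<subseteq> fst c"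
    and bound: "\<And>y v. y \<in> W \<Longrightarrow> k * norm (Q *v v) \<le> sqrt (v \<bullet> (g c (snd c y) *v v))"
    and C: "piecewise_C1_on A a b \<gamma>" and s: "a < s" "s \<le> b" and in_W: "\<And>t. t \<in> {a..s} \<Longrightarrow> \<gamma> t \<in> W"
    and k: "0 < k"
  shows "k * norm (Q *v (snd c (\<gamma> s) - snd c (\<gamma> a))) \<le> integral {a..s} (speed A g \<gamma>)"
proof -
  have piece: "k * norm (Q *v (snd c (\<gamma> s) - snd c (\<gamma> p))) \<le> integral {p..s} (speed A g \<gamma>)"
    if C1: "C1_curve_on A p q \<gamma>" and ps: "p < s" "s \<le> q" and iW: "\<And>t. t \<in> {p..s} \<Longrightarrow> \<gamma> t \<in> W" for p q s
  proof -
    let ?f = "\<lambda>t. Q *v (snd c (\<gamma> t))"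
    let ?f' = "\<lambda>t. Q *v vector_derivative (snd c \<circ> \<gamma>) (at t)"
    have C1s: "C1_curve_on A p s \<gamma>" by (rule C1_curve_on_subinterval[OF C1]) (use ps in auto)
    then have cg: "continuous_on {p..s} \<gamma>" by (simp add: C1_curve_on_def)
    have cf: "continuous_on {p..s} (\<lambda>t. snd c (\<gamma> t))"
      by (rule continuous_on_compose2[OF chart_cont[OF A c] cg]) (use iW W in auto)
    obtain D where D: "\<And>t. t \<in> {p..s} \<Longrightarrow> \<gamma> t \<in> fst c \<Longrightarrow> ((snd c \<circ> \<gamma>) has_vector_derivative D t) (at t within {p..s})"
      by (rule C1_curve_onE[OF C1s c]) (rule that, simp)
    have der: "((snd c \<circ> \<gamma>) has_vector_derivative vector_derivative (snd c \<circ> \<gamma>) (at t)) (at t)" if t: "t \<in> {p<..<s}" for t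
    proof -
      have "((snd c \<circ> \<gamma>) has_vector_derivative D t) (at t within {p..s})"
        by (rule D) (use t iW[of t] W in auto)
      then have "((snd c \<circ> \<gamma>) has_vector_derivative D t) (at t)"
        using at_within_Icc_at[of p t s] t by simp
      then show ?thesis by (simp add: vector_derivative_at)
    qed
    have "(?f' has_integral ?f s - ?f p) {p..s}"
    proof (rule fundamental_theorem_of_calculus_interior)
      show "p \<le> s" using ps by simp
      show "continuous_on {p..s} ?f"
        by (rule bounded_linear.continuous_on[OF matrix_vector_mul_bounded_linear cf])
      fix t assume "t \<in> {p<..<s}"
      from bounded_linear.has_vector_derivative[OF matrix_vector_mul_bounded_linear[of Q] der[OF this]]
      show "(?f has_vector_derivative ?f' t) (at t)" by (simp add: o_def)
    qed
    then have hf: "(?f' has_integral Q *v (snd c (\<gamma> s) - snd c (\<gamma> p))) {p..s}"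
      by (simp add: matrix_vector_mult_diff_distrib)
    define h where "h = (\<lambda>t. if t \<in> {p, s} then 0 else ?f' t)"
    have hh: "(h has_integral Q *v (snd c (\<gamma> s) - snd c (\<gamma> p))) {p..s}"
      by (rule has_integral_spike_finite[OF _ _ hf, of "{p, s}"]) (simp_all add: h_def)
    have hk: "((\<lambda>t. k *\<^sub>R h t) has_integral k *\<^sub>R (Q *v (snd c (\<gamma> s) - snd c (\<gamma> p)))) {p..s}"
      by (rule has_integral_cmul[OF hh])
    have "norm (integral {p..s} (\<lambda>t. k *\<^sub>R h t)) \<le> integral {p..s} (speed A g \<gamma>)"
    proof (rule Henstock_Kurzweil_Integration.integral_norm_bound_integral)
      show "(\<lambda>t. k *\<^sub>R h t) integrable_on {p..s}" using hk by (rule has_integral_integrable)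
      show "speed A g \<gamma> integrable_on {p..s}" by (rule C1_speed_integrable[OF A g C1s ps(1)])
      fix t assume t: "t \<in> {p..s}"
      show "norm (k *\<^sub>R h t) \<le> speed A g \<gamma> t"
      proof (cases "t \<in> {p, s}")
        case True
        then have "h t = 0" unfolding h_def by (rule if_P)
        then show ?thesis using speed_nonneg[OF A g, of \<gamma> t] by simp
      next
        case False
        then have t': "t \<in> {p<..<s}" using t by auto
        have gW: "\<gamma> t \<in> W" by (rule iW[OF t])
        have "isCont \<gamma> t" by (rule continuous_on_interior[OF cg]) (use t' in simp)
        from speed_in_chart[OF A g c subsetD[OF W gW] this der[OF t']]
        have "k * norm (?f' t) \<le> speed A g \<gamma> t" using bound[OF gW] by simp
        then show ?thesis using False k by (simp add: h_def)
      qed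
    qed
    then show ?thesis using k by (simp add: integral_unique[OF hh])
  qed
  let ?P = "\<lambda>p q. \<forall>s. p < s \<and> s \<le> q \<and> (\<forall>t\<in>{p..s}. \<gamma> t \<in> W) \<longrightarrow>
     k * norm (Q *v (snd c (\<gamma> s) - snd c (\<gamma> p))) \<le> integral {p..s} (speed A g \<gamma>)"
  have "speed A g \<gamma> integrable_on {a..b} \<and> ?P a b"
    using C less_le_trans[OF s]
  proof (rule piecewise_C1_on_induct)
    fix p q assume pq: "p < q" "C1_curve_on A p q \<gamma>"
    show "speed A g \<gamma> integrable_on {p..q} \<and> ?P p q"
      using C1_speed_integrable[OF A g pq(2,1)] piece[OF pq(2)] by blast
  next
    fix p q r assume pqr: "p < q" "q < r"
      and 1: "speed A g \<gamma> integrable_on {p..q} \<and> ?P p q"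
      and 2: "speed A g \<gamma> integrable_on {q..r} \<and> ?P q r"
    have i: "speed A g \<gamma> integrable_on {p..r}"
      by (rule Henstock_Kurzweil_Integration.integrable_combine[of p q r]) (use pqr 1 2 in auto)
    have "?P p r"
    proof (intro allI impI)
      fix s assume s: "p < s \<and> s \<le> r \<and> (\<forall>t\<in>{p..s}. \<gamma> t \<in> W)"
      show "k * norm (Q *v (snd c (\<gamma> s) - snd c (\<gamma> p))) \<le> integral {p..s} (speed A g \<gamma>)"
      proof (cases "s \<le> q")
        case True
        then show ?thesis using 1 s by blast
      next
        case False
        have "k * norm (Q *v (snd c (\<gamma> q) - snd c (\<gamma> p))) \<le> integral {p..q} (speed A g \<gamma>)"
          using conjunct2[OF 1] pqr s False by auto
        moreover have "k * norm (Q *v (snd c (\<gamma> s) - snd c (\<gamma> q))) \<le> integral {q..s} (speed A g \<gamma>)"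
          using conjunct2[OF 2] pqr s False by auto
        moreover have "integral {p..q} (speed A g \<gamma>) + integral {q..s} (speed A g \<gamma>) = integral {p..s} (speed A g \<gamma>)"
        proof (rule Henstock_Kurzweil_Integration.integral_combine)
          show "speed A g \<gamma> integrable_on {p..s}"
            by (rule integrable_on_subinterval[OF i]) (use s in auto)
        qed (use pqr False in auto)
        moreover have "norm (Q *v (snd c (\<gamma> s) - snd c (\<gamma> p))) \<le>
            norm (Q *v (snd c (\<gamma> s) - snd c (\<gamma> q))) + norm (Q *v (snd c (\<gamma> q) - snd c (\<gamma> p)))"
          using norm_triangle_ineq[of "Q *v (snd c (\<gamma> s) - snd c (\<gamma> q))" "Q *v (snd c (\<gamma> q) - snd c (\<gamma> p))"]
          by (simp add: matrix_vector_mult_diff_distrib)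
        ultimately show ?thesis
          using mult_left_mono[OF _ less_imp_le[OF k]] by (fastforce simp: distrib_left)
      qed
    qed
    with i show "speed A g \<gamma> integrable_on {p..r} \<and> ?P p r" by blast
  qed
  then show ?thesis using s in_W by blast
qed

text \<open>
  Consider the first time at which the curve is outside the open ellipsoid of radius \<open>b\<close>. Up to that
  time it runs in the closed ellipsoid, whose preimage is compact, hence closed in the manifold.
  So the displacement estimate applies and puts the curve strictly inside, a contradiction.
  That the manifold is Hausdorff is used to pass from compact to closed.
\<close>

lemma short_curve_stays_in_chart:
  fixes A :: "('m::t2_space, 'n::finite) chart set" and Q :: "real^'n^'n"
  assumes A: "smooth_atlas A" and g: "riemannian_metric A g" and c: "c \<in> A" and x: "x \<in> fst c"
    and k: "0 < k" and b: "0 < b"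
    and K: "compact {z. norm (Q *v (z - snd c x)) \<le> b}" "{z. norm (Q *v (z - snd c x)) \<le> b} \<subseteq> coords c"
    and bound: "\<And>z v. norm (Q *v (z - snd c x)) \<le> b \<Longrightarrow> k * norm (Q *v v) \<le> sqrt (v \<bullet> (g c z *v v))"
    and L: "L < k * b" "joined_by A g x y L"
  shows "y \<in> fst c \<and> norm (Q *v (snd c y - snd c x)) < b"
proof (rule ccontr)
  let ?p = "snd c x"
  let ?N = "\<lambda>y. norm (Q *v (snd c y - ?p))"
  let ?Z = "{z. norm (Q *v (z - ?p)) \<le> b}"
  let ?W = "fst c \<inter> {y. ?N y < b}"
  let ?Wc = "fst c \<inter> {y. ?N y \<le> b}"
  assume ny: "\<not> (y \<in> fst c \<and> ?N y < b)"
  obtain \<gamma> where C: "piecewise_C1_on A 0 1 \<gamma>" and ends: "\<gamma> 0 = x" "\<gamma> 1 = y"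
    and len: "integral {0..1} (speed A g \<gamma>) = L"
    using L(2) unfolding joined_by_def piecewise_C1_curve_eq curve_length_def by blast
  have cg: "continuous_on {0..1} \<gamma>" by (rule piecewise_C1_on_continuous[OF C]) simp
  have cN: "continuous_on (fst c) ?N"
    by (intro continuous_on_norm bounded_linear.continuous_on[OF matrix_vector_mul_bounded_linear]
        continuous_on_diff continuous_on_const chart_cont[OF A c])
  have oW: "open ?W"
  proof -
    have "open (fst c \<inter> ?N -` {..<b})"
      by (rule continuous_open_preimage[OF cN chart_open[OF A c]]) simp
    moreover have "fst c \<inter> ?N -` {..<b} = ?W" by auto
    ultimately show ?thesis by simp
  qed
  have cWc: "closed ?Wc"
  proof -
    have "?Wc = chart_inv c ` ?Z"
    proof (intro equalityI subsetI)
      fix y assume "y \<in> ?Wc"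
      then have "chart_inv c (snd c y) = y" "snd c y \<in> ?Z" using chart_inv_chart[OF A c] by auto
      then show "y \<in> chart_inv c ` ?Z" by (metis imageI)
    next
      fix y assume "y \<in> chart_inv c ` ?Z"
      then obtain z where z: "z \<in> ?Z" "y = chart_inv c z" by blast
      then have "z \<in> coords c" using K(2) by blast
      then show "y \<in> ?Wc" using z chart_inv_in[OF A c] chart_chart_inv[OF A c] by simp
    qed
    moreover have "compact (chart_inv c ` ?Z)"
      by (rule compact_continuous_image[OF continuous_on_subset[OF chart_inv_cont[OF A c] K(2)] K(1)])
    ultimately show ?thesis by (simp add: compact_imp_closed)
  qed
  define T where "T = {0..1} \<inter> \<gamma> -` (- ?W)"
  have T1: "1 \<in> T" using ny ends by (auto simp: T_def)
  have cT: "closed T"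
    unfolding T_def by (rule continuous_closed_preimage[OF cg closed_atLeastAtMost closed_Compl[OF oW]])
  have bT: "bdd_below T" by (rule bdd_belowI[of _ 0]) (simp add: T_def)
  define s where "s = Inf T"
  have sT: "s \<in> T" unfolding s_def by (rule closed_contains_Inf[OF _ bT cT]) (use T1 in blast)
  then have s01: "0 \<le> s" "s \<le> 1" and sW: "\<gamma> s \<notin> ?W" by (auto simp: T_def)
  have "s \<noteq> 0"
  proof
    assume "s = 0"
    then show False using sW ends x b by simp
  qed
  then have s0: "0 < s" using s01 by simp
  have before: "\<gamma> t \<in> ?W" if "t \<in> {0..<s}" for t
  proof (rule ccontr)
    assume "\<gamma> t \<notin> ?W"
    then have "t \<in> T" using that s01 by (simp add: T_def)
    then have "s \<le> t" unfolding s_def by (rule cInf_lower[OF _ bT])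
    then show False using that by simp
  qed
  have upto: "\<gamma> t \<in> ?Wc" if "t \<in> {0..s}" for t
  proof -
    have "{0..s} \<subseteq> {0..1} \<inter> \<gamma> -` ?Wc"
    proof -
      have "closure {0..<s} \<subseteq> {0..1} \<inter> \<gamma> -` ?Wc"
      proof (rule closure_minimal)
        show "{0..<s} \<subseteq> {0..1} \<inter> \<gamma> -` ?Wc" using before s01 by force
        show "closed ({0..1} \<inter> \<gamma> -` ?Wc)" by (rule continuous_closed_preimage[OF cg _ cWc]) simp
      qed
      then show ?thesis using s0 by simp
    qed
    then show ?thesis using that by blast
  qed
  have "k * norm (Q *v (snd c (\<gamma> s) - snd c (\<gamma> 0))) \<le> integral {0..s} (speed A g \<gamma>)"
  proof (rule chart_displacement_le_length[OF A g c _ _ C s0 s01(2) upto k])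
    show "?Wc \<subseteq> fst c" by blast
    fix y v assume "y \<in> ?Wc"
    then show "k * norm (Q *v v) \<le> sqrt (v \<bullet> (g c (snd c y) *v v))" by (intro bound) simp
  qed
  also have "\<dots> \<le> integral {0..1} (speed A g \<gamma>)"
  proof (rule integral_subset_le)
    show i: "speed A g \<gamma> integrable_on {0..1}" by (rule speed_integrable[OF A g C]) simp
    show "speed A g \<gamma> integrable_on {0..s}" by (rule integrable_on_subinterval[OF i]) (use s01 in auto)
  qed (use s01 speed_nonneg[OF A g] in auto)
  also have "\<dots> < k * b" using len L(1) by simp
  finally have "?N (\<gamma> s) < b" using k ends by simp
  moreover have "\<gamma> s \<in> fst c" using upto[of s] s0 by simp
  ultimately show False using sW by simp
qed

lemma emeasure_affine_image_ball:
  fixes P :: "real^'n^'n::finite"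
  assumes "Q ** P = mat 1"
  shows "emeasure lborel ((\<lambda>u. p + P *v u) ` ball 0 b) = ennreal \<bar>det P\<bar> * emeasure lborel (ball (0::real^'n) b)"
proof -
  let ?T = "\<lambda>u. p + P *v u"
  have inj: "inj_on ?T S" for S
    by (rule inj_on_inverseI[of _ "\<lambda>z. Q *v (z - p)"]) (simp add: matrix_vector_mul_assoc assms)
  have "inj ((*v) P)"
    by (rule inj_on_inverseI[of _ "\<lambda>z. Q *v z"]) (simp add: matrix_vector_mul_assoc assms)
  then have "open ((*v) P ` ball 0 b)"
    by (intro open_bijective_linear_image_eq[THEN iffD2] matrix_vector_mul_linear)
       (auto simp: bij_def linear_injective_imp_surjective)
  then have op: "open (?T ` ball 0 b)"
    using open_translation[of "(*v) P ` ball 0 b" p] by (simp add: image_image)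
  have m: "(\<lambda>x. indicat_real (ball 0 b) x * \<bar>det P\<bar>) \<in> borel_measurable (borel :: (real^'n) measure)"
    by (intro borel_measurable_times borel_measurable_indicator) auto
  have d: "(?T has_derivative (*v) P) (at u within ball 0 b)" for u
    by (auto intro!: derivative_eq_intros bounded_linear_imp_has_derivative matrix_vector_mul_bounded_linear)
  have "(\<integral>\<^sup>+y. ennreal (indicator (?T ` ball 0 b) y * 1) \<partial>lborel) =
         (\<integral>\<^sup>+x. ennreal (indicator (ball (0::real^'n) b) x * (\<bar>det (matrix ((*v) P))\<bar> * 1)) \<partial>lborel)"
    using nn_integral_change_of_variables[where S="ball 0 b" and T="?T" and T'="\<lambda>_. (*v) P" and f="\<lambda>_. 1"]
      d inj op m by simp
  also have "\<dots> = (\<integral>\<^sup>+x. ennreal \<bar>det P\<bar> * indicator (ball (0::real^'n) b) x \<partial>lborel)"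
    by (rule nn_integral_cong) (simp add: matrix_of_matrix_vector_mul indicator_def)
  also have "\<dots> = ennreal \<bar>det P\<bar> * emeasure lborel (ball (0::real^'n) b)"
    by (rule nn_integral_cmult_indicator) simp
  finally show ?thesis using op by (simp add: ennreal_indicator)
qed

text \<open>
  In a chart, a geodesic ball of small radius \<open>r\<close> lies in the ellipsoid of radius \<open>r / (1 - e)\<close> for the
  metric at the centre, and the volume density is at most \<open>1 + e\<close> times its value at the centre.
  The ellipsoid is an affine image of a Euclidean ball, whose determinant cancels that value.
  Positivity holds because the ball is open and nonempty.
\<close>

theorem small_geodesic_ball_volume:
  fixes A :: "('m::{t2_space, second_countable_topology}, 'n::finite) chart set"
  assumes M: "riemannian_manifold A g" and con: "connected (UNIV :: 'm set)" and e: "0 < e" "e < 1"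
  obtains r0 where "0 < r0"
    "\<And>r. 0 < r \<Longrightarrow> r < r0 \<Longrightarrow> 0 < measure (riemannian_volume A g) (geodesic_ball A g x r)"
    "\<And>r. 0 < r \<Longrightarrow> r < r0 \<Longrightarrow> measure (riemannian_volume A g) (geodesic_ball A g x r)
        \<le> (1 + e) / (1 - e) ^ CARD('n) * measure lborel (ball (0 :: real^'n) r)"
proof -
  note A = manifold_atlas[OF M] and g = manifold_metric[OF M]
  define c where "c = chart_at A x"
  have c: "c \<in> A" "x \<in> fst c" unfolding c_def by (rule chart_at_in[OF A])+
  let ?p = "snd c x"
  obtain P Q :: "real^'n^'n" and \<rho> :: real where PQ: "P ** Q = mat 1" "Q ** P = mat 1"
    and \<rho>: "0 < \<rho>" "cball ?p \<rho> \<subseteq> coords c"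
    and lower: "\<forall>z\<in>cball ?p \<rho>. \<forall>v. (1 - e) * norm (Q *v v) \<le> sqrt (v \<bullet> (g c z *v v))"
    and upper: "\<forall>z\<in>cball ?p \<rho>. \<bar>det P\<bar> * sqrt (det (g c z)) \<le> 1 + e"
    using metric_nearly_constant[OF A g c(1) chart_in[OF A c] e] .
  have detP: "\<bar>det P\<bar> > 0"
  proof -
    have "det P * det Q = 1" using PQ(1) by (metis det_I det_mul)
    then show ?thesis by auto
  qed
  define k where "k = 1 - e"
  have k: "0 < k" using e by (simp add: k_def)
  let ?o = "onorm ((*v) P)"
  have o: "0 \<le> ?o" by (rule onorm_pos_le) (rule matrix_vector_mul_bounded_linear)
  (* Ellipsoids of radius at most b0 lie in the coordinate ball of radius \<rho>. *)
  define b0 where "b0 = \<rho> / (?o + 1)"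
  have b0: "0 < b0" using \<rho> o by (simp add: b0_def)
  let ?Z = "\<lambda>b. {z. norm (Q *v (z - ?p)) \<le> b}"
  have Z: "?Z b \<subseteq> cball ?p \<rho>" if b: "b \<le> b0" for b
  proof
    fix z assume z: "z \<in> ?Z b"
    have "z - ?p = P *v (Q *v (z - ?p))" by (simp add: matrix_vector_mul_assoc PQ)
    then have "norm (z - ?p) = norm (P *v (Q *v (z - ?p)))" by simp
    also have "\<dots> \<le> ?o * norm (Q *v (z - ?p))" by (rule onorm) (rule matrix_vector_mul_bounded_linear)
    also have "\<dots> \<le> ?o * b0" using z b o by (intro mult_left_mono) auto
    also have "\<dots> \<le> (?o + 1) * b0" using b0 by simp
    also have "\<dots> = \<rho>" using o by (simp add: b0_def)
    finally show "z \<in> cball ?p \<rho>" by (simp add: dist_norm norm_minus_commute)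
  qed
  have compact_Z: "compact (?Z b)" if b: "b \<le> b0" for b
  proof -
    have "closed ((\<lambda>z. norm (Q *v (z - ?p))) -` {..b})"
      by (intro closed_vimage closed_atMost continuous_on_norm
          bounded_linear.continuous_on[OF matrix_vector_mul_bounded_linear] continuous_intros)
    moreover have "(\<lambda>z. norm (Q *v (z - ?p))) -` {..b} = ?Z b" by auto
    ultimately show ?thesis
      using bounded_subset[OF bounded_cball Z[OF b]] by (simp add: compact_eq_bounded_closed)
  qed
  let ?V = "riemannian_volume A g" and ?B = "geodesic_ball A g x"
  have main: "0 < measure ?V (?B r) \<and> measure ?V (?B r) \<le> (1 + e) / (1 - e) ^ CARD('n) * measure lborel (ball (0 :: real^'n) r)"
    if r: "0 < r" "r < k * b0" for r
  proof -
    define b where "b = r / k"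
    have b: "0 < b" "b \<le> b0" "r = k * b" using r k by (auto simp: b_def field_simps)
    let ?E = "{z. norm (Q *v (z - ?p)) < b}"
    have in_E: "y \<in> fst c \<and> snd c y \<in> ?E" if "y \<in> ?B r" for y
    proof -
      have "geodesic_dist A g x y < r" using that by (simp add: geodesic_ball_def)
      then obtain L where L: "L < r" "joined_by A g x y L" by (rule geodesic_dist_lessE[OF A g con])
      have "y \<in> fst c \<and> norm (Q *v (snd c y - ?p)) < b"
      proof (rule short_curve_stays_in_chart[OF A g c k b(1) compact_Z[OF b(2)] _ _ _ L(2)])
        show "?Z b \<subseteq> coords c" using Z[OF b(2)] \<rho>(2) by blast
        show "k * norm (Q *v v) \<le> sqrt (v \<bullet> (g c z *v v))" if "norm (Q *v (z - ?p)) \<le> b" for z v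
          unfolding k_def by (rule lower[rule_format]) (use Z[OF b(2)] that in blast)
        show "L < k * b" using L b by simp
      qed
      then show ?thesis by simp
    qed
    have oB: "open (?B r)" by (rule geodesic_ball_open[OF A g con])
    then have bB: "?B r \<in> sets borel" by simp
    have subB: "?B r \<subseteq> fst c" using in_E by blast
    let ?S = "snd c ` ?B r"
    have SE: "?S \<subseteq> ?E" using in_E by blast
    have Scoords: "?S \<subseteq> coords c" using subB by (auto simp: coords_def)
    have oS: "open ?S" using overlap_open[OF A c(1) oB] subB by (simp add: Int_absorb1)
    have neS: "?S \<noteq> {}" using centre_in_geodesic_ball[OF A g r(1)] by blast
    have bS: "?S \<in> sets borel" using oS by simp
    have em: "emeasure ?V (?B r) = (\<integral>\<^sup>+z. ennreal (indicator ?S z * sqrt (det (g c z))) \<partial>lborel)"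
      using emeasure_riemannian_volume[OF M c(1) bB subB] chart_volume_eq[of g c "?B r"]
      by (simp add: chart_volume_def)
    have E_eq: "?E = (\<lambda>u. ?p + P *v u) ` ball 0 b"
    proof (intro equalityI subsetI)
      fix z assume "z \<in> ?E"
      then have "z = ?p + P *v (Q *v (z - ?p))" "Q *v (z - ?p) \<in> ball 0 b"
        by (simp_all add: matrix_vector_mul_assoc PQ)
      then show "z \<in> (\<lambda>u. ?p + P *v u) ` ball 0 b" by (rule image_eqI)
    qed (auto simp: matrix_vector_mul_assoc PQ)
    have "open ((\<lambda>z. norm (Q *v (z - ?p))) -` {..<b})"
      by (intro open_vimage open_lessThan continuous_on_norm
          bounded_linear.continuous_on[OF matrix_vector_mul_bounded_linear] continuous_intros)
    moreover have "(\<lambda>z. norm (Q *v (z - ?p))) -` {..<b} = ?E" by auto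
    ultimately have bE: "?E \<in> sets borel" by simp
    have "emeasure ?V (?B r) \<le> (\<integral>\<^sup>+z. ennreal ((1 + e) / \<bar>det P\<bar>) * indicator ?E z \<partial>lborel)"
      unfolding em
    proof (rule nn_integral_mono)
      fix z :: "real^'n"
      show "ennreal (indicator ?S z * sqrt (det (g c z))) \<le> ennreal ((1 + e) / \<bar>det P\<bar>) * indicator ?E z"
      proof (cases "z \<in> ?S")
        case True
        then have E: "z \<in> ?E" using SE by blast
        then have "z \<in> ?Z b" by simp
        then have "z \<in> cball ?p \<rho>" using Z[OF b(2)] by blast
        then have "sqrt (det (g c z)) \<le> (1 + e) / \<bar>det P\<bar>"
          using upper detP by (simp add: pos_le_divide_eq mult.commute)
        then show ?thesis using True E by (simp add: ennreal_leI)
      qed simp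
    qed
    also have "\<dots> = ennreal ((1 + e) / \<bar>det P\<bar>) * emeasure lborel ?E"
      by (rule nn_integral_cmult_indicator) (use bE in simp)
    also have "emeasure lborel ?E = ennreal \<bar>det P\<bar> * emeasure lborel (ball (0::real^'n) b)"
      unfolding E_eq by (rule emeasure_affine_image_ball[OF PQ(2)])
    also have "emeasure lborel (ball (0::real^'n) b) = ennreal (measure lborel (ball (0::real^'n) b))"
      by (rule emeasure_eq_ennreal_measure) (use emeasure_lborel_ball_finite[of "0::real^'n" b] in auto)
    also have "ennreal ((1 + e) / \<bar>det P\<bar>) * (ennreal \<bar>det P\<bar> * ennreal (measure lborel (ball (0::real^'n) b)))
        = ennreal ((1 + e) * measure lborel (ball (0::real^'n) b))"
      using detP e by (simp add: ennreal_mult[symmetric])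
    finally have le: "emeasure ?V (?B r) \<le> ennreal ((1 + e) * measure lborel (ball (0::real^'n) b))" .
    have fin: "emeasure ?V (?B r) \<noteq> \<infinity>" using le by (auto simp: top_unique)
    have "measure ?V (?B r) \<le> (1 + e) * measure lborel (ball (0::real^'n) b)"
      unfolding measure_def[of ?V] using le e by (intro enn2real_leI) (auto intro!: mult_nonneg_nonneg)
    also have "measure lborel (ball (0::real^'n) b) = measure lborel (ball (0::real^'n) r) / k ^ CARD('n)"
      using b(1) r(1) by (simp add: content_ball b_def power_divide)
    finally have up: "measure ?V (?B r) \<le> (1 + e) / (1 - e) ^ CARD('n) * measure lborel (ball (0 :: real^'n) r)"
      by (simp add: k_def)
    have "emeasure ?V (?B r) \<noteq> 0"
    proof
      assume "emeasure ?V (?B r) = 0"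
      moreover have "(\<lambda>z. ennreal (indicator ?S z * sqrt (det (g c z)))) \<in> borel_measurable lborel"
        using volume_density_measurable[OF g c(1) Scoords bS] by simp
      ultimately have "AE z in lborel. ennreal (indicator ?S z * sqrt (det (g c z))) = 0"
        unfolding em by (simp add: nn_integral_0_iff_AE)
      then have "AE z in lborel. z \<notin> ?S"
      proof (rule eventually_mono)
        fix z assume 0: "ennreal (indicator ?S z * sqrt (det (g c z))) = 0"
        show "z \<notin> ?S"
        proof
          assume "z \<in> ?S"
          with 0 metric_det_pos[OF g c(1), of z] Scoords show False by (auto simp: ennreal_eq_0_iff)
        qed
      qed
      then have "?S \<in> null_sets lborel" using bS by (simp add: AE_iff_null_sets)
      then have "negligible ?S" by (simp add: negligible_iff_null_sets null_sets_completionI)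
      then show False using open_not_negligible[OF oS neS] by simp
    qed
    then have "0 < measure ?V (?B r)"
      using fin by (simp add: measure_def enn2real_positive_iff less_top zero_less_iff_neq_zero)
    with up show ?thesis by blast
  qed
  show ?thesis
    by (rule that[of "k * b0"]) (use main k b0 in auto)
qed

section \<open>Flat space\<close>

lemma euclidean_chart:
  assumes "c \<in> euclidean_atlas"
  shows "fst c = UNIV" "snd c = (\<lambda>x. x)" "coords c = UNIV" "chart_inv c = (\<lambda>x. x)"
proof -
  have "inv (\<lambda>x::real^'n. x) = (\<lambda>x. x)" using inv_id by (simp add: id_def)
  then show "fst c = UNIV" "snd c = (\<lambda>x. x)" "coords c = UNIV" "chart_inv c = (\<lambda>x. x)"
    using assms by (auto simp: euclidean_atlas_def coords_def chart_inv_def)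
qed

lemma euclidean_chart_at: "chart_at euclidean_atlas p = (UNIV, \<lambda>x. x)"
  unfolding chart_at_def euclidean_atlas_def by (rule some_equality) auto

lemma euclidean_volume: "riemannian_volume euclidean_atlas flat_metric = (lborel :: (real^'n::finite) measure)"
  unfolding riemannian_volume_def
proof (rule the_equality)
  show "sets lborel = sets (borel :: (real^'n) measure) \<and>
      (\<forall>c\<in>euclidean_atlas. \<forall>B\<in>sets borel. B \<subseteq> fst c \<longrightarrow>
        emeasure lborel B = (\<integral>\<^sup>+ z\<in>snd c ` B. ennreal (sqrt (det (flat_metric c z))) \<partial>lborel))"
    by (auto simp: euclidean_atlas_def flat_metric_def)
  fix \<nu> :: "(real^'n) measure"
  assume \<nu>: "sets \<nu> = sets borel \<and>
      (\<forall>c\<in>euclidean_atlas. \<forall>B\<in>sets borel. B \<subseteq> fst c \<longrightarrow>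
        emeasure \<nu> B = (\<integral>\<^sup>+ z\<in>snd c ` B. ennreal (sqrt (det (flat_metric c z))) \<partial>lborel))"
  show "\<nu> = lborel"
    by (rule measure_eqI) (use \<nu> in \<open>auto simp: euclidean_atlas_def flat_metric_def\<close>)
qed

lemma euclidean_laplacian:
  "laplace_beltrami euclidean_atlas flat_metric f p = (\<Sum>i\<in>UNIV. pd i (pd i f) (p :: real^'n::finite))"
proof -
  have inv: "matrix_inv (mat 1 :: real^'n^'n) = mat 1"
    unfolding matrix_inv_def by (rule some_equality) simp_all
  have "(\<Sum>j\<in>UNIV. (mat 1 :: real^'n^'n) $ i $ j * pd j f w) = pd i f w" for i w
  proof -
    have "(\<Sum>j\<in>UNIV. (mat 1 :: real^'n^'n) $ i $ j * pd j f w) = (\<Sum>j\<in>UNIV. if i = j then pd j f w else 0)"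
      by (rule sum.cong) (auto simp: mat_def)
    then show ?thesis by simp
  qed
  moreover have "chart_inv (UNIV :: (real^'n) set, \<lambda>x. x) = (\<lambda>x. x)"
    by (rule euclidean_chart(4)) (simp add: euclidean_atlas_def)
  ultimately show ?thesis
    unfolding laplace_beltrami_def euclidean_chart_at Let_def chart_laplacian_def flat_metric_def inv
    by (simp add: o_def)
qed

section \<open>The Gaussian\<close>

definition gauss :: "real \<Rightarrow> real^'n::finite \<Rightarrow> real" where
  "gauss t z = (4 * pi * t) powr (- real CARD('n) / 2) * exp (- (norm z)\<^sup>2 / (4 * t))"

lemma gauss_pos: "0 < t \<Longrightarrow> 0 < gauss t z"
  by (simp add: gauss_def)

lemma gauss_minus: "gauss t (- z) = gauss t z"
  by (simp add: gauss_def)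

lemma gauss_has_derivative [derivative_intros]:
  assumes "0 < t" and f: "(f has_derivative f') (at x within S)"
  shows "((\<lambda>x. gauss t (f x)) has_derivative (\<lambda>h. - (f x \<bullet> f' h) / (2 * t) * gauss t (f x))) (at x within S)"
proof -
  have "((\<lambda>x. (f x) \<bullet> (f x)) has_derivative (\<lambda>h. f x \<bullet> f' h + f' h \<bullet> f x)) (at x within S)"
    by (rule has_derivative_inner[OF f f])
  from has_derivative_exp[OF has_derivative_mult_left[OF this, of "- 1 / (4 * t)"]]
  have "((\<lambda>x. exp ((f x \<bullet> f x) * (- 1 / (4 * t)))) has_derivative
     (\<lambda>h. (f x \<bullet> f' h + f' h \<bullet> f x) * (- 1 / (4 * t)) * exp ((f x \<bullet> f x) * (- 1 / (4 * t))))) (at x within S)"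
    by simp
  from has_derivative_mult_right[OF this, of "(4 * pi * t) powr (- real CARD('b) / 2)"]
  show ?thesis using assms(1)
    by (simp add: gauss_def power2_norm_eq_inner inner_commute algebra_simps)
qed

lemma gauss_has_time_derivative:
  fixes z :: "real^'n::finite"
  assumes "0 < t"
  shows "((\<lambda>t. gauss t z) has_real_derivative (- real CARD('n) / (2 * t) + (norm z)\<^sup>2 / (4 * t\<^sup>2)) * gauss t z) (at t)"
proof -
  let ?m = "- real CARD('n) / 2"
  have 1: "((\<lambda>t. (4 * pi * t) powr ?m) has_real_derivative ?m * (4 * pi * t) powr (?m - 1) * (4 * pi)) (at t)"
    using assms by (auto intro!: derivative_eq_intros)
  have e: "(4 * pi * t) powr (?m - 1) = (4 * pi * t) powr ?m / (4 * pi * t)"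
    using assms by (simp add: powr_diff)
  have 1: "((\<lambda>t. (4 * pi * t) powr ?m) has_real_derivative (?m / t) * (4 * pi * t) powr ?m) (at t)"
    by (rule DERIV_cong[OF 1], unfold e) (use assms in simp)
  have 2: "((\<lambda>t. exp (- (norm z)\<^sup>2 / (4 * t))) has_real_derivative ((norm z)\<^sup>2 / (4 * t\<^sup>2)) * exp (- (norm z)\<^sup>2 / (4 * t))) (at t)"
    using assms by (auto intro!: derivative_eq_intros simp: power2_eq_square)
  show ?thesis
    unfolding gauss_def
    by (rule DERIV_cong[OF DERIV_mult[OF 1 2]]) (simp add: algebra_simps)
qed

lemma pd_eq: "(f has_derivative f') (at z) \<Longrightarrow> pd i f z = f' (axis i 1)"
  by (simp add: pd_def frechet_derivative_at[symmetric])

lemma gauss_shift_has_derivative: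
  assumes "0 < t"
  shows "((\<lambda>w. gauss t (w - x)) has_derivative (\<lambda>h. - ((z - x) \<bullet> h) / (2 * t) * gauss t (z - x))) (at z)"
  by (rule gauss_has_derivative[OF assms]) (auto intro!: derivative_eq_intros)

lemma pd_gauss:
  assumes "0 < t"
  shows "pd i (\<lambda>w. gauss t (w - x)) z = - ((z - x) $ i) / (2 * t) * gauss t (z - x)"
  using pd_eq[OF gauss_shift_has_derivative[OF assms]] by (simp add: inner_axis)

lemma pd_pd_gauss_derivative:
  assumes "0 < t"
  shows "((\<lambda>w. - ((w - x) $ i) / (2 * t) * gauss t (w - x)) has_derivative
    (\<lambda>h. (- (h $ i) / (2 * t) + (z - x) $ i * ((z - x) \<bullet> h) / (4 * t\<^sup>2)) * gauss t (z - x))) (at z)"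
proof -
  note 1 = gauss_shift_has_derivative[OF assms, of x z]
  have 2: "((\<lambda>w. - ((w - x) $ i) / (2 * t)) has_derivative (\<lambda>h. - (h $ i) / (2 * t))) (at z)"
    unfolding cart_eq_inner_axis using assms
    by (auto intro!: derivative_eq_intros)
  show ?thesis
    by (rule has_derivative_eq_rhs[OF has_derivative_mult[OF 2 1]])
       (use assms in \<open>auto simp: fun_eq_iff field_simps power2_eq_square\<close>)
qed

lemma pd_pd_gauss:
  assumes "0 < t"
  shows "pd j (pd i (\<lambda>w. gauss t (w - x))) z =
    (- (if i = j then 1 else 0) / (2 * t) + (z - x) $ i * (z - x) $ j / (4 * t\<^sup>2)) * gauss t (z - x)"
  unfolding pd_gauss[OF assms, abs_def] pd_eq[OF pd_pd_gauss_derivative[OF assms]]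
  by (simp add: inner_axis) (simp add: axis_def)

lemma continuous_on_gauss [continuous_intros]:
  fixes f :: "'a::topological_space \<Rightarrow> real^'n::finite"
  assumes "continuous_on S f" "continuous_on S h" "\<And>x. x \<in> S \<Longrightarrow> 0 < h x"
  shows "continuous_on S (\<lambda>x. gauss (h x) (f x))"
  unfolding gauss_def
  by (intro continuous_intros assms) (use assms(3) in force)+

lemma gauss_heat_equation:
  fixes x z :: "real^'n::finite"
  assumes "0 < t"
  shows "(\<Sum>i\<in>UNIV. pd i (pd i (\<lambda>w. gauss t (w - x))) z) = (- real CARD('n) / (2 * t) + (norm (z - x))\<^sup>2 / (4 * t\<^sup>2)) * gauss t (z - x)"
proof -
  have "(norm (z - x))\<^sup>2 = (\<Sum>i\<in>UNIV. (z - x) $ i * (z - x) $ i)"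
    by (simp only: power2_norm_eq_inner inner_vec_def inner_real_def)
  then show ?thesis
    unfolding pd_pd_gauss[OF assms]
    by (simp add: sum_distrib_right[symmetric] sum.distrib sum_divide_distrib[symmetric] sum_subtractf)
qed

lemma gauss_C21:
  fixes x :: "real^'n::finite"
  shows "C21 euclidean_atlas (\<lambda>y t. gauss t (y - x))"
proof -
  let ?G = "\<lambda>t w. gauss t (w - x)"
  have cases: "js = [] \<or> (\<exists>i. js = [i]) \<or> (\<exists>i j. js = [j, i])" if "length js \<le> 2" for js :: "'n list"
    using that by (cases js; cases "tl js"; cases "tl (tl js)") auto
  have joint: "continuous_on (UNIV \<times> {0<..}) (\<lambda>(z, t). iter_pd js (?G t) z)" if "length js \<le> 2" for js
  proof -
    let ?S = "UNIV \<times> {0<..} :: ((real^'n) \<times> real) set"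
    have c: "continuous_on ?S (\<lambda>p. gauss (snd p) (fst p - x))"
      by (intro continuous_intros) auto
    have 1: "continuous_on ?S (\<lambda>p. - ((fst p - x) $ i) / (2 * snd p) * gauss (snd p) (fst p - x))" for i
      by (intro continuous_intros c) auto
    have 2: "continuous_on ?S (\<lambda>p. (- (if i = j then 1 else 0) / (2 * snd p) + (fst p - x) $ i * (fst p - x) $ j / (4 * (snd p)\<^sup>2)) * gauss (snd p) (fst p - x))" for i j
      by (intro continuous_intros c) auto
    have e1: "continuous_on ?S (\<lambda>(z, t). iter_pd [i] (?G t) z)" for i
      using 1[of i] by (rule continuous_on_eq) (auto simp: pd_gauss)
    have e2: "continuous_on ?S (\<lambda>(z, t). iter_pd [j, i] (?G t) z)" for i j
      using 2[of i j] by (rule continuous_on_eq) (auto simp: pd_pd_gauss)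
    have e0: "continuous_on ?S (\<lambda>(z, t). iter_pd [] (?G t) z)"
      using c by (rule continuous_on_eq) auto
    show ?thesis using cases[OF that] e0 e1 e2 by (elim disjE exE) (simp only:)+
  qed
  have Ck: "Ck_on 2 UNIV (?G t)" if t: "0 < t" for t
    unfolding Ck_on_def
  proof (intro conjI allI impI ballI)
    fix js :: "'n list" and z :: "real^'n" assume "length js < 2"
    then have "js = [] \<or> (\<exists>i. js = [i])" by (cases js; cases "tl js") auto
    moreover have "?G t differentiable (at z)"
      unfolding differentiable_def using gauss_shift_has_derivative[OF t] by blast
    moreover have "pd i (?G t) differentiable (at z)" for i
      unfolding pd_gauss[OF t, abs_def] differentiable_def using pd_pd_gauss_derivative[OF t] by blast
    ultimately show "iter_pd js (?G t) differentiable (at z)" by auto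
  next
    fix js :: "'n list" assume js: "length js \<le> 2"
    have "continuous_on UNIV (\<lambda>z. (\<lambda>(z, t). iter_pd js (?G t) z) (z, t))"
      by (rule continuous_on_compose2[OF joint[OF js]]) (use t in \<open>auto intro!: continuous_intros\<close>)
    then show "continuous_on UNIV (iter_pd js (?G t))" by simp
  qed
  have dt: "(\<lambda>t. gauss t (z - x)) differentiable (at t)"
    "deriv (\<lambda>t. gauss t (z - x)) t = (- real CARD('n) / (2 * t) + (norm (z - x))\<^sup>2 / (4 * t\<^sup>2)) * gauss t (z - x)"
    if "0 < t" for t and z :: "real^'n"
    using gauss_has_time_derivative[OF that, of "z - x"]
    by (auto intro: DERIV_imp_deriv simp: real_differentiable_def)
  have cdt: "continuous_on (UNIV \<times> {0<..}) (\<lambda>(z, t). deriv (\<lambda>t. gauss t (z - x)) t)"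
  proof -
    have "continuous_on (UNIV \<times> {0<..}) (\<lambda>p. (- real CARD('n) / (2 * snd p) + (norm (fst p - x))\<^sup>2 / (4 * (snd p)\<^sup>2)) * gauss (snd p) (fst p - x))"
      by (intro continuous_intros) auto
    then show ?thesis by (rule continuous_on_eq) (auto simp: dt)
  qed
  show ?thesis
    unfolding C21_def using joint Ck dt cdt by (simp add: euclidean_chart)
qed

section \<open>Total mass and concentration\<close>

definition std_gauss :: "real^'n::finite \<Rightarrow> real" where
  "std_gauss u = (\<Prod>b\<in>Basis. std_normal_density (u \<bullet> b))"

lemma std_gauss_nonneg: "0 \<le> std_gauss u"
  unfolding std_gauss_def by (intro prod_nonneg) simp

lemma std_gauss_integrable: "integrable lborel (std_gauss :: real^'n::finite \<Rightarrow> real)"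
  and std_gauss_integral: "(\<integral>(u::real^'n). std_gauss u \<partial>lborel) = 1"
proof -
  have m: "(std_gauss :: real^'n \<Rightarrow> real) \<in> borel_measurable lborel"
    unfolding std_gauss_def by (intro borel_measurable_prod) measurable
  have "(\<integral>\<^sup>+(u::real^'n). ennreal (std_gauss u) \<partial>lborel) = (\<integral>\<^sup>+(u::real^'n). (\<Prod>b\<in>Basis. ennreal (std_normal_density (u \<bullet> b))) \<partial>lborel)"
    unfolding std_gauss_def by (intro nn_integral_cong prod_ennreal[symmetric]) simp
  also have "\<dots> = (\<Prod>b\<in>(Basis :: (real^'n) set). \<integral>\<^sup>+x. ennreal (std_normal_density x) \<partial>lborel)"
    by (rule nn_integral_lborel_prod) auto
  also have "(\<integral>\<^sup>+x. ennreal (std_normal_density x) \<partial>lborel) = 1"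
    by (subst nn_integral_eq_integral) (auto simp: integral_normal_density)
  finally have 1: "(\<integral>\<^sup>+(u::real^'n). ennreal (std_gauss u) \<partial>lborel) = 1" by simp
  then show "integrable lborel (std_gauss :: real^'n \<Rightarrow> real)"
    using m by (intro integrableI_nonneg) (auto simp: std_gauss_nonneg)
  from nn_integral_eq_integral[OF this] 1 show "(\<integral>(u::real^'n). std_gauss u \<partial>lborel) = 1"
    by (simp add: std_gauss_nonneg)
qed

text \<open>
  In the variable \<open>u = z / sqrt (2 t)\<close> the Gaussian is a product of standard normal densities.
\<close>

lemma gauss_scaled:
  fixes u :: "real^'n::finite"
  assumes "0 < t"
  shows "sqrt (2 * t) ^ CARD('n) * gauss t (sqrt (2 * t) *\<^sub>R u) = std_gauss u"
proof -
  have "std_gauss u = (\<Prod>b\<in>(Basis::(real^'n) set). 1 / sqrt (2 * pi)) * (\<Prod>b\<in>Basis. exp (- (u \<bullet> b)\<^sup>2 / 2))"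
    by (simp only: std_gauss_def std_normal_density_def prod.distrib)
  also have "(\<Prod>b\<in>Basis. exp (- (u \<bullet> b)\<^sup>2 / 2)) = exp (\<Sum>b\<in>Basis. - (u \<bullet> b)\<^sup>2 / 2)"
    by (simp add: exp_sum)
  also have "(\<Sum>b\<in>Basis. - (u \<bullet> b)\<^sup>2 / 2) = - (norm u)\<^sup>2 / 2"
  proof -
    have "(norm u)\<^sup>2 = (\<Sum>b\<in>Basis. (u \<bullet> b)\<^sup>2)"
      unfolding power2_norm_eq_inner unfolding euclidean_inner[of u u] by (simp add: power2_eq_square)
    then show ?thesis by (simp add: sum_negf sum_divide_distrib)
  qed
  finally have s: "std_gauss u = (1 / sqrt (2 * pi)) ^ CARD('n) * exp (- (norm u)\<^sup>2 / 2)" by simp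
  have "(4 * pi * t) powr (- real CARD('n) / 2) = (1 / sqrt (4 * pi * t)) ^ CARD('n)"
  proof -
    have "(4 * pi * t) powr (- real CARD('n) / 2) = ((4 * pi * t) powr (- 1 / 2)) powr (real CARD('n))"
      by (simp add: powr_powr)
    also have "(4 * pi * t) powr (- 1 / 2) = 1 / sqrt (4 * pi * t)"
      using assms by (simp add: powr_minus_divide powr_half_sqrt)
    finally show ?thesis using assms by (simp add: powr_realpow)
  qed
  moreover have "sqrt (2 * t) * (1 / sqrt (4 * pi * t)) = 1 / sqrt (2 * pi)"
  proof -
    have "4 * pi * t = (2 * t) * (2 * pi)" by simp
    then have "sqrt (4 * pi * t) = sqrt (2 * t) * sqrt (2 * pi)" by (simp only: real_sqrt_mult)
    then show ?thesis using assms by simp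
  qed
  ultimately show ?thesis
    using assms unfolding s gauss_def
    by (simp add: power_mult_distrib[symmetric] mult.assoc[symmetric]) (simp add: power_mult_distrib)
qed

lemma integral_gauss_affine:
  fixes x :: "real^'n::finite" and f :: "real^'n \<Rightarrow> real"
  assumes t: "0 < t" and f: "f \<in> borel_measurable borel"
  shows "(\<integral>y. gauss t (y - x) * f y \<partial>lborel) = (\<integral>u. std_gauss u * f (x + sqrt (2 * t) *\<^sub>R u) \<partial>lborel)"
proof -
  let ?s = "sqrt (2 * t)"
  have [measurable]: "(\<lambda>y. gauss t (y - x)) \<in> borel_measurable borel"
    by (intro borel_measurable_continuous_onI continuous_intros) (use t in auto)
  note [measurable] = f
  have "(\<integral>y. gauss t (y - x) * f y \<partial>lborel) =
    (\<integral>y. gauss t (y - x) * f y \<partial>(density (distr lborel borel (\<lambda>u. x + ?s *\<^sub>R u)) (\<lambda>_. \<bar>?s\<bar>^DIM(real^'n))))"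
    using t by (subst lborel_affine[of ?s x]) auto
  also have "\<dots> = (\<integral>y. ?s ^ CARD('n) * (gauss t (y - x) * f y) \<partial>distr lborel borel (\<lambda>u. x + ?s *\<^sub>R u))"
    using t by (subst integral_density) auto
  also have "\<dots> = (\<integral>u. ?s ^ CARD('n) * (gauss t (?s *\<^sub>R u) * f (x + ?s *\<^sub>R u)) \<partial>lborel)"
    by (subst integral_distr) auto
  also have "\<dots> = (\<integral>u. std_gauss u * f (x + sqrt (2 * t) *\<^sub>R u) \<partial>lborel)"
    by (simp only: mult.assoc[symmetric] gauss_scaled[OF t])
  finally show ?thesis .
qed

text \<open>
  After the substitution \<open>y = x + sqrt (2 t) u\<close> the Gaussian weight no longer depends on \<open>t\<close>, and
  dominated convergence applies.
\<close>

lemma gauss_concentrates: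
  fixes x :: "real^'n::finite" and f :: "real^'n \<Rightarrow> real"
  assumes f: "continuous_on UNIV f" and B: "\<And>y. \<bar>f y\<bar> \<le> B"
  shows "((\<lambda>t. \<integral>y. gauss t (y - x) * f y \<partial>lborel) \<longlongrightarrow> f x) (at_right 0)"
proof (subst tendsto_at_iff_sequentially, intro allI impI)
  fix T :: "nat \<Rightarrow> real" assume T: "\<forall>i. T i \<in> {0<..} - {0}" "T \<longlonglongrightarrow> 0"
  then have T0: "T i > 0" for i by auto
  have fm [measurable]: "f \<in> borel_measurable borel" by (rule borel_measurable_continuous_onI[OF f])
  have "(\<lambda>i. \<integral>u. std_gauss u * f (x + sqrt (2 * T i) *\<^sub>R u) \<partial>lborel) \<longlonglongrightarrow> (\<integral>(u::real^'n). std_gauss u * f x \<partial>lborel)"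
  proof (rule integral_dominated_convergence[where w="\<lambda>u. std_gauss u * B"])
    note [measurable] = borel_measurable_integrable[OF std_gauss_integrable]
    show "(\<lambda>u::real^'n. std_gauss u * f x) \<in> borel_measurable lborel" by measurable
    show "(\<lambda>u. std_gauss u * f (x + sqrt (2 * T i) *\<^sub>R u)) \<in> borel_measurable lborel" for i by measurable
    show "integrable lborel (\<lambda>u::real^'n. std_gauss u * B)" by (intro integrable_mult_left std_gauss_integrable)
    show "AE u in lborel. (\<lambda>i. std_gauss u * f (x + sqrt (2 * T i) *\<^sub>R u)) \<longlonglongrightarrow> std_gauss u * f x"
    proof (intro AE_I2 tendsto_mult tendsto_const)
      fix u
      have "(\<lambda>i. x + sqrt (2 * T i) *\<^sub>R u) \<longlonglongrightarrow> x + sqrt (2 * 0) *\<^sub>R u"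
        by (intro tendsto_intros T)
      then show "(\<lambda>i. f (x + sqrt (2 * T i) *\<^sub>R u)) \<longlonglongrightarrow> f x"
        using f by (intro isCont_tendsto_compose[of x f]) (auto simp: continuous_on_eq_continuous_at)
    qed
    show "AE u in lborel. norm (std_gauss u * f (x + sqrt (2 * T i) *\<^sub>R u)) \<le> std_gauss u * B" for i
      using B by (intro AE_I2) (simp add: abs_mult std_gauss_nonneg mult_left_mono)
  qed
  then show "((\<lambda>t. \<integral>y. gauss t (y - x) * f y \<partial>lborel) \<circ> T) \<longlonglongrightarrow> f x"
    by (simp add: o_def integral_gauss_affine[OF T0 fm] std_gauss_integral)
qed

theorem gauss_fundamental_solution:
  "positive_fundamental_solution euclidean_atlas flat_metric (\<lambda>x y t. gauss t (y - x :: real^'n::finite))"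
  unfolding positive_fundamental_solution_def
proof (intro conjI allI impI)
  fix x y :: "real^'n" and t :: real assume t: "0 < t"
  show "0 < gauss t (y - x)" by (rule gauss_pos[OF t])
  show "gauss t (y - x) = gauss t (x - y)" using gauss_minus[of t "y - x"] by simp
  show "laplace_beltrami euclidean_atlas flat_metric (\<lambda>w. gauss t (w - x)) y - deriv (\<lambda>t. gauss t (y - x)) t = 0"
    unfolding euclidean_laplacian gauss_heat_equation[OF t]
    using gauss_has_time_derivative[OF t, of "y - x"] by (simp add: DERIV_imp_deriv)
next
  fix x :: "real^'n"
  show "C21 euclidean_atlas (\<lambda>y t. gauss t (y - x))" by (rule gauss_C21)
next
  fix x :: "real^'n" and f :: "real^'n \<Rightarrow> real"
  assume f: "continuous_on UNIV f \<and> compact (closure {y. f y \<noteq> 0})"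
  have "compact (f ` closure {y. f y \<noteq> 0})"
    using f continuous_on_subset by (intro compact_continuous_image) auto
  then obtain B where B: "B > 0" "\<And>y. y \<in> closure {y. f y \<noteq> 0} \<Longrightarrow> \<bar>f y\<bar> \<le> B"
    unfolding bounded_pos by (auto dest!: compact_imp_bounded simp: bounded_pos)
  have "\<bar>f y\<bar> \<le> B" for y
    using B closure_subset[of "{y. f y \<noteq> 0}"] by (cases "f y = 0") auto
  then show "((\<lambda>t. LINT y|riemannian_volume euclidean_atlas flat_metric. gauss t (y - x) * f y) \<longlongrightarrow> f x) (at_right 0)"
    unfolding euclidean_volume using f by (intro gauss_concentrates) auto
qed

section \<open>The parabolic minimum principle\<close>

lemma second_derivative_nonneg_at_min:
  fixes h h' :: "real \<Rightarrow> real"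
  assumes d: "0 < d" and h: "\<And>\<tau>. \<bar>\<tau>\<bar> < d \<Longrightarrow> (h has_real_derivative h' \<tau>) (at \<tau>)"
    and h': "(h' has_real_derivative D) (at 0)" and min: "\<And>\<tau>. \<bar>\<tau>\<bar> < d \<Longrightarrow> h 0 \<le> h \<tau>"
  shows "0 \<le> D"
proof (rule ccontr)
  assume "\<not> 0 \<le> D"
  then have "D < 0" by simp
  have 0: "h' 0 = 0"
    by (rule DERIV_local_min[OF h[of 0] d]) (use d min in auto)
  obtain e where e: "0 < e" "\<And>\<epsilon>. 0 < \<epsilon> \<Longrightarrow> \<epsilon> < e \<Longrightarrow> h' (0 + \<epsilon>) < h' 0"
    using DERIV_neg_dec_right[OF h' \<open>D < 0\<close>] by auto
  define \<tau> where "\<tau> = min d e / 2"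
  have \<tau>: "0 < \<tau>" "\<tau> < d" "\<tau> < e" using d e(1) by (auto simp: \<tau>_def)
  obtain z where z: "0 < z" "z < \<tau>" "h \<tau> - h 0 = (\<tau> - 0) * h' z"
    using MVT2[of 0 \<tau> h h'] \<tau> h by auto
  have "h' z < 0" using e(2)[of z] z \<tau> 0 by simp
  then have "h \<tau> < h 0" using z \<tau> by (simp add: mult_pos_neg algebra_simps)
  then show False using min[of \<tau>] \<tau> by simp
qed

text \<open>
  Adding \<open>\<kappa> t\<close> with a small \<open>\<kappa> > 0\<close> makes the inequality for \<open>u\<close> strict while a negative excess
  survives. At a minimum with value below \<open>m\<close>, which can lie neither on the initial nor on the
  lateral boundary, the time derivative is \<open>\<le> 0\<close> and all pure second derivatives are \<open>\<ge> 0\<close>,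
  contradicting strictness. Derivatives are required along coordinate lines only.
\<close>

lemma parabolic_minimum_principle:
  fixes u :: "real^'n::finite \<Rightarrow> real \<Rightarrow> real"
  assumes cont: "continuous_on (cball 0 R \<times> {0..T}) (\<lambda>(y, t). u y t)"
    and time: "\<And>y t. norm y < R \<Longrightarrow> 0 < t \<Longrightarrow> t \<le> T \<Longrightarrow> ((\<lambda>s. u y s) has_real_derivative ut y t) (at t)"
    and space1: "\<And>y t i. norm y < R \<Longrightarrow> 0 < t \<Longrightarrow> t \<le> T \<Longrightarrow>
       ((\<lambda>\<tau>. u (y + \<tau> *\<^sub>R axis i 1) t) has_real_derivative ux i y t) (at 0)"
    and space2: "\<And>y t i. norm y < R \<Longrightarrow> 0 < t \<Longrightarrow> t \<le> T \<Longrightarrow>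
       ((\<lambda>\<tau>. ux i (y + \<tau> *\<^sub>R axis i 1) t) has_real_derivative uxx i y t) (at 0)"
    and heat: "\<And>y t. norm y < R \<Longrightarrow> 0 < t \<Longrightarrow> t \<le> T \<Longrightarrow> (\<Sum>i\<in>UNIV. uxx i y t) \<le> ut y t"
    and init: "\<And>y. norm y \<le> R \<Longrightarrow> m \<le> u y 0"
    and bdry: "\<And>y t. norm y = R \<Longrightarrow> 0 \<le> t \<Longrightarrow> t \<le> T \<Longrightarrow> m \<le> u y t"
    and y: "norm y \<le> R" and t: "0 \<le> t" "t \<le> T"
  shows "m \<le> u y t"
proof (rule ccontr)
  assume "\<not> m \<le> u y t"
  then have neg: "u y t < m" by simp
  have T: "0 \<le> T" using t by simp
  define \<kappa> where "\<kappa> = (m - u y t) / (2 * (T + 1))"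
  have \<kappa>: "0 < \<kappa>" using neg T by (simp add: \<kappa>_def)
  have "\<kappa> * t \<le> \<kappa> * (T + 1)" using \<kappa> t by (intro mult_left_mono) auto
  also have "\<dots> = (m - u y t) / 2" using T by (simp add: \<kappa>_def field_simps)
  finally have small: "u y t + \<kappa> * t < m" using neg by (simp add: field_simps)
  let ?C = "cball (0::real^'n) R \<times> {0..T}"
  have "continuous_on ?C (\<lambda>p. (\<lambda>(y, t). u y t) p + \<kappa> * snd p)"
    by (intro continuous_on_add cont continuous_intros)
  moreover have "compact ?C" by (intro compact_Times compact_cball compact_Icc)
  moreover have yt: "(y, t) \<in> ?C" using y t by simp
  ultimately obtain p where p: "p \<in> ?C" "\<And>q. q \<in> ?C \<Longrightarrow> (\<lambda>(y, t). u y t) p + \<kappa> * snd p \<le> (\<lambda>(y, t). u y t) q + \<kappa> * snd q"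
    using continuous_attains_inf[of ?C "\<lambda>p. (\<lambda>(y, t). u y t) p + \<kappa> * snd p"] by blast
  obtain z s where zs: "p = (z, s)" by (cases p)
  have z: "norm z \<le> R" and s: "0 \<le> s" "s \<le> T" using p(1) zs by auto
  have min: "u z s + \<kappa> * s \<le> u z' s' + \<kappa> * s'" if "norm z' \<le> R" "0 \<le> s'" "s' \<le> T" for z' s'
    using p(2)[of "(z', s')"] that zs by simp
  have low: "u z s + \<kappa> * s < m" using min[OF y t] small by simp
  have "s \<noteq> 0" using init[OF z] low by auto
  then have s0: "0 < s" using s by simp
  have "norm z \<noteq> R"
  proof
    assume "norm z = R"
    then have "m \<le> u z s" using bdry s by simp
    moreover have "0 \<le> \<kappa> * s" using \<kappa> s by simp
    ultimately show False using low by simp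
  qed
  then have zR: "norm z < R" using z by simp
  have "ut z s + \<kappa> \<le> 0"
  proof (rule ccontr)
    assume "\<not> ?thesis"
    moreover have "((\<lambda>s. u z s + \<kappa> * s) has_real_derivative ut z s + \<kappa>) (at s)"
      using time[OF zR s0 s(2)] by (auto intro!: derivative_eq_intros)
    ultimately obtain d where d: "0 < d" "\<And>h. 0 < h \<Longrightarrow> h < d \<Longrightarrow> u z (s - h) + \<kappa> * (s - h) < u z s + \<kappa> * s"
      using DERIV_pos_inc_left[of "\<lambda>s. u z s + \<kappa> * s" "ut z s + \<kappa>" s] by auto
    define h where "h = min d s / 2"
    have h: "0 < h" "h < d" "h < s" using d(1) s0 by (auto simp: h_def)
    show False using d(2)[OF h(1,2)] min[of z "s - h"] h s zR by simp
  qed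
  moreover have "0 \<le> uxx i z s" for i
  proof (rule second_derivative_nonneg_at_min[where d="R - norm z"])
    show "0 < R - norm z" using zR by simp
    have inside: "norm (z + \<tau> *\<^sub>R axis i 1) < R" if "\<bar>\<tau>\<bar> < R - norm z" for \<tau>
    proof -
      have "norm (z + \<tau> *\<^sub>R axis i 1) \<le> norm z + norm (\<tau> *\<^sub>R (axis i 1 :: real^'n))" by (rule norm_triangle_ineq)
      also have "norm (\<tau> *\<^sub>R (axis i 1 :: real^'n)) = \<bar>\<tau>\<bar>" by simp
      finally show ?thesis using that by simp
    qed
    show "((\<lambda>\<tau>. u (z + \<tau> *\<^sub>R axis i 1) s) has_real_derivative ux i (z + \<tau> *\<^sub>R axis i 1) s) (at \<tau>)"
      if "\<bar>\<tau>\<bar> < R - norm z" for \<tau>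
    proof -
      have "((\<lambda>\<tau>'. u ((z + \<tau> *\<^sub>R axis i 1) + \<tau>' *\<^sub>R axis i 1) s) has_real_derivative ux i (z + \<tau> *\<^sub>R axis i 1) s) (at 0)"
        by (rule space1[OF inside[OF that] s0 s(2)])
      then show ?thesis
        using DERIV_shift[of "\<lambda>\<tau>. u (z + \<tau> *\<^sub>R axis i 1) s" "ux i (z + \<tau> *\<^sub>R axis i 1) s" 0 \<tau>]
        by (simp add: algebra_simps)
    qed
    show "((\<lambda>\<tau>. ux i (z + \<tau> *\<^sub>R axis i 1) s) has_real_derivative uxx i z s) (at 0)"
      by (rule space2[OF zR s0 s(2)])
    show "u (z + 0 *\<^sub>R axis i 1) s \<le> u (z + \<tau> *\<^sub>R axis i 1) s" if "\<bar>\<tau>\<bar> < R - norm z" for \<tau>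
      using min[of "z + \<tau> *\<^sub>R axis i 1" s] inside[OF that] s by simp
  qed
  then have "0 \<le> (\<Sum>i\<in>UNIV. uxx i z s)" by (intro sum_nonneg)
  ultimately show False using heat[OF zR s0 s(2)] \<kappa> by simp
qed

section \<open>Gaussian convolutions\<close>

text \<open>
  The convolution of \<open>F\<close> with the Gaussian, for \<open>F\<close> supported in the box. Integrating over a
  compact box allows differentiation under the integral sign without growth conditions.
\<close>

definition heat_conv :: "real^'n::finite \<Rightarrow> real^'n \<Rightarrow> (real^'n \<Rightarrow> real) \<Rightarrow> real^'n \<Rightarrow> real \<Rightarrow> real" where
  "heat_conv a b F y t = integral (cbox a b) (\<lambda>z. gauss t (y - z) * F z)"

lemma has_derivative_along_axis:
  fixes f :: "real^'n::finite \<Rightarrow> real"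
  assumes "(f has_derivative f') (at (y + \<tau> *\<^sub>R axis i 1))"
  shows "((\<lambda>\<tau>. f (y + \<tau> *\<^sub>R axis i 1)) has_real_derivative f' (axis i 1)) (at \<tau>)"
proof -
  have "((\<lambda>\<tau>. y + \<tau> *\<^sub>R axis i 1) has_vector_derivative axis i 1) (at \<tau>)"
    by (auto intro!: derivative_eq_intros simp: has_vector_derivative_def)
  from vector_derivative_diff_chain_within[OF this has_derivative_at_withinI[OF assms]]
  show ?thesis by (simp add: has_real_derivative_iff_has_vector_derivative o_def)
qed

lemma heat_conv_continuous:
  fixes F :: "real^'n::finite \<Rightarrow> real"
  assumes F: "continuous_on UNIV F" and \<eta>: "0 < \<eta>"
  shows "continuous_on (S \<times> {0..}) (\<lambda>(y, t). heat_conv a b F y (t + \<eta>))"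
proof -
  have "continuous_on (S \<times> {0..}) (\<lambda>p. integral (cbox a b) (\<lambda>z. gauss (snd p + \<eta>) (fst p - z) * F z))"
  proof (rule integral_continuous_on_param)
    have "continuous_on ((S \<times> {0..}) \<times> cbox a b) (\<lambda>q. gauss (snd (fst q) + \<eta>) (fst (fst q) - snd q) * F (snd q))"
      by (intro continuous_intros continuous_on_compose2[OF F]) (use \<eta> in auto)
    then show "continuous_on ((S \<times> {0..}) \<times> cbox a b) (\<lambda>(p, z). gauss (snd p + \<eta>) (fst p - z) * F z)"
      by (simp add: case_prod_unfold)
  qed
  then show ?thesis by (simp add: heat_conv_def case_prod_unfold)
qed

lemma heat_conv_time_derivative:
  fixes F :: "real^'n::finite \<Rightarrow> real"
  assumes F: "continuous_on UNIV F" and t: "0 < t"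
  shows "((\<lambda>t. heat_conv a b F y t) has_real_derivative
    integral (cbox a b) (\<lambda>z. (- real CARD('n) / (2 * t) + (norm (y - z))\<^sup>2 / (4 * t\<^sup>2)) * gauss t (y - z) * F z)) (at t)"
proof -
  have "((\<lambda>t. integral (cbox a b) (\<lambda>z. gauss t (y - z) * F z)) has_real_derivative
    integral (cbox a b) (\<lambda>z. (- real CARD('n) / (2 * t) + (norm (y - z))\<^sup>2 / (4 * t\<^sup>2)) * gauss t (y - z) * F z)) (at t within {0<..})"
  proof (rule leibniz_rule_field_derivative)
    show "((\<lambda>t. gauss t (y - z) * F z) has_real_derivative
       (- real CARD('n) / (2 * s) + (norm (y - z))\<^sup>2 / (4 * s\<^sup>2)) * gauss s (y - z) * F z) (at s within {0<..})"
      if "s \<in> {0<..}" for s z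
      by (rule has_field_derivative_at_within[OF DERIV_cmult_right[OF gauss_has_time_derivative]]) (use that in simp)
    show "(\<lambda>z. gauss s (y - z) * F z) integrable_on cbox a b" if "s \<in> {0<..}" for s
      by (intro integrable_continuous continuous_intros continuous_on_subset[OF F]) (use that in auto)
    have "continuous_on ({0<..} \<times> cbox a b) (\<lambda>q. (- real CARD('n) / (2 * fst q) + (norm (y - snd q))\<^sup>2 / (4 * (fst q)\<^sup>2)) * gauss (fst q) (y - snd q) * F (snd q))"
      by (intro continuous_intros continuous_on_compose2[OF F]) auto
    then show "continuous_on ({0<..} \<times> cbox a b) (\<lambda>(s, z). (- real CARD('n) / (2 * s) + (norm (y - z))\<^sup>2 / (4 * s\<^sup>2)) * gauss s (y - z) * F z)"
      by (simp add: case_prod_unfold)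
  qed (use t in auto)
  moreover have "at t within {0<..} = at t" using t by (intro at_within_open) auto
  ultimately show ?thesis by (simp add: heat_conv_def)
qed

lemma heat_conv_space_derivatives:
  fixes F :: "real^'n::finite \<Rightarrow> real" and a b :: "real^'n" and i :: 'n
  assumes F: "continuous_on UNIV F" and t: "0 < t"
  defines "W1 \<equiv> \<lambda>y. integral (cbox a b) (\<lambda>z. (- ((y - z) $ i) / (2 * t) * gauss t (y - z)) * F z)"
  shows "((\<lambda>\<tau>. heat_conv a b F (y + \<tau> *\<^sub>R axis i 1) t) has_real_derivative W1 y) (at 0)"
    and "((\<lambda>\<tau>. W1 (y + \<tau> *\<^sub>R axis i 1)) has_real_derivative
      integral (cbox a b) (\<lambda>z. ((- 1 / (2 * t) + (y - z) $ i * (y - z) $ i / (4 * t\<^sup>2)) * gauss t (y - z)) * F z)) (at 0)"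
proof -
  let ?y = "\<lambda>\<tau>. y + \<tau> *\<^sub>R axis i (1::real)"
  have c: "continuous_on (UNIV \<times> cbox a b) (\<lambda>q. f (?y (fst q)) (snd q) * F (snd q))"
    if "continuous_on UNIV (\<lambda>p. f (fst p) (snd p))" for f :: "real^'n \<Rightarrow> real^'n \<Rightarrow> real"
  proof -
    have "continuous_on (UNIV \<times> cbox a b) (\<lambda>q. (\<lambda>p. f (fst p) (snd p)) (?y (fst q), snd q))"
      by (rule continuous_on_compose2[OF that]) (auto intro!: continuous_intros)
    then show ?thesis by (intro continuous_intros continuous_on_compose2[OF F]) auto
  qed
  have g0: "continuous_on UNIV (\<lambda>p. gauss t (fst p - snd p))" 
    by (intro continuous_intros) (use t in auto)
  have g1: "continuous_on UNIV (\<lambda>p. - ((fst p - snd p) $ i) / (2 * t) * gauss t (fst p - snd p))"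
    by (intro continuous_intros g0) (use t in auto)
  have g2: "continuous_on UNIV (\<lambda>p. (- 1 / (2 * t) + (fst p - snd p) $ i * (fst p - snd p) $ i / (4 * t\<^sup>2)) * gauss t (fst p - snd p))"
    by (intro continuous_intros g0) (use t in auto)
  have i: "(\<lambda>z. f (w - z) * F z) integrable_on cbox a b" if "continuous_on UNIV f" for w and f :: "real^'n \<Rightarrow> real"
    by (intro integrable_continuous continuous_intros continuous_on_subset[OF F] continuous_on_compose2[OF that]) auto
  have h0: "continuous_on UNIV (\<lambda>v. gauss t (v::real^'n))" by (intro continuous_intros) (use t in auto)
  have h1: "continuous_on UNIV (\<lambda>v::real^'n. - (v $ i) / (2 * t) * gauss t v)" by (intro continuous_intros h0) (use t in auto)
  have d1: "((\<lambda>\<tau>. gauss t (?y \<tau> - z) * F z) has_real_derivative (- ((?y \<tau> - z) $ i) / (2 * t) * gauss t (?y \<tau> - z)) * F z) (at \<tau>)" for \<tau> z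
    using DERIV_cmult_right[OF has_derivative_along_axis[OF gauss_shift_has_derivative[OF t, where x=z and z="?y \<tau>"]], where c="F z"]
    by (simp add: inner_axis)
  have d2: "((\<lambda>\<tau>. (- ((?y \<tau> - z) $ i) / (2 * t) * gauss t (?y \<tau> - z)) * F z) has_real_derivative
     ((- 1 / (2 * t) + (?y \<tau> - z) $ i * (?y \<tau> - z) $ i / (4 * t\<^sup>2)) * gauss t (?y \<tau> - z)) * F z) (at \<tau>)" for \<tau> z
    using DERIV_cmult_right[OF has_derivative_along_axis[OF pd_pd_gauss_derivative[OF t, where i=i and x=z and z="?y \<tau>"]], where c="F z"]
    by (simp add: inner_axis)
  have "((\<lambda>\<tau>. integral (cbox a b) (\<lambda>z. gauss t (?y \<tau> - z) * F z)) has_real_derivative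
     integral (cbox a b) (\<lambda>z. (- ((?y 0 - z) $ i) / (2 * t) * gauss t (?y 0 - z)) * F z)) (at 0 within UNIV)"
    by (rule leibniz_rule_field_derivative[OF d1 i[OF h0]])
       (use c[OF g1] in \<open>auto simp: case_prod_unfold\<close>)
  then show "((\<lambda>\<tau>. heat_conv a b F (?y \<tau>) t) has_real_derivative W1 y) (at 0)"
    by (simp add: heat_conv_def W1_def)
  have "((\<lambda>\<tau>. integral (cbox a b) (\<lambda>z. (- ((?y \<tau> - z) $ i) / (2 * t) * gauss t (?y \<tau> - z)) * F z)) has_real_derivative
     integral (cbox a b) (\<lambda>z. ((- 1 / (2 * t) + (?y 0 - z) $ i * (?y 0 - z) $ i / (4 * t\<^sup>2)) * gauss t (?y 0 - z)) * F z)) (at 0 within UNIV)"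
    by (rule leibniz_rule_field_derivative[OF d2 i[OF h1]])
       (use c[OF g2] in \<open>auto simp: case_prod_unfold\<close>)
  then show "((\<lambda>\<tau>. W1 (?y \<tau>)) has_real_derivative
      integral (cbox a b) (\<lambda>z. ((- 1 / (2 * t) + (y - z) $ i * (y - z) $ i / (4 * t\<^sup>2)) * gauss t (y - z)) * F z)) (at 0)"
    by (simp add: W1_def)
qed

lemma heat_conv_heat_equation:
  fixes F :: "real^'n::finite \<Rightarrow> real"
  assumes F: "continuous_on UNIV F" and t: "0 < t"
  shows "(\<Sum>i\<in>UNIV. integral (cbox a b) (\<lambda>z. ((- 1 / (2 * t) + (y - z) $ i * (y - z) $ i / (4 * t\<^sup>2)) * gauss t (y - z)) * F z))
    = integral (cbox a b) (\<lambda>z. (- real CARD('n) / (2 * t) + (norm (y - z))\<^sup>2 / (4 * t\<^sup>2)) * gauss t (y - z) * F z)"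
proof -
  have "(\<Sum>i\<in>UNIV. integral (cbox a b) (\<lambda>z. ((- 1 / (2 * t) + (y - z) $ i * (y - z) $ i / (4 * t\<^sup>2)) * gauss t (y - z)) * F z))
    = integral (cbox a b) (\<lambda>z. \<Sum>i\<in>UNIV. ((- 1 / (2 * t) + (y - z) $ i * (y - z) $ i / (4 * t\<^sup>2)) * gauss t (y - z)) * F z)"
    by (intro Henstock_Kurzweil_Integration.integral_sum[symmetric] integrable_continuous continuous_intros continuous_on_subset[OF F])
       (use t in auto)
  also have "(\<lambda>z. \<Sum>i\<in>UNIV. ((- 1 / (2 * t) + (y - z) $ i * (y - z) $ i / (4 * t\<^sup>2)) * gauss t (y - z)) * F z)
    = (\<lambda>z. (- real CARD('n) / (2 * t) + (norm (y - z))\<^sup>2 / (4 * t\<^sup>2)) * gauss t (y - z) * F z)"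
  proof
    fix z
    have "(norm (y - z))\<^sup>2 = (\<Sum>i\<in>UNIV. (y - z) $ i * (y - z) $ i)"
      by (simp only: power2_norm_eq_inner inner_vec_def inner_real_def)
    then show "(\<Sum>i\<in>UNIV. ((- 1 / (2 * t) + (y - z) $ i * (y - z) $ i / (4 * t\<^sup>2)) * gauss t (y - z)) * F z)
      = (- real CARD('n) / (2 * t) + (norm (y - z))\<^sup>2 / (4 * t\<^sup>2)) * gauss t (y - z) * F z"
      by (simp add: sum_distrib_right[symmetric] sum.distrib sum_divide_distrib[symmetric] sum_subtractf)
  qed
  finally show ?thesis .
qed

text \<open>
  On \<open>norm y = R\<close> the exponent is at least of the order of \<open>R\<close>, and \<open>exp (- p) \<le> 1 / p\<close>
  turns this into a bound of order \<open>1 / R\<close>, uniformly for \<open>0 \<le> t \<le> T\<close>.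
\<close>

lemma heat_conv_small_far_away:
  fixes F :: "real^'n::finite \<Rightarrow> real"
  assumes F: "continuous_on UNIV F" and \<eta>: "0 < \<eta>" and e: "0 < e" and T: "0 \<le> T"
  obtains R where "r \<le> R" "\<forall>y t. norm y = R \<longrightarrow> 0 \<le> t \<longrightarrow> t \<le> T \<longrightarrow> heat_conv a b F y (t + \<eta>) \<le> e"
proof -
  have "bounded (F ` cbox a b)"
    by (intro compact_imp_bounded compact_continuous_image continuous_on_subset[OF F]) auto
  then obtain B where B: "0 < B" "\<And>z. z \<in> cbox a b \<Longrightarrow> \<bar>F z\<bar> \<le> B"
    unfolding bounded_pos by auto
  obtain \<rho> where \<rho>: "0 < \<rho>" "\<And>z. z \<in> cbox a b \<Longrightarrow> norm z \<le> \<rho>"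
    using bounded_cbox[of a b] unfolding bounded_pos by auto
  define C where "C = (4 * pi * \<eta>) powr (- real CARD('n) / 2)"
  have C: "0 < C" using \<eta> by (simp add: C_def)
  define D where "D = C * (4 * (T + \<eta>)) * B * measure lborel (cbox a b)"
  have D: "0 \<le> D" using C B T \<eta> by (simp add: D_def)
  define R where "R = max r (\<rho> + 1 + D / e)"
  have R: "r \<le> R" "\<rho> + 1 + D / e \<le> R" by (auto simp: R_def)
  have "heat_conv a b F y (t + \<eta>) \<le> e" if y: "norm y = R" and t: "0 \<le> t" "t \<le> T" for y t
  proof -
    let ?q = "R - \<rho>"
    have "0 \<le> D / e" using D e by simp
    then have q: "1 \<le> ?q" using R by simp
    have g: "gauss (t + \<eta>) (y - z) \<le> C * (4 * (T + \<eta>) / ?q)" if z: "z \<in> cbox a b" for z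
    proof -
      have "(4 * pi * (t + \<eta>)) powr (- real CARD('n) / 2) \<le> C"
        unfolding C_def by (rule powr_mono2') (use t \<eta> in auto)
      moreover have "exp (- (norm (y - z))\<^sup>2 / (4 * (t + \<eta>))) \<le> 4 * (T + \<eta>) / ?q"
      proof -
        have "?q \<le> norm (y - z)" using norm_triangle_ineq2[of y z] y \<rho>(2)[OF z] by simp
        then have "?q\<^sup>2 \<le> (norm (y - z))\<^sup>2" using q by (intro power_mono) auto
        moreover have "?q \<le> ?q\<^sup>2" using q by (simp add: power2_eq_square)
        ultimately have "?q \<le> (norm (y - z))\<^sup>2" by simp
        then have "?q / (4 * (T + \<eta>)) \<le> (norm (y - z))\<^sup>2 / (4 * (t + \<eta>))"
          using t \<eta> q by (intro frac_le) auto
        then have "exp (- ((norm (y - z))\<^sup>2 / (4 * (t + \<eta>)))) \<le> exp (- (?q / (4 * (T + \<eta>))))" by simp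
        also have "\<dots> \<le> 1 / (?q / (4 * (T + \<eta>)))"
        proof -
          have "exp (- p) \<le> 1 / p" if p: "0 < p" for p :: real
          proof -
            have "p \<le> exp p" using exp_ge_add_one_self[of p] by linarith
            then have "1 / exp p \<le> 1 / p" using p by (intro frac_le) auto
            then show ?thesis by (simp add: exp_minus inverse_eq_divide)
          qed
          moreover have "0 < ?q / (4 * (T + \<eta>))" using q T \<eta> by simp
          ultimately show ?thesis by blast
        qed
        finally show ?thesis by simp
      qed
      ultimately show ?thesis
        unfolding gauss_def by (intro mult_mono) (use C in auto)
    qed
    have i: "((\<lambda>z. gauss (t + \<eta>) (y - z) * F z) has_integral heat_conv a b F y (t + \<eta>)) (cbox a b)"
      unfolding heat_conv_def
      by (intro integrable_integral integrable_continuous continuous_intros continuous_on_subset[OF F]) (use t \<eta> in auto)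
    have "norm (heat_conv a b F y (t + \<eta>)) \<le> (C * (4 * (T + \<eta>) / ?q) * B) * measure lborel (cbox a b)"
    proof (rule has_integral_bound[OF _ i])
      show "0 \<le> C * (4 * (T + \<eta>) / ?q) * B" using C B q T \<eta> by simp
      fix z assume z: "z \<in> cbox a b"
      have "0 < gauss (t + \<eta>) (y - z)" by (rule gauss_pos) (use t \<eta> in simp)
      then show "norm (gauss (t + \<eta>) (y - z) * F z) \<le> C * (4 * (T + \<eta>) / ?q) * B"
        unfolding real_norm_def abs_mult by (intro mult_mono) (use g[OF z] B(2)[OF z] in auto)
    qed
    also have "\<dots> = D / ?q" by (simp add: D_def)
    also have "\<dots> \<le> e"
    proof -
      have "D / e \<le> ?q" using R by simp
      then show ?thesis using e q by (simp add: field_simps)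
    qed
    finally show ?thesis by simp
  qed
  with R show ?thesis by (intro that[of R]) auto
qed

lemma heat_conv_eq_lborel:
  fixes F :: "real^'n::finite \<Rightarrow> real"
  assumes F: "continuous_on UNIV F" and supp: "\<And>z. z \<notin> cbox a b \<Longrightarrow> F z = 0" and t: "0 < t"
  shows "heat_conv a b F y t = (\<integral>z. gauss t (z - y) * F z \<partial>lborel)"
proof -
  let ?f = "\<lambda>z. gauss t (z - y) * F z"
  have e: "gauss t (y - z) = gauss t (z - y)" for z using gauss_minus[of t "z - y"] by simp
  have c: "continuous_on (cbox a b) ?f"
    by (intro continuous_intros continuous_on_subset[OF F]) (use t in auto)
  have i: "(\<lambda>z. indicator (cbox a b) z *\<^sub>R ?f z) = ?f"
    using supp by (auto simp: indicator_def fun_eq_iff)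
  have "integrable lborel ?f"
    using borel_integrable_compact[OF compact_cbox c] unfolding i .
  then have "(\<integral>z. ?f z \<partial>lborel) = integral UNIV ?f" by (simp add: integral_lborel)
  also have "\<dots> = integral UNIV (\<lambda>z. if z \<in> cbox a b then ?f z else 0)"
    using supp by (intro Henstock_Kurzweil_Integration.integral_cong) auto
  also have "\<dots> = integral (cbox a b) ?f" by (rule integral_restrict_UNIV)
  finally show ?thesis by (simp add: heat_conv_def e)
qed

section \<open>The Gaussian is the minimal fundamental solution\<close>

lemma euclidean_fundamental_solutionD:
  fixes K :: "real^'n::finite \<Rightarrow> real^'n \<Rightarrow> real \<Rightarrow> real"
  assumes "positive_fundamental_solution euclidean_atlas flat_metric K"
  shows fundamental_pos: "0 < t \<Longrightarrow> 0 < K x y t"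
    and fundamental_cont: "continuous_on (UNIV \<times> {0<..}) (\<lambda>(y, t). K x y t)"
    and fundamental_time: "0 < t \<Longrightarrow> ((\<lambda>s. K x y s) has_real_derivative deriv (K x y) t) (at t)"
    and fundamental_space1: "0 < t \<Longrightarrow>
      ((\<lambda>\<tau>. K x (y + \<tau> *\<^sub>R axis i 1) t) has_real_derivative pd i (\<lambda>w. K x w t) y) (at 0)"
    and fundamental_space2: "0 < t \<Longrightarrow>
      ((\<lambda>\<tau>. pd i (\<lambda>w. K x w t) (y + \<tau> *\<^sub>R axis i 1)) has_real_derivative pd i (pd i (\<lambda>w. K x w t)) y) (at 0)"
    and fundamental_heat: "0 < t \<Longrightarrow> (\<Sum>i\<in>UNIV. pd i (pd i (\<lambda>w. K x w t)) y) = deriv (K x y) t"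
    and fundamental_init: "continuous_on UNIV f \<Longrightarrow> compact (closure {y. f y \<noteq> 0}) \<Longrightarrow>
        ((\<lambda>t. \<integral>y. K x y t * f y \<partial>lborel) \<longlongrightarrow> f x) (at_right 0)"
proof -
  note P = assms[unfolded positive_fundamental_solution_def euclidean_volume euclidean_laplacian]
  note P1 = P[THEN conjunct1] and P2 = P[THEN conjunct2, THEN conjunct1]
    and P3 = P[THEN conjunct2, THEN conjunct2, THEN conjunct1]
    and P4 = P[THEN conjunct2, THEN conjunct2, THEN conjunct2]
  show "0 < K x y t" if "0 < t" using P1 that by blast
  show "(\<Sum>i\<in>UNIV. pd i (pd i (\<lambda>w. K x w t)) y) = deriv (K x y) t" if "0 < t" using P3[rule_format, OF that, of x y] by simp
  show "((\<lambda>t. \<integral>y. K x y t * f y \<partial>lborel) \<longlongrightarrow> f x) (at_right 0)"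
    if "continuous_on UNIV f" "compact (closure {y. f y \<noteq> 0})" using P4 that by blast
  have C: "C21 euclidean_atlas (K x)" using P2 by blast
  have e: "(UNIV, \<lambda>x. x) \<in> (euclidean_atlas :: (real^'n, 'n) chart set)" by (simp add: euclidean_atlas_def)
  note C' = C[unfolded C21_def, rule_format, OF e, unfolded euclidean_chart[OF e]]
  show "continuous_on (UNIV \<times> {0<..}) (\<lambda>(y, t). K x y t)"
    using conjunct1[OF conjunct2[OF C']] by (auto dest: spec[of _ "[]"])
  show "((\<lambda>s. K x y s) has_real_derivative deriv (K x y) t) (at t)" if "0 < t"
  proof -
    have "K x y differentiable (at t)" using C' that by simp
    then show ?thesis by (simp add: DERIV_deriv_iff_real_differentiable)
  qed
  have Ck: "Ck_on 2 UNIV (\<lambda>w. K x w t)" if "0 < t" using C' that by simp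
  have d: "f differentiable (at y) \<Longrightarrow>
      ((\<lambda>\<tau>. f (y + \<tau> *\<^sub>R axis i 1)) has_real_derivative pd i f y) (at 0)" for f :: "real^'n \<Rightarrow> real"
    using has_derivative_along_axis[of f "frechet_derivative f (at y)" y 0 i]
    by (simp add: frechet_derivative_works pd_def)
  show "((\<lambda>\<tau>. K x (y + \<tau> *\<^sub>R axis i 1) t) has_real_derivative pd i (\<lambda>w. K x w t) y) (at 0)" if "0 < t"
    by (rule d) (use Ck[OF that] in \<open>auto simp: Ck_on_def dest: spec[of _ "[]"]\<close>)
  show "((\<lambda>\<tau>. pd i (\<lambda>w. K x w t) (y + \<tau> *\<^sub>R axis i 1)) has_real_derivative pd i (pd i (\<lambda>w. K x w t)) y) (at 0)" if "0 < t"
    by (rule d) (use Ck[OF that] in \<open>auto simp: Ck_on_def dest: spec[of _ "[i]"]\<close>)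
qed

text \<open>
  The minimum principle is applied to the difference of the two solutions on a large cylinder. On
  its lateral boundary the convolution is at most \<open>e\<close> while \<open>K\<close> is positive. Starting the
  convolution at time \<open>\<eta>\<close> and \<open>K\<close> at time \<open>s\<close> keeps both away from their singular initial
  times.
\<close>

lemma heat_conv_le_solution:
  fixes K :: "real^'n::finite \<Rightarrow> real^'n \<Rightarrow> real \<Rightarrow> real"
  assumes K: "positive_fundamental_solution euclidean_atlas flat_metric K"
    and F: "continuous_on UNIV F" and s: "0 < s" and \<eta>: "0 < \<eta>" and e: "0 < e"
    and init: "\<And>y. heat_conv a b F y \<eta> \<le> K x y s + e" and t: "0 \<le> t"
  shows "heat_conv a b F y (t + \<eta>) \<le> K x y (s + t) + e"
proof -
  obtain R where R: "norm y \<le> R" "\<forall>z r. norm z = R \<longrightarrow> 0 \<le> r \<longrightarrow> r \<le> t \<longrightarrow> heat_conv a b F z (r + \<eta>) \<le> e"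
    using heat_conv_small_far_away[OF F \<eta> e t, of "norm y" a b] .
  define u where "u = (\<lambda>y t. K x y (s + t) - heat_conv a b F y (t + \<eta>))"
  define W1 where "W1 = (\<lambda>i t y. integral (cbox a b) (\<lambda>z. (- ((y - z) $ i) / (2 * t) * gauss t (y - z)) * F z))"
  define W2 where "W2 = (\<lambda>i t y. integral (cbox a b) (\<lambda>z. ((- 1 / (2 * t) + (y - z) $ i * (y - z) $ i / (4 * t\<^sup>2)) * gauss t (y - z)) * F z))"
  define Wt where "Wt = (\<lambda>t y. integral (cbox a b) (\<lambda>z. (- real CARD('n) / (2 * t) + (norm (y - z))\<^sup>2 / (4 * t\<^sup>2)) * gauss t (y - z) * F z))"
  have "- e \<le> u y t"
  proof (rule parabolic_minimum_principle[where R=R and T=t and u=u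
        and ut="\<lambda>y t. deriv (K x y) (s + t) - Wt (t + \<eta>) y"
        and ux="\<lambda>i y t. pd i (\<lambda>w. K x w (s + t)) y - W1 i (t + \<eta>) y"
        and uxx="\<lambda>i y t. pd i (pd i (\<lambda>w. K x w (s + t))) y - W2 i (t + \<eta>) y"])
    have "continuous_on (cball 0 R \<times> {0..t}) (\<lambda>p. (\<lambda>(y, t). K x y t) (fst p, s + snd p))"
      by (rule continuous_on_compose2[OF fundamental_cont[OF K]]) (use s in \<open>auto intro!: continuous_intros\<close>)
    moreover have "continuous_on (cball 0 R \<times> {0..t}) (\<lambda>(y, t). heat_conv a b F y (t + \<eta>))"
      by (rule continuous_on_subset[OF heat_conv_continuous[OF F \<eta>, of UNIV]]) auto
    ultimately have "continuous_on (cball 0 R \<times> {0..t}) (\<lambda>p. (\<lambda>(y, t). K x y t) (fst p, s + snd p) - (\<lambda>(y, t). heat_conv a b F y (t + \<eta>)) p)"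
      by (rule continuous_on_diff)
    then show "continuous_on (cball 0 R \<times> {0..t}) (\<lambda>(y, t). u y t)"
      by (simp add: u_def case_prod_unfold)
  next
    fix z and r :: real assume r: "0 < r"
    then have sr: "0 < s + r" and r\<eta>: "0 < r + \<eta>" using s \<eta> by auto
    have "((\<lambda>q. K x z (q + s)) has_real_derivative deriv (K x z) (r + s)) (at r)"
      using fundamental_time[OF K sr, of x z] DERIV_shift[of "K x z" "deriv (K x z) (r + s)" r s]
      by (simp add: add.commute)
    moreover have "((\<lambda>q. heat_conv a b F z (q + \<eta>)) has_real_derivative Wt (r + \<eta>) z) (at r)"
      using heat_conv_time_derivative[OF F r\<eta>, of a b z] DERIV_shift[of "heat_conv a b F z" _ r \<eta>]
      by (simp add: Wt_def)
    ultimately show "((\<lambda>q. u z q) has_real_derivative deriv (K x z) (s + r) - Wt (r + \<eta>) z) (at r)"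
      unfolding u_def by (intro DERIV_diff) (simp_all add: add.commute)
    show "((\<lambda>\<tau>. u (z + \<tau> *\<^sub>R axis i 1) r) has_real_derivative pd i (\<lambda>w. K x w (s + r)) z - W1 i (r + \<eta>) z) (at 0)" for i
      unfolding u_def W1_def
      by (intro DERIV_diff fundamental_space1[OF K sr] heat_conv_space_derivatives(1)[OF F r\<eta>])
    show "((\<lambda>\<tau>. pd i (\<lambda>w. K x w (s + r)) (z + \<tau> *\<^sub>R axis i 1) - W1 i (r + \<eta>) (z + \<tau> *\<^sub>R axis i 1))
       has_real_derivative pd i (pd i (\<lambda>w. K x w (s + r))) z - W2 i (r + \<eta>) z) (at 0)" for i
      unfolding W1_def W2_def
      by (intro DERIV_diff fundamental_space2[OF K sr] heat_conv_space_derivatives(2)[OF F r\<eta>])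
    show "(\<Sum>i\<in>UNIV. pd i (pd i (\<lambda>w. K x w (s + r))) z - W2 i (r + \<eta>) z) \<le> deriv (K x z) (s + r) - Wt (r + \<eta>) z"
      unfolding sum_subtractf W2_def Wt_def heat_conv_heat_equation[OF F r\<eta>] fundamental_heat[OF K sr] by simp
  next
    fix z show "- e \<le> u z 0" using init[of z] by (simp add: u_def)
  next
    fix z :: "real^'n" and r :: real assume "norm z = R" "0 \<le> r" "r \<le> t"
    then show "- e \<le> u z r" using R(2)[rule_format, of z r] fundamental_pos[OF K, of "s + r" x z] s by (simp add: u_def)
  qed (use R t in auto)
  then show ?thesis by (simp add: u_def)
qed

text \<open>
  Uniform continuity and boundedness give \<open>F (y + v) \<le> F y + e / 2 + 2 B \<psi> v\<close>, where \<open>\<psi>\<close> is continuous,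
  bounded, independent of \<open>y\<close> and zero at \<open>0\<close>. Hence the error in \<open>\<psi>\<close> tends to \<open>0\<close> uniformly
  in \<open>y\<close> by the concentration of the Gaussian.
\<close>

lemma heat_conv_initial_upper_bound:
  fixes F :: "real^'n::finite \<Rightarrow> real"
  assumes F: "continuous_on UNIV F" and supp: "\<And>z. z \<notin> cball x 1 \<Longrightarrow> F z = 0" and box: "cball x 1 \<subseteq> cbox a b"
    and e: "0 < e"
  shows "eventually (\<lambda>\<eta>. \<forall>y. heat_conv a b F y \<eta> \<le> F y + e) (at_right 0)"
proof -
  have "compact (F ` cball x 1)" by (intro compact_continuous_image continuous_on_subset[OF F]) auto
  then obtain B where B: "0 < B" "\<And>z. z \<in> cball x 1 \<Longrightarrow> \<bar>F z\<bar> \<le> B"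
    using compact_imp_bounded[of "F ` cball x 1"] unfolding bounded_pos by auto
  have B': "\<bar>F z\<bar> \<le> B" for z using B supp[of z] by (cases "z \<in> cball x 1") auto
  have "uniformly_continuous_on (cball x 3) F"
    by (intro compact_uniformly_continuous continuous_on_subset[OF F]) auto
  then obtain d where d: "0 < d" "\<And>y z. y \<in> cball x 3 \<Longrightarrow> z \<in> cball x 3 \<Longrightarrow> dist z y < d \<Longrightarrow> dist (F z) (F y) < e / 2"
    using e unfolding uniformly_continuous_on_def by (metis half_gt_zero)
  define \<delta> where "\<delta> = min d 1"
  have \<delta>: "0 < \<delta>" "\<delta> \<le> d" "\<delta> \<le> 1" using d by (auto simp: \<delta>_def)
  have near: "F z \<le> F y + e / 2" if "dist z y < \<delta>" for y z
  proof (cases "y \<in> cball x 2")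
    case True
    then have "z \<in> cball x 3" "y \<in> cball x 3"
      using that \<delta> dist_triangle[of x z y] by (auto simp: dist_commute)
    then have "dist (F z) (F y) < e / 2" using d(2)[of y z] that \<delta> by simp
    then have "\<bar>F z - F y\<bar> < e / 2" by (simp only: dist_real_def)
    then show ?thesis by linarith
  next
    case False
    then have "y \<notin> cball x 1" "z \<notin> cball x 1"
      using that \<delta> dist_triangle[of x y z] by (auto simp: dist_commute)
    then show ?thesis using supp e by simp
  qed
  define \<psi> where "\<psi> = (\<lambda>v::real^'n. min 1 (norm v / \<delta>))"
  have \<psi>c: "continuous_on UNIV \<psi>" unfolding \<psi>_def by (intro continuous_intros) (use \<delta> in auto)
  have \<psi>b: "\<bar>\<psi> v\<bar> \<le> 1" "0 \<le> \<psi> v" for v using \<delta> by (auto simp: \<psi>_def)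
  have upper: "F (y + v) \<le> F y + e / 2 + 2 * B * \<psi> v" for y v
  proof (cases "norm v < \<delta>")
    case True
    have "F (y + v) \<le> F y + e / 2" by (rule near) (use True in \<open>simp add: dist_norm\<close>)
    then show ?thesis using B(1) \<psi>b(2)[of v] by (smt (verit) mult_nonneg_nonneg)
  next
    case False
    then have "\<psi> v = 1" using \<delta> by (simp add: \<psi>_def)
    then show ?thesis using B'[of "y + v"] B'[of y] e by simp
  qed
  have "((\<lambda>t. \<integral>y. gauss t (y - 0) * \<psi> y \<partial>lborel) \<longlongrightarrow> \<psi> 0) (at_right 0)"
    by (rule gauss_concentrates[OF \<psi>c \<psi>b(1)])
  then have "((\<lambda>t. \<integral>y. gauss t y * \<psi> y \<partial>lborel) \<longlongrightarrow> 0) (at_right 0)" by (simp add: \<psi>_def)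
  from order_tendstoD(2)[OF this, of "e / (4 * B)"]
  have ev: "eventually (\<lambda>t. (\<integral>y. gauss t y * \<psi> y \<partial>lborel) < e / (4 * B)) (at_right 0)" using e B by simp
  have pos: "eventually (\<lambda>t. (0::real) < t) (at_right 0)" by (rule eventually_at_right_less)
  from ev pos show ?thesis
  proof eventually_elim
    case (elim t)
    note t = \<open>0 < t\<close>
    let ?s = "sqrt (2 * t)"
    have Fm: "F \<in> borel_measurable borel" and \<psi>m: "\<psi> \<in> borel_measurable borel"
      using F \<psi>c by (auto intro: borel_measurable_continuous_onI)
    note [measurable] = Fm \<psi>m borel_measurable_integrable[OF std_gauss_integrable]
    have i\<psi>: "integrable lborel (\<lambda>u. std_gauss u * \<psi> (?s *\<^sub>R u))"
      by (rule Bochner_Integration.integrable_bound[OF std_gauss_integrable])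
         (use \<psi>b in \<open>auto intro!: AE_I2 simp: abs_mult std_gauss_nonneg mult_left_le\<close>)
    have iF: "integrable lborel (\<lambda>u. std_gauss u * F (y + ?s *\<^sub>R u))" for y
      by (rule Bochner_Integration.integrable_bound[OF integrable_mult_left[OF std_gauss_integrable, of B]])
         (use B' B(1) in \<open>auto intro!: AE_I2 mult_left_mono simp: abs_mult std_gauss_nonneg\<close>)
    have small: "(\<integral>u. std_gauss u * \<psi> (?s *\<^sub>R u) \<partial>lborel) < e / (4 * B)"
      using elim(1) integral_gauss_affine[OF t \<psi>m, of 0] by simp
    show ?case
    proof
      fix y
      have "heat_conv a b F y t = (\<integral>z. gauss t (z - y) * F z \<partial>lborel)"
        by (rule heat_conv_eq_lborel[OF F _ t]) (use supp box in blast)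
      also have "\<dots> = (\<integral>u. std_gauss u * F (y + ?s *\<^sub>R u) \<partial>lborel)"
        by (rule integral_gauss_affine[OF t Fm])
      also have "\<dots> \<le> (\<integral>u. std_gauss u * (F y + e / 2) + 2 * B * (std_gauss u * \<psi> (?s *\<^sub>R u)) \<partial>lborel)"
      proof (rule integral_mono[OF iF])
        show "integrable lborel (\<lambda>u. std_gauss u * (F y + e / 2) + 2 * B * (std_gauss u * \<psi> (?s *\<^sub>R u)))"
          by (intro Bochner_Integration.integrable_add integrable_mult_left integrable_mult_right std_gauss_integrable i\<psi>)
        fix u
        show "std_gauss u * F (y + ?s *\<^sub>R u) \<le> std_gauss u * (F y + e / 2) + 2 * B * (std_gauss u * \<psi> (?s *\<^sub>R u))"
          using mult_left_mono[OF upper[of y "?s *\<^sub>R u"] std_gauss_nonneg[of u]] by (simp add: algebra_simps)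
      qed
      also have "\<dots> = (F y + e / 2) + 2 * B * (\<integral>u. std_gauss u * \<psi> (?s *\<^sub>R u) \<partial>lborel)"
        by (subst Bochner_Integration.integral_add)
           (auto intro!: integrable_mult_left integrable_mult_right std_gauss_integrable i\<psi> simp: std_gauss_integral)
      also have "\<dots> \<le> F y + e"
        using small B(1) by (simp add: field_simps)
      finally show "heat_conv a b F y t \<le> F y + e" .
    qed
  qed
qed

text \<open>
  Let \<open>\<phi>\<close> be a cutoff function near \<open>x\<close> and start the heat flow of flat space from the compactly
  supported datum \<open>\<phi> K x \<cdot> s\<close>, which lies below \<open>K x \<cdot> s\<close>. By comparison the flow stays below \<open>K\<close>
  after any further time \<open>t\<close>. As \<open>s \<rightarrow> 0\<close>, the datum tends to the point mass at \<open>x\<close>, so the flow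
  tends to the Gaussian, and \<open>K x y (s + t)\<close> tends to \<open>K x y t\<close>.
\<close>

theorem gauss_minimal:
  fixes K :: "real^'n::finite \<Rightarrow> real^'n \<Rightarrow> real \<Rightarrow> real"
  assumes K: "positive_fundamental_solution euclidean_atlas flat_metric K" and t: "0 < t"
  shows "gauss t (y - x) \<le> K x y t"
proof -
  define \<phi> where "\<phi> = (\<lambda>z. max 0 (1 - dist x z))"
  have \<phi>c: "continuous_on UNIV \<phi>" unfolding \<phi>_def by (intro continuous_intros)
  have \<phi>: "0 \<le> \<phi> z" "\<phi> z \<le> 1" "\<phi> x = 1" for z by (auto simp: \<phi>_def)
  have \<phi>0: "\<phi> z = 0" if "z \<notin> cball x 1" for z using that by (simp add: \<phi>_def)
  obtain a b where box: "cball x 1 \<subseteq> cbox a b"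
    using bounded_subset_cbox_symmetric[OF bounded_cball, of x 1] by metis
  have Kt: "isCont (\<lambda>r. K x y r) r" if "0 < r" for r
    by (rule DERIV_isCont[OF fundamental_time[OF K that]])
  have averaged: "(\<integral>z. K x z s * (\<phi> z * gauss t (z - y)) \<partial>lborel) \<le> K x y (s + t)" if s: "0 < s" for s
  proof -
    define F where "F = (\<lambda>z. \<phi> z * K x z s)"
    have "continuous_on UNIV (\<lambda>z. (\<lambda>(y, t). K x y t) (z, s))"
      by (rule continuous_on_compose2[OF fundamental_cont[OF K]]) (use s in \<open>auto intro!: continuous_intros\<close>)
    then have F: "continuous_on UNIV F" unfolding F_def by (intro continuous_on_mult \<phi>c) simp
    have F0: "F z = 0" if "z \<notin> cball x 1" for z using \<phi>0[OF that] by (simp add: F_def)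
    have FK: "F z \<le> K x z s" for z
      unfolding F_def using mult_right_mono[OF \<phi>(2)[of z] less_imp_le[OF fundamental_pos[OF K s, of x z]]] by simp
    have "heat_conv a b F y t \<le> K x y (s + t) + e" if e: "0 < e" for e
    proof (rule tendsto_lowerbound)
      have "((\<lambda>\<eta>. s + (t - \<eta>)) \<longlongrightarrow> s + (t - 0)) (at_right 0)"
        by (rule tendsto_add[OF tendsto_const tendsto_diff[OF tendsto_const tendsto_ident_at]])
      then have lim: "((\<lambda>\<eta>. s + (t - \<eta>)) \<longlongrightarrow> s + t) (at_right 0)" by simp
      have "0 < s + t" using s t by simp
      from isCont_tendsto_compose[OF Kt[OF this] lim]
      show "((\<lambda>\<eta>. K x y (s + (t - \<eta>)) + e) \<longlongrightarrow> K x y (s + t) + e) (at_right 0)"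
        by (rule tendsto_add[OF _ tendsto_const])
      (* The convolution started at time \<eta> runs for the time t - \<eta>, so its left-hand side is free
         of \<eta>, and only the continuity of K in time is needed as \<eta> tends to 0. *)
      have 1: "eventually (\<lambda>\<eta>. \<forall>y. heat_conv a b F y \<eta> \<le> F y + e) (at_right 0)"
        by (rule heat_conv_initial_upper_bound[OF F F0 box e])
      have 2: "eventually (\<lambda>\<eta>. (0::real) < \<eta>) (at_right 0)" by (rule eventually_at_right_less)
      have 3: "eventually (\<lambda>\<eta>. \<eta> < t) (at_right 0)" by (rule order_tendstoD(2)[OF tendsto_ident_at t])
      from 1 2 3 show "eventually (\<lambda>\<eta>. heat_conv a b F y t \<le> K x y (s + (t - \<eta>)) + e) (at_right 0)"
      proof eventually_elim
        case (elim \<eta>)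
        have "heat_conv a b F z \<eta> \<le> K x z s + e" for z using elim(1) FK[of z] by (meson add_right_mono order_trans)
        from heat_conv_le_solution[OF K F s elim(2) e this, of "t - \<eta>" y] elim(3)
        show ?case by simp
      qed
    qed simp
    then have "heat_conv a b F y t \<le> K x y (s + t)" by (rule field_le_epsilon)
    moreover have "heat_conv a b F y t = (\<integral>z. gauss t (z - y) * F z \<partial>lborel)"
      by (rule heat_conv_eq_lborel[OF F _ t]) (use F0 box in blast)
    moreover have "(\<lambda>z. gauss t (z - y) * F z) = (\<lambda>z. K x z s * (\<phi> z * gauss t (z - y)))"
      by (simp add: F_def fun_eq_iff)
    ultimately show ?thesis by simp
  qed
  have "\<phi> x * gauss t (x - y) \<le> K x y t"
  proof (rule tendsto_le)
    have "((\<lambda>s. s + t) \<longlongrightarrow> 0 + t) (at_right 0)"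
      by (rule tendsto_add[OF tendsto_ident_at tendsto_const])
    then have lim: "((\<lambda>s. s + t) \<longlongrightarrow> t) (at_right 0)" by simp
    show "((\<lambda>s. K x y (s + t)) \<longlongrightarrow> K x y t) (at_right 0)"
      by (rule isCont_tendsto_compose[OF Kt[OF t] lim])
    show "((\<lambda>s. \<integral>z. K x z s * (\<phi> z * gauss t (z - y)) \<partial>lborel) \<longlongrightarrow> \<phi> x * gauss t (x - y)) (at_right 0)"
    proof (rule fundamental_init[OF K])
      show "continuous_on UNIV (\<lambda>z. \<phi> z * gauss t (z - y))"
        by (intro continuous_intros \<phi>c) (use t in auto)
      have "closure {z. \<phi> z * gauss t (z - y) \<noteq> 0} \<subseteq> cball x 1"
        by (rule closure_minimal) (use \<phi>0 in force, simp)
      then show "compact (closure {z. \<phi> z * gauss t (z - y) \<noteq> 0})"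
        using bounded_subset[OF bounded_cball] by (simp add: compact_eq_bounded_closed)
    qed
    show "eventually (\<lambda>s. (\<integral>z. K x z s * (\<phi> z * gauss t (z - y)) \<partial>lborel) \<le> K x y (s + t)) (at_right 0)"
      using eventually_at_right_less[of 0] by eventually_elim (rule averaged)
  qed simp
  then show ?thesis using \<phi>(3) gauss_minus[of t "y - x"] by simp
qed

theorem euclidean_heat_kernel_eq_gauss:
  fixes H0 :: "real^'n::finite \<Rightarrow> real^'n \<Rightarrow> real \<Rightarrow> real"
  assumes "heat_kernel euclidean_atlas flat_metric H0" and t: "0 < t"
  shows "H0 x y t = gauss t (y - x)"
proof (rule antisym)
  show "H0 x y t \<le> gauss t (y - x)"
    using assms gauss_fundamental_solution[where 'n='n] unfolding heat_kernel_def by blast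
  show "gauss t (y - x) \<le> H0 x y t"
    using assms(1) unfolding heat_kernel_def by (intro gauss_minimal t) blast
qed

section \<open>The comparison theorem\<close>

lemma comparison_radius_pos:
  assumes "0 < \<delta>" "0 < t"
  shows "0 < comparison_radius D \<delta> t"
proof -
  have "D \<le> sqrt (D\<^sup>2)" by simp
  also have "\<dots> < sqrt (D\<^sup>2 + 4 * \<delta> * t)"
    by (rule real_sqrt_less_mono) (use assms in simp)
  finally show ?thesis by (simp add: comparison_radius_def)
qed

lemma comparison_radius_tendsto_0:
  assumes "0 \<le> D"
  shows "((\<lambda>\<delta>. comparison_radius D \<delta> t) \<longlongrightarrow> 0) (at_right 0)"
proof -
  have "((\<lambda>\<delta>. (sqrt (D\<^sup>2 + 4 * \<delta> * t) - D) / 2) \<longlongrightarrow> (sqrt (D\<^sup>2 + 4 * 0 * t) - D) / 2) (at_right 0)"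
    by (intro tendsto_divide tendsto_diff tendsto_real_sqrt tendsto_add tendsto_mult tendsto_const tendsto_ident_at) simp
  then show ?thesis using assms by (simp add: comparison_radius_def)
qed

text \<open>
  As \<open>\<delta> \<rightarrow> 0\<close> the radius tends to \<open>0\<close>, so the ratio of the volumes eventually exceeds any number
  below \<open>1\<close>, while \<open>exp (- \<delta>)\<close> tends to \<open>1\<close>.
\<close>

lemma comparison_bounds_imp_gaussian_bound:
  fixes A :: "('m::{t2_space, second_countable_topology}, 'n::finite) chart set"
  assumes M: "riemannian_manifold A g" and con: "connected (UNIV :: 'm set)"
    and D: "0 \<le> D" and t: "0 < t" and E: "0 \<le> E"
    and bound: "\<And>\<delta>. 0 < \<delta> \<Longrightarrow> exp (- \<delta>)
             * (measure lborel (ball (0 :: real ^ 'n) (comparison_radius D \<delta> t))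
                / measure (riemannian_volume A g) (geodesic_ball A g x (comparison_radius D \<delta> t))) * E \<le> h"
  shows "E \<le> h"
proof -
  let ?R = "\<lambda>\<delta>. comparison_radius D \<delta> t"
  have almost: "(1 - e) ^ CARD('n) / (1 + e) * E \<le> h" if e: "0 < e" "e < 1" for e
  proof (rule tendsto_upperbound)
    let ?q = "(1 - e) ^ CARD('n) / (1 + e)"
    have "((\<lambda>\<delta>. exp (- \<delta>) * ?q * E) \<longlongrightarrow> exp (- 0) * ?q * E) (at_right (0::real))"
      by (intro tendsto_mult tendsto_exp tendsto_minus tendsto_ident_at tendsto_const)
    then show "((\<lambda>\<delta>. exp (- \<delta>) * ?q * E) \<longlongrightarrow> ?q * E) (at_right (0::real))" by simp
    obtain r0 where r0: "0 < r0"
      "\<And>r. 0 < r \<Longrightarrow> r < r0 \<Longrightarrow> 0 < measure (riemannian_volume A g) (geodesic_ball A g x r)"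
      "\<And>r. 0 < r \<Longrightarrow> r < r0 \<Longrightarrow> measure (riemannian_volume A g) (geodesic_ball A g x r)
        \<le> (1 + e) / (1 - e) ^ CARD('n) * measure lborel (ball (0 :: real^'n) r)"
      using small_geodesic_ball_volume[OF M con e, of x] by blast
    have small: "eventually (\<lambda>\<delta>. ?R \<delta> < r0) (at_right 0)"
      by (rule order_tendstoD(2)[OF comparison_radius_tendsto_0[OF D] r0(1)])
    have pos: "eventually (\<lambda>\<delta>. (0::real) < \<delta>) (at_right 0)" by (rule eventually_at_right_less)
    from small pos show "eventually (\<lambda>\<delta>. exp (- \<delta>) * ?q * E \<le> h) (at_right 0)"
    proof eventually_elim
      case (elim \<delta>)
      let ?V = "measure (riemannian_volume A g) (geodesic_ball A g x (?R \<delta>))"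
      let ?U = "measure lborel (ball (0 :: real^'n) (?R \<delta>))"
      have R: "0 < ?R \<delta>" by (rule comparison_radius_pos[OF elim(2) t])
      have V: "0 < ?V" by (rule r0(2)[OF R elim(1)])
      have p: "0 < (1 - e) ^ CARD('n)" "0 < 1 + e" using e by auto
      have "?V \<le> (1 + e) / (1 - e) ^ CARD('n) * ?U" by (rule r0(3)[OF R elim(1)])
      then have "?q * ?V \<le> ?U" using p by (simp add: field_simps)
      then have "?q \<le> ?U / ?V" using V by (simp add: pos_le_divide_eq)
      then have "exp (- \<delta>) * ?q * E \<le> exp (- \<delta>) * (?U / ?V) * E"
        using E by (intro mult_right_mono mult_left_mono) auto
      also have "\<dots> \<le> h" by (rule bound[OF elim(2)])
      finally show ?case .
    qed
  qed simp
  have "((\<lambda>e. (1 - e) ^ CARD('n) / (1 + e) * E) \<longlongrightarrow> (1 - 0) ^ CARD('n) / (1 + 0) * E) (at_right (0::real))"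
    by (intro tendsto_mult tendsto_divide tendsto_power tendsto_diff tendsto_add tendsto_const tendsto_ident_at) simp
  then have lim: "((\<lambda>e. (1 - e) ^ CARD('n) / (1 + e) * E) \<longlongrightarrow> E) (at_right (0::real))" by simp
  have "eventually (\<lambda>e. (1 - e) ^ CARD('n) / (1 + e) * E \<le> h) (at_right (0::real))"
    using eventually_at_right_less[of 0] order_tendstoD(2)[OF tendsto_ident_at zero_less_one]
    by eventually_elim (rule almost)
  then show ?thesis by (rule tendsto_upperbound[OF lim]) simp
qed

theorem theorem3p1:
  fixes A :: "('m::{t2_space, second_countable_topology}, 'n::finite) chart set"
    and g :: "('m, 'n) metric_coeffs"
    and H :: "'m \<Rightarrow> 'm \<Rightarrow> real \<Rightarrow> real"
    and H0 :: "real ^ 'n \<Rightarrow> real ^ 'n \<Rightarrow> real \<Rightarrow> real"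
  defines "n \<equiv> real CARD('n)"
    and "d \<equiv> geodesic_dist A g"
  assumes "riemannian_manifold A g"
    and "connected (UNIV :: 'm set)"
    and "complete_riemannian A g"
    and "ricci_nonneg A g"
    and "heat_kernel A g H"
    and "heat_kernel euclidean_atlas flat_metric H0"
    and "\<And>\<delta> x y t. \<delta> > 0 \<Longrightarrow> t > 0 \<Longrightarrow>
           H x y t \<ge> exp (- \<delta>)
             * (measure lborel (ball (0 :: real ^ 'n) (comparison_radius (d x y) \<delta> t))
                / measure (riemannian_volume A g) (geodesic_ball A g x (comparison_radius (d x y) \<delta> t)))
             * (4 * pi * t) powr (- n / 2) * exp (- (d x y)\<^sup>2 / (4 * t))"
  shows "\<forall>x y t xbar ybar. t > 0 \<longrightarrow> dist xbar ybar = d x y \<longrightarrow>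
           H x y t \<ge> H0 xbar ybar t \<and>
           H0 xbar ybar t = (1 / (4 * pi * t)) powr (n / 2) * exp (- (d x y)\<^sup>2 / (4 * t))"
proof (intro allI impI)
  fix x y :: 'm and t :: real and xbar ybar :: "real^'n"
  assume t: "t > 0" and dist: "dist xbar ybar = d x y"
  have E: "H0 xbar ybar t = (4 * pi * t) powr (- n / 2) * exp (- (d x y)\<^sup>2 / (4 * t))"
    using euclidean_heat_kernel_eq_gauss[OF assms(8) t, of xbar ybar] dist
    by (simp add: gauss_def n_def dist_norm norm_minus_commute)
  have "H0 xbar ybar t \<le> H x y t"
    unfolding E
  proof (rule comparison_bounds_imp_gaussian_bound[OF assms(3,4) _ t])
    show "0 \<le> d x y" unfolding dist[symmetric] by simp
    show "exp (- \<delta>)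
             * (measure lborel (ball (0 :: real ^ 'n) (comparison_radius (d x y) \<delta> t))
                / measure (riemannian_volume A g) (geodesic_ball A g x (comparison_radius (d x y) \<delta> t)))
             * ((4 * pi * t) powr (- n / 2) * exp (- (d x y)\<^sup>2 / (4 * t))) \<le> H x y t" if "0 < \<delta>" for \<delta>
      using assms(9)[OF that t, of x y] by (simp only: mult.assoc)
  qed simp
  moreover have "(4 * pi * t) powr (- n / 2) = (1 / (4 * pi * t)) powr (n / 2)"
    using t by (simp add: powr_minus_divide powr_divide)
  ultimately show "H x y t \<ge> H0 xbar ybar t \<and>
           H0 xbar ybar t = (1 / (4 * pi * t)) powr (n / 2) * exp (- (d x y)\<^sup>2 / (4 * t))"
    using E by simp
qed

end
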